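(* There exist universal constants $C,c>0$ such that the following holds. Let $\kappa>0$ and set $$M=\lceil C\kappa^{-21}\rceil,\qquad \epsilon = c\,\kappa^7/M^2 .$$ Then for every $d\in\mathbb N$ and all unitaries $A,T\in U(d)$ such that $$\|A^2-1\|_{\mathrm{HS}}\le \epsilon\quad\text{and}\quad \|[A,T^{-i}AT^{i}]\|_{\mathrm{HS}}\le\epsilon\quad\text{for all } 0\le i\le 2M,$$ there exist unitaries $\widetilde A,\widetilde T\in U(d)$ such that $\widetilde A^2=1$, the unitary $\widetilde T^{-i}\widetilde A\widetilde T^{i}$ commutes with $\widetilde A$ for all $i\in\mathbb Z$, and $$\|A-\widetilde A\|_{\mathrm{HS}}\le\kappa,\qquad \|T-\widetilde T\|_{\mathrm{HS}}\le\kappa .$$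
   Context: $U(d)$ is the group of $d\times d$ complex unitary matrices. For $A\in M_d(\mathbb C)$, $\operatorname{tr}(A)=\frac1d\operatorname{Tr}(A)$ is the normalized trace and $\|A\|_{\mathrm{HS}}=\sqrt{\operatorname{tr}(A^*A)}$ is the normalized Hilbert--Schmidt norm. $[A,B]=AB-BA$. The constants $C,c$ do not depend on $\kappa$, $d$, $A$, $T$. *)

theory Defs
  imports Complex_Main "HOL-Algebra.Group" "Jordan_Normal_Form.Schur_Decomposition"
begin

text \<open>Matrices carry their dimension at the term level (\<^typ>\<open>complex mat\<close>), because the
  constants of the theorem must not depend on the dimension.\<close>

text \<open>Integer powers in \<open>U(d)\<close> are HOL-Algebra's powers \<open>T [^]\<^bsub>unitary_group d\<^esub> (i :: int)\<close>,
  where a negative exponent refers to the inverse in the group.\<close>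

definition unitary_group :: "nat \<Rightarrow> complex mat monoid" where
  "unitary_group d =
     \<lparr>carrier = {A \<in> carrier_mat d d. mat_adjoint A * A = 1\<^sub>m d \<and> A * mat_adjoint A = 1\<^sub>m d},
      monoid.mult = (*), one = 1\<^sub>m d\<rparr>"

definition ntr :: "complex mat \<Rightarrow> complex" where
  "ntr A = (1 / of_nat (dim_row A)) * (\<Sum>i<dim_row A. A $$ (i, i))"

text \<open>The number \<open>ntr (mat_adjoint A * A)\<close> is real and nonnegative, so taking the real part
  only changes the type.\<close>

definition hs_norm :: "complex mat \<Rightarrow> real" where
  "hs_norm A = sqrt (Re (ntr (mat_adjoint A * A)))"

definition commutator :: "complex mat \<Rightarrow> complex mat \<Rightarrow> complex mat" where
  "commutator A B = A * B - B * A"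

lemma mat_adjoint_dim [simp]:
  "dim_row (mat_adjoint A) = dim_col A" "dim_col (mat_adjoint A) = dim_row A"
  by (simp_all add: mat_adjoint_def)

lemma mat_adjoint_index:
  fixes A :: "complex mat"
  assumes "i < dim_col A" "j < dim_row A"
  shows "mat_adjoint A $$ (i, j) = cnj (A $$ (j, i))"
  using assms by (simp add: mat_adjoint_def mat_of_rows_index conjugate_complex_def)

lemma mat_adjoint_adjoint [simp]:
  fixes A :: "complex mat"
  shows "mat_adjoint (mat_adjoint A) = A"
  by (rule eq_matI) (simp_all add: mat_adjoint_index)

lemma mat_adjoint_mult:
  fixes A B :: "complex mat"
  assumes "A \<in> carrier_mat n m" "B \<in> carrier_mat m k"
  shows "mat_adjoint (A * B) = mat_adjoint B * mat_adjoint A"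
  by (rule eq_matI)
    (use assms in \<open>auto simp: mat_adjoint_index scalar_prod_def mult.commute intro!: sum.cong\<close>)

lemma mat_adjoint_one: "mat_adjoint (1\<^sub>m d :: complex mat) = 1\<^sub>m d"
  by (rule eq_matI) (auto simp: mat_adjoint_index)

lemma mat_adjoint_carrier:
  fixes A :: "complex mat"
  shows "A \<in> carrier_mat n m \<Longrightarrow> mat_adjoint A \<in> carrier_mat m n"
  by auto

lemma group_unitary_group: "group (unitary_group d)"
proof (rule groupI)
  fix A B assume "A \<in> carrier (unitary_group d)" "B \<in> carrier (unitary_group d)"
  then have A: "A \<in> carrier_mat d d" "mat_adjoint A * A = 1\<^sub>m d" "A * mat_adjoint A = 1\<^sub>m d"
    and B: "B \<in> carrier_mat d d" "mat_adjoint B * B = 1\<^sub>m d" "B * mat_adjoint B = 1\<^sub>m d"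
    by (simp_all add: unitary_group_def)
  note A' = mat_adjoint_carrier[OF A(1)] and B' = mat_adjoint_carrier[OF B(1)]
  have "mat_adjoint B * mat_adjoint A * (A * B) = mat_adjoint B * ((mat_adjoint A * A) * B)"
    using A(1) B(1) A' B' by (smt (verit) assoc_mult_mat mult_carrier_mat)
  moreover have "A * B * (mat_adjoint B * mat_adjoint A) = A * ((B * mat_adjoint B) * mat_adjoint A)"
    using A(1) B(1) A' B' by (smt (verit) assoc_mult_mat mult_carrier_mat)
  ultimately show "A \<otimes>\<^bsub>unitary_group d\<^esub> B \<in> carrier (unitary_group d)"
    using A B A' B' by (simp add: unitary_group_def mat_adjoint_mult)
next
  fix A assume "A \<in> carrier (unitary_group d)"
  then show "\<exists>B\<in>carrier (unitary_group d). B \<otimes>\<^bsub>unitary_group d\<^esub> A = \<one>\<^bsub>unitary_group d\<^esub>"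
    by (intro bexI[of _ "mat_adjoint A"]) (auto simp: unitary_group_def)
qed (auto simp: unitary_group_def mat_adjoint_one)

lemma inv_unitary_group:
  assumes "A \<in> carrier (unitary_group d)"
  shows "inv\<^bsub>unitary_group d\<^esub> A = mat_adjoint A"
  by (rule group.inv_equality[OF group_unitary_group])
    (use assms in \<open>auto simp: unitary_group_def\<close>)

end

theory Submission
  imports Defs "HOL-Analysis.Inner_Product" "HOL-Library.FuncSet"
begin

text \<open>Put \<open>A\<^sub>i = T\<^sup>-\<^sup>i A T\<^sup>i\<close>. The matrices in a long window of indices are almost
involutions and almost commute, and conjugation by \<open>T\<close> shifts the window. If the basis vectors of an
orthonormal basis are joint eigenvectors of involutions near the \<open>A\<^sub>i\<close>, then every basis vector \<open>a\<close>
carries a word \<open>x a\<close> of signs. The squared moduli of the entries of \<open>T\<close> in this basis form a doubly stochastic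
matrix, that is, a stationary random step \<open>b \<mapsto> a\<close>, and with high probability the word of \<open>a\<close> is the
word of \<open>b\<close> shifted by one letter. The pair is close to an exact model as soon as \<open>T\<close> is close to a
unitary that permutes the blocks of a decomposition into coordinate subspaces on each of which \<open>A\<close> is
close to a fixed sign: conjugates of a block-scalar matrix by a block permutation commute. Three
ingredients produce this situation.

\<^item> Simultaneous diagonalization (\<open>simultaneous_diagonalization\<close>). Measuring the signs of the \<open>A\<^sub>i\<close> one
  after the other yields positive matrices \<open>M\<^sub>w\<close>, indexed by words \<open>w\<close>, with sum 1. Since the \<open>A\<^sub>i\<close>
  almost commute, the \<open>i\<close>-th letter of the outcome reproduces \<open>A\<^sub>i\<close>, and a union bound over the letters
  shows that different \<open>M\<^sub>w\<close> are almost orthogonal. The eigenvectors of the \<open>M\<^sub>w\<close> with eigenvalue above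
  1/2 are then almost an orthonormal basis, which a polar decomposition makes orthonormal. The loss is
  polynomial in the number of letters.

\<^item> A cyclic label for every word (\<open>label\<close>, \<open>coding\<close>), computed from a window of the word, such that a
  shift of the word usually rotates the label. Cut times are chosen at random according to the block of
  letters at that time. Between two cuts a label is the whole stretch of letters with the current
  position marked by rotation; the stretch is closed up to a cycle, which costs only the density of the
  cuts. If no cut occurs for a long time, then with high probability the word repeats a long block soon,
  hence it is locally periodic, and its label is one period. Long runs without a cut are left rarely,
  because two exits are far apart.

\<^item> Rounding (\<open>equalize_orbits\<close>, \<open>masked_rounding\<close>). After a few indices are relabelled by fixed points of the
  rotation, the classes along every orbit of labels have the same size. Deleting the entries of \<open>T\<close> that do
  not respect the rotation changes \<open>T\<close> little, and the polar part of what remains is a unitary that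
  permutes the label classes.

The theorem \<open>fmat_stability\<close> combines them; the rest is the choice of the scales as powers of \<open>1/\<kappa>\<close>, which
the hypotheses on \<open>M\<close> and \<open>\<epsilon>\<close> leave room for, and a translation of the matrix notions.\<close>

section \<open>Finitely supported complex matrices\<close>

text \<open>Matrices of all sizes live in one type, where multiplication is an operation of a ring and the
Hilbert--Schmidt inner product is an instance of \<^class>\<open>real_inner\<close>. The \<open>d \<times> d\<close> matrices are the
elements supported in the upper left corner. This makes ring and inner product automation available
although the dimension is a variable, and the embedding of \<open>U(n)\<close> into \<open>U(n + 1)\<close> is the addition of a
diagonal unit.\<close>

typedef fmat = "{f :: nat \<Rightarrow> nat \<Rightarrow> complex. \<exists>n. \<forall>i j. f i j \<noteq> 0 \<longrightarrow> i < n \<and> j < n}"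
  morphisms entry Fmat
  by (rule exI[of _ "\<lambda>_ _. 0"]) simp

setup_lifting type_definition_fmat

definition bnd :: "nat \<Rightarrow> fmat \<Rightarrow> bool" where
  "bnd n x \<longleftrightarrow> (\<forall>i j. entry x i j \<noteq> 0 \<longrightarrow> i < n \<and> j < n)"

lemma bnd_ex: "\<exists>n. bnd n x"
  using entry[of x] by (auto simp: bnd_def)

lemma bnd_mono: "bnd n x \<Longrightarrow> n \<le> m \<Longrightarrow> bnd m x"
  unfolding bnd_def by (meson order_less_le_trans)

lemma bnd_ex2: obtains n where "bnd n x" "bnd n y"
proof -
  obtain n m where "bnd n x" "bnd m y" using bnd_ex by blast
  then have "bnd (max n m) x" "bnd (max n m) y" by (auto intro: bnd_mono)
  then show ?thesis using that by blast
qed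

lemma bnd_ex3: obtains n where "bnd n x" "bnd n y" "bnd n z"
proof -
  obtain n m where "bnd n x" "bnd n y" "bnd m z" using bnd_ex bnd_ex2 by metis
  then have "bnd (max n m) x" "bnd (max n m) y" "bnd (max n m) z" by (auto intro: bnd_mono)
  then show ?thesis using that by blast
qed

lemma fmat_eqI: "(\<And>i j. entry x i j = entry y i j) \<Longrightarrow> x = y"
  by (metis entry_inject ext)

lemma entry_zero_left: "bnd n x \<Longrightarrow> n \<le> i \<Longrightarrow> entry x i j = 0"
  and entry_zero_right: "bnd n x \<Longrightarrow> n \<le> j \<Longrightarrow> entry x i j = 0"
  unfolding bnd_def by (meson linorder_not_less)+

instantiation fmat :: ring
begin

lift_definition zero_fmat :: fmat is "\<lambda>_ _. 0" by simp
lift_definition plus_fmat :: "fmat \<Rightarrow> fmat \<Rightarrow> fmat" is "\<lambda>f g i j. f i j + g i j"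
proof -
  fix f g :: "nat \<Rightarrow> nat \<Rightarrow> complex"
  assume "\<exists>n. \<forall>i j. f i j \<noteq> 0 \<longrightarrow> i < n \<and> j < n" "\<exists>n. \<forall>i j. g i j \<noteq> 0 \<longrightarrow> i < n \<and> j < n"
  then obtain n m where "\<forall>i j. f i j \<noteq> 0 \<longrightarrow> i < n \<and> j < n" "\<forall>i j. g i j \<noteq> 0 \<longrightarrow> i < m \<and> j < m" by blast
  then show "\<exists>n. \<forall>i j. f i j + g i j \<noteq> 0 \<longrightarrow> i < n \<and> j < n"
    by (intro exI[of _ "max n m"]) (metis add.right_neutral less_max_iff_disj add_0)
qed
lift_definition uminus_fmat :: "fmat \<Rightarrow> fmat" is "\<lambda>f i j. - f i j" by simp
lift_definition minus_fmat :: "fmat \<Rightarrow> fmat \<Rightarrow> fmat" is "\<lambda>f g i j. f i j - g i j"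
proof -
  fix f g :: "nat \<Rightarrow> nat \<Rightarrow> complex"
  assume "\<exists>n. \<forall>i j. f i j \<noteq> 0 \<longrightarrow> i < n \<and> j < n" "\<exists>n. \<forall>i j. g i j \<noteq> 0 \<longrightarrow> i < n \<and> j < n"
  then obtain n m where "\<forall>i j. f i j \<noteq> 0 \<longrightarrow> i < n \<and> j < n" "\<forall>i j. g i j \<noteq> 0 \<longrightarrow> i < m \<and> j < m" by blast
  then show "\<exists>n. \<forall>i j. f i j - g i j \<noteq> 0 \<longrightarrow> i < n \<and> j < n"
    by (intro exI[of _ "max n m"]) (metis diff_self less_max_iff_disj)
qed
lift_definition times_fmat :: "fmat \<Rightarrow> fmat \<Rightarrow> fmat"
  is "\<lambda>f g i j. \<Sum>k\<in>{k. f i k \<noteq> 0}. f i k * g k j"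
proof -
  fix f g :: "nat \<Rightarrow> nat \<Rightarrow> complex"
  assume "\<exists>n. \<forall>i j. f i j \<noteq> 0 \<longrightarrow> i < n \<and> j < n" "\<exists>n. \<forall>i j. g i j \<noteq> 0 \<longrightarrow> i < n \<and> j < n"
  then obtain n m where nm: "\<forall>i j. f i j \<noteq> 0 \<longrightarrow> i < n \<and> j < n" "\<forall>i j. g i j \<noteq> 0 \<longrightarrow> i < m \<and> j < m" by blast
  show "\<exists>n. \<forall>i j. (\<Sum>k\<in>{k. f i k \<noteq> 0}. f i k * g k j) \<noteq> 0 \<longrightarrow> i < n \<and> j < n"
  proof (intro exI[of _ "max n m"] allI impI)
    fix i j assume "(\<Sum>k\<in>{k. f i k \<noteq> 0}. f i k * g k j) \<noteq> 0"
    then obtain k where "f i k * g k j \<noteq> 0" by (meson sum.neutral)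
    then show "i < max n m \<and> j < max n m" using nm by (auto simp: less_max_iff_disj)
  qed
qed

lemma entry_mult_left:
  assumes "bnd n x" shows "entry (x * y) i j = (\<Sum>k<n. entry x i k * entry y k j)"
  unfolding times_fmat.rep_eq
  by (rule sum.mono_neutral_left) (use assms in \<open>auto simp: bnd_def\<close>)

instance
proof
  fix a b c :: fmat
  show "a + b + c = a + (b + c)" by transfer (simp add: add.assoc)
  show "a + b = b + a" by transfer (simp add: add.commute)
  show "0 + a = a" by transfer simp
  show "- a + a = 0" by transfer simp
  show "a - b = a + - b" by transfer simp
  obtain n where n: "bnd n a" "bnd n b" using bnd_ex2 by metis
  have nab: "bnd n (a * b)"
    unfolding bnd_def
  proof (intro allI impI)
    fix i j assume "entry (a * b) i j \<noteq> 0"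
    then obtain k where "entry a i k * entry b k j \<noteq> 0"
      unfolding entry_mult_left[OF n(1)] by (meson sum.neutral)
    then show "i < n \<and> j < n" using n by (auto simp: bnd_def)
  qed
  have nab': "bnd n (a + b)"
    using n unfolding bnd_def plus_fmat.rep_eq by (metis add.right_neutral)
  show "a * b * c = a * (b * c)"
  proof (rule fmat_eqI)
    fix i j
    have "entry (a * b * c) i j = (\<Sum>k<n. (\<Sum>l<n. entry a i l * entry b l k) * entry c k j)"
      unfolding entry_mult_left[OF nab] entry_mult_left[OF n(1)] ..
    also have "\<dots> = (\<Sum>k<n. \<Sum>l<n. entry a i l * (entry b l k * entry c k j))"
      by (simp add: sum_distrib_right mult.assoc)
    also have "\<dots> = (\<Sum>l<n. \<Sum>k<n. entry a i l * (entry b l k * entry c k j))"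
      by (rule sum.swap)
    also have "\<dots> = entry (a * (b * c)) i j"
      unfolding entry_mult_left[OF n(1)] entry_mult_left[OF n(2)] by (simp add: sum_distrib_left)
    finally show "entry (a * b * c) i j = entry (a * (b * c)) i j" .
  qed
  show "(a + b) * c = a * c + b * c"
    by (rule fmat_eqI)
      (simp add: entry_mult_left[OF nab'] entry_mult_left[OF n(1)] entry_mult_left[OF n(2)]
        plus_fmat.rep_eq distrib_right sum.distrib)
  show "c * (a + b) = c * a + c * b"
  proof (rule fmat_eqI)
    fix i j
    obtain m where m: "bnd m c" using bnd_ex by blast
    show "entry (c * (a + b)) i j = entry (c * a + c * b) i j"
      by (simp add: entry_mult_left[OF m] plus_fmat.rep_eq distrib_left sum.distrib)
  qed
qed

end

lemmas entry_simps [simp] = zero_fmat.rep_eq plus_fmat.rep_eq uminus_fmat.rep_eq minus_fmat.rep_eq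

lemma bnd_mult: "bnd n x \<Longrightarrow> bnd n y \<Longrightarrow> bnd n (x * y)"
  unfolding bnd_def
proof (intro allI impI)
  fix i j assume n: "\<forall>i j. entry x i j \<noteq> 0 \<longrightarrow> i < n \<and> j < n" "\<forall>i j. entry y i j \<noteq> 0 \<longrightarrow> i < n \<and> j < n"
    and "entry (x * y) i j \<noteq> 0"
  then obtain k where "entry x i k * entry y k j \<noteq> 0"
    unfolding times_fmat.rep_eq by (meson sum.neutral)
  then show "i < n \<and> j < n" using n by auto
qed

lemma bnd_add: "bnd n x \<Longrightarrow> bnd n y \<Longrightarrow> bnd n (x + y)"
  unfolding bnd_def plus_fmat.rep_eq by (metis add.right_neutral)
lemma bnd_diff: "bnd n x \<Longrightarrow> bnd n y \<Longrightarrow> bnd n (x - y)"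
  unfolding bnd_def minus_fmat.rep_eq by (metis diff_self)
lemma bnd_zero: "bnd n 0" by (simp add: bnd_def)
lemma bnd_sum: "(\<And>i. i \<in> S \<Longrightarrow> bnd n (f i)) \<Longrightarrow> bnd n (sum f S)"
  by (induction S rule: infinite_finite_induct) (auto intro: bnd_zero bnd_add)

lemma entry_sum: "entry (sum f S) i j = (\<Sum>s\<in>S. entry (f s) i j)"
  by (induction S rule: infinite_finite_induct) auto

lemma entry_mult_right:
  assumes "bnd n y" shows "entry (x * y) i j = (\<Sum>k<n. entry x i k * entry y k j)"
proof -
  obtain m where m: "bnd m x" "n \<le> m" by (metis bnd_ex bnd_mono linorder_le_cases)
  have "entry (x * y) i j = (\<Sum>k<m. entry x i k * entry y k j)" by (rule entry_mult_left[OF m(1)])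
  also have "\<dots> = (\<Sum>k<n. entry x i k * entry y k j)"
    by (rule sum.mono_neutral_right) (use m assms in \<open>auto simp: entry_zero_left\<close>)
  finally show ?thesis .
qed

instantiation fmat :: real_vector
begin

lift_definition scaleR_fmat :: "real \<Rightarrow> fmat \<Rightarrow> fmat" is "\<lambda>r f i j. r *\<^sub>R f i j"
  by (metis scaleR_zero_right)

instance
proof
  fix x y z :: fmat and r s :: real
  show "r *\<^sub>R (x + y) = r *\<^sub>R x + r *\<^sub>R y" by transfer (simp add: scaleR_add_right)
  show "(r + s) *\<^sub>R x = r *\<^sub>R x + s *\<^sub>R x" by transfer (simp add: scaleR_add_left)
  show "r *\<^sub>R s *\<^sub>R x = (r * s) *\<^sub>R x" by transfer simp
  show "1 *\<^sub>R x = x" by transfer simp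
qed

end

lemma Re_cnj_mult_self: "Re (cnj z * z) = (cmod z)\<^sup>2"
  using cmod_power2[of z] by (simp add: power2_eq_square[of "Re z"] power2_eq_square[of "Im z"])

text \<open>The inner product is the real part of the unnormalized trace of \<open>x\<^sup>* y\<close>, so the norm of a matrix of
size \<open>d\<close> is \<open>sqrt d\<close> times its normalized Hilbert--Schmidt norm.\<close>

instantiation fmat :: real_inner
begin

definition inner_fmat :: "fmat \<Rightarrow> fmat \<Rightarrow> real" where
  "inner x y = (let n = (LEAST n. bnd n x) in \<Sum>i<n. \<Sum>j<n. Re (cnj (entry x i j) * entry y i j))"
definition norm_fmat :: "fmat \<Rightarrow> real" where "norm x = sqrt (inner x x)" for x :: fmat
definition sgn_fmat :: "fmat \<Rightarrow> fmat" where "sgn x = x /\<^sub>R norm x" for x :: fmat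
definition dist_fmat :: "fmat \<Rightarrow> fmat \<Rightarrow> real" where "dist x y = norm (x - y)" for x y :: fmat
definition uniformity_fmat :: "(fmat \<times> fmat) filter"
  where "uniformity = (INF e\<in>{0 <..}. principal {(x, y :: fmat). dist x y < e})"
definition open_fmat :: "fmat set \<Rightarrow> bool"
  where "open U \<longleftrightarrow> (\<forall>x\<in>U. \<forall>\<^sub>F (x', y) in uniformity. x' = x \<longrightarrow> y \<in> U)" for U :: "fmat set"

lemma inner_fmat_left:
  assumes "bnd n x"
  shows "inner x y = (\<Sum>i<n. \<Sum>j<n. Re (cnj (entry x i j) * entry y i j))"
proof -
  define m where "m = (LEAST n. bnd n x)"
  have m: "bnd m x" unfolding m_def using bnd_ex by (rule LeastI_ex)
  have "m \<le> n" unfolding m_def using assms by (rule Least_le)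
  have "inner x y = (\<Sum>i<m. \<Sum>j<m. Re (cnj (entry x i j) * entry y i j))"
    by (simp add: inner_fmat_def m_def Let_def)
  also have "\<dots> = (\<Sum>i<m. \<Sum>j<n. Re (cnj (entry x i j) * entry y i j))"
    by (intro sum.cong refl sum.mono_neutral_left) (use \<open>m \<le> n\<close> m in \<open>auto simp: entry_zero_right\<close>)
  also have "\<dots> = (\<Sum>i<n. \<Sum>j<n. Re (cnj (entry x i j) * entry y i j))"
    by (intro sum.mono_neutral_left) (use \<open>m \<le> n\<close> m in \<open>auto simp: entry_zero_left\<close>)
  finally show ?thesis .
qed

instance
proof
  fix x y z :: fmat and r s :: real
  show "dist x y = norm (x - y)" by (rule dist_fmat_def)
  show "sgn x = x /\<^sub>R norm x" by (rule sgn_fmat_def)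
  show "uniformity = (INF e\<in>{0 <..}. principal {(x, y :: fmat). dist x y < e})" by (rule uniformity_fmat_def)
  show "open U \<longleftrightarrow> (\<forall>x\<in>U. \<forall>\<^sub>F (x', y) in uniformity. x' = x \<longrightarrow> y \<in> U)" for U :: "fmat set"
    by (rule open_fmat_def)
  obtain n where n: "bnd n x" "bnd n y" "bnd n z" using bnd_ex3 by metis
  show "inner x y = inner y x"
    by (simp add: inner_fmat_left[OF n(1)] inner_fmat_left[OF n(2)] mult.commute)
  show "inner (x + y) z = inner x z + inner y z"
    by (simp add: inner_fmat_left[OF bnd_add[OF n(1,2)]] inner_fmat_left[OF n(1)] inner_fmat_left[OF n(2)]
       sum.distrib algebra_simps)
  have "bnd n (r *\<^sub>R x)" using n(1) by (auto simp: bnd_def scaleR_fmat.rep_eq)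
  then show "inner (r *\<^sub>R x) y = r * inner x y"
    by (simp add: inner_fmat_left[OF n(1)] inner_fmat_left scaleR_fmat.rep_eq sum_distrib_left algebra_simps)
  show "0 \<le> inner x x"
    unfolding inner_fmat_left[OF n(1)] by (intro sum_nonneg) auto
  show "inner x x = 0 \<longleftrightarrow> x = 0"
  proof
    assume "inner x x = 0"
    then have "(\<Sum>i<n. \<Sum>j<n. (cmod (entry x i j))\<^sup>2) = 0"
      unfolding inner_fmat_left[OF n(1)] by (simp only: Re_cnj_mult_self)
    then have "\<forall>i<n. \<forall>j<n. entry x i j = 0"
      by (simp add: sum_nonneg_eq_0_iff sum_nonneg)
    then show "x = 0"
      by (intro fmat_eqI) (metis bnd_def n(1) zero_fmat.rep_eq)
  qed (simp add: inner_fmat_left[OF bnd_zero[of 0]])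
  show "norm x = sqrt (inner x x)" by (rule norm_fmat_def)
qed

end

lemma entry_scaleR [simp]: "entry (r *\<^sub>R x) i j = complex_of_real r * entry x i j"
  by (simp add: scaleR_fmat.rep_eq scaleR_conv_of_real)

lemma bnd_scaleR: "bnd n x \<Longrightarrow> bnd n (r *\<^sub>R x)"
  by (auto simp: bnd_def)

lemma scaleR_mult_left [simp]: "(r *\<^sub>R x) * y = r *\<^sub>R (x * y)" for x y :: fmat
proof (rule fmat_eqI)
  fix i j obtain n where n: "bnd n x" using bnd_ex by blast
  show "entry (r *\<^sub>R x * y) i j = entry (r *\<^sub>R (x * y)) i j"
    by (simp add: entry_mult_left[OF n] entry_mult_left[OF bnd_scaleR[OF n]] sum_distrib_left mult.assoc)
qed

lemma scaleR_mult_right [simp]: "x * (r *\<^sub>R y) = r *\<^sub>R (x * y)" for x y :: fmat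
proof (rule fmat_eqI)
  fix i j obtain n where n: "bnd n x" using bnd_ex by blast
  show "entry (x * (r *\<^sub>R y)) i j = entry (r *\<^sub>R (x * y)) i j"
    by (simp add: entry_mult_left[OF n] sum_distrib_left mult.left_commute)
qed

lift_definition adj :: "fmat \<Rightarrow> fmat" is "\<lambda>f i j. cnj (f j i)" by auto

lemmas entry_adj [simp] = adj.rep_eq

lemma bnd_adj: "bnd n x \<Longrightarrow> bnd n (adj x)" by (auto simp: bnd_def)

lemma adj_adj [simp]: "adj (adj x) = x" by (rule fmat_eqI) simp
lemma adj_zero [simp]: "adj 0 = 0" by (rule fmat_eqI) simp
lemma adj_add: "adj (x + y) = adj x + adj y" by (rule fmat_eqI) simp
lemma adj_diff: "adj (x - y) = adj x - adj y" by (rule fmat_eqI) simp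
lemma adj_scaleR: "adj (r *\<^sub>R x) = r *\<^sub>R adj x" by (rule fmat_eqI) simp
lemma adj_sum: "adj (sum f S) = (\<Sum>s\<in>S. adj (f s))" by (rule fmat_eqI) (simp add: entry_sum)
lemma adj_mult: "adj (x * y) = adj y * adj x"
proof (rule fmat_eqI)
  fix i j obtain n where n: "bnd n x" "bnd n y" using bnd_ex2 by metis
  show "entry (adj (x * y)) i j = entry (adj y * adj x) i j"
    by (simp add: entry_mult_left[OF n(1)] entry_mult_left[OF bnd_adj[OF n(2)]] mult.commute)
qed
lemmas adj_simps = adj_add adj_diff adj_scaleR adj_sum adj_mult

lemma inner_adj: "inner (adj x) (adj y) = inner x y"
proof -
  obtain n where n: "bnd n x" using bnd_ex by blast
  show ?thesis unfolding inner_fmat_left[OF n] inner_fmat_left[OF bnd_adj[OF n]]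
    by (subst sum.swap) simp
qed

lemma norm_adj [simp]: "norm (adj x) = norm x"
  by (simp add: norm_fmat_def inner_adj)

lemma inner_mult_left: "inner (x * y) z = inner y (adj x * z)"
proof -
  obtain n where n: "bnd n x" "bnd n y" "bnd n z" using bnd_ex3 by metis
  have "inner (x * y) z = (\<Sum>i<n. \<Sum>j<n. \<Sum>k<n. Re (cnj (entry x i k * entry y k j) * entry z i j))"
    unfolding inner_fmat_left[OF bnd_mult[OF n(1,2)]] entry_mult_left[OF n(1)]
    by (simp add: sum_distrib_right)
  also have "\<dots> = (\<Sum>k<n. \<Sum>j<n. \<Sum>i<n. Re (cnj (entry x i k * entry y k j) * entry z i j))"
    by (subst (2) sum.swap, subst sum.swap, subst (2) sum.swap) simp
  also have "\<dots> = inner y (adj x * z)"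
    unfolding inner_fmat_left[OF n(2)] entry_mult_left[OF bnd_adj[OF n(1)]]
    by (simp add: sum_distrib_left mult.assoc mult.left_commute)
  finally show ?thesis .
qed

lemma inner_mult_right: "inner (x * y) z = inner x (z * adj y)"
proof -
  have "inner (x * y) z = inner (adj y * adj x) (adj z)" by (metis adj_mult inner_adj)
  also have "\<dots> = inner (adj x) (adj (z * adj y))" by (simp add: inner_mult_left adj_mult)
  finally show ?thesis by (simp add: inner_adj)
qed

section \<open>Unitary and diagonal matrices\<close>

text \<open>The unit of the matrices of size \<open>d\<close>.\<close>

lift_definition e :: "nat \<Rightarrow> fmat" is "\<lambda>d i j. if i = j \<and> i < d then 1 else 0"
  by auto

lemmas entry_e = e.rep_eq

lemma bnd_e [simp]: "bnd d (e d)" by (auto simp: bnd_def entry_e)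
lemma adj_e [simp]: "adj (e d) = e d" by (rule fmat_eqI) (auto simp: entry_e)

lemma e_mult: assumes "bnd d x" shows "e d * x = x" "x * e d = x"
proof -
  have 1: "e d * x = x" if "bnd d x" for x
    by (rule fmat_eqI) (use that in \<open>auto simp: entry_mult_left[OF bnd_e] entry_e if_distrib[of "\<lambda>z. z * _"]
        entry_zero_left sum.delta cong: if_cong conj_cong\<close>)
  show "e d * x = x" using 1 assms .
  show "x * e d = x" using arg_cong[OF 1[OF bnd_adj[OF assms]], of adj] by (simp add: adj_mult)
qed

lemma inner_e: "inner (e d) (e d) = d"
proof -
  have "inner (e d) (e d) = (\<Sum>i<d. \<Sum>j<d. if i = j then 1 else 0)"
    unfolding inner_fmat_left[OF bnd_e] by (intro sum.cong refl) (auto simp: entry_e)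
  then show ?thesis by simp
qed

definition uni :: "nat \<Rightarrow> fmat set" where
  "uni d = {u. bnd d u \<and> adj u * u = e d \<and> u * adj u = e d}"

lemma uniD: "u \<in> uni d \<Longrightarrow> bnd d u" "u \<in> uni d \<Longrightarrow> adj u * u = e d" "u \<in> uni d \<Longrightarrow> u * adj u = e d"
  by (auto simp: uni_def)

lemma uni_cancel:
  assumes "u \<in> uni d" "bnd d x"
  shows "adj u * (u * x) = x" "u * (adj u * x) = x" "x * u * adj u = x" "x * adj u * u = x"
  using assms by (simp_all add: uniD e_mult mult.assoc flip: mult.assoc[of u "adj u"] mult.assoc[of "adj u" u])

lemma adj_uni: "u \<in> uni d \<Longrightarrow> adj u \<in> uni d" by (auto simp: uni_def intro: bnd_adj)
lemma e_uni: "e d \<in> uni d" by (simp add: uni_def e_mult)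
lemma mult_uni: assumes "u \<in> uni d" "v \<in> uni d" shows "u * v \<in> uni d"
proof -
  have "adj (u * v) * (u * v) = adj v * (adj u * (u * v))" by (simp add: adj_mult mult.assoc)
  moreover have "(u * v) * adj (u * v) = u * (v * (adj v * adj u))" by (simp add: adj_mult mult.assoc)
  ultimately show ?thesis
    using assms uni_cancel(1)[OF assms(1) uniD(1)[OF assms(2)]]
      uni_cancel(2)[OF assms(2) bnd_adj[OF uniD(1)[OF assms(1)]]]
    by (simp add: uni_def bnd_mult)
qed

lemma inner_uni_left:
  assumes "u \<in> uni d" "bnd d y" shows "inner (u * x) (u * y) = inner x y"
  by (simp add: inner_mult_left uni_cancel[OF assms])
lemma inner_uni_right:
  assumes "u \<in> uni d" "bnd d y" shows "inner (x * u) (y * u) = inner x y"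
  by (simp add: inner_mult_right uni_cancel[OF assms])
lemma norm_uni_left [simp]: "u \<in> uni d \<Longrightarrow> bnd d x \<Longrightarrow> norm (u * x) = norm x"
  by (simp add: norm_fmat_def inner_uni_left)
lemma norm_uni_right [simp]: "u \<in> uni d \<Longrightarrow> bnd d x \<Longrightarrow> norm (x * u) = norm x"
  by (simp add: norm_fmat_def inner_uni_right)
lemma norm_e: "norm (e d) = sqrt d" by (simp add: norm_fmat_def inner_e)
lemma norm_uni: "u \<in> uni d \<Longrightarrow> norm u = sqrt d"
  using norm_uni_left[of u d "e d"] by (simp add: norm_e e_mult uniD)

text \<open>The projection \<open>u u\<^sup>*\<close> has the same trace as \<open>u\<^sup>* u = e d\<close>, so its distance to \<open>e d\<close> vanishes.\<close>

lemma uniI_left: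
  assumes "bnd d u" "adj u * u = e d" shows "u \<in> uni d"
proof -
  let ?p = "u * adj u"
  have "inner (e d) ?p = d"
    by (metis assms inner_adj adj_adj adj_mult inner_commute inner_e inner_mult_left e_mult(1) bnd_adj inner_mult_right)
  moreover have "inner ?p ?p = d"
    by (metis assms e_mult(2) inner_e inner_mult_left mult.assoc adj_mult adj_adj bnd_adj inner_mult_right calculation inner_commute)
  ultimately have "inner (e d - ?p) (e d - ?p) = 0"
    by (simp add: inner_diff_left inner_diff_right inner_e inner_commute)
  then show ?thesis using assms by (simp add: uni_def)
qed

lift_definition diag :: "nat \<Rightarrow> (nat \<Rightarrow> real) \<Rightarrow> fmat"
  is "\<lambda>d f i j. if i = j \<and> i < d then complex_of_real (f i) else 0"
  by (metis (full_types))

lemmas entry_diag = diag.rep_eq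
lemma bnd_diag [simp]: "bnd d (diag d f)" by (auto simp: bnd_def entry_diag)
lemma adj_diag [simp]: "adj (diag d f) = diag d f" by (rule fmat_eqI) (auto simp: entry_diag)
lemma entry_mult_diag: "entry (x * diag d f) i j = (if j < d then entry x i j * f j else 0)"
  by (auto simp: entry_mult_right[OF bnd_diag] entry_diag if_distrib sum.delta' cong: if_cong conj_cong)
lemma entry_diag_mult: "entry (diag d f * x) i j = (if i < d then f i * entry x i j else 0)"
  by (auto simp: entry_mult_left[OF bnd_diag] entry_diag if_distrib[of "\<lambda>z. z * _"] sum.delta cong: if_cong conj_cong)
lemma diag_mult_diag: "diag d f * diag d g = diag d (\<lambda>i. f i * g i)"
  by (rule fmat_eqI) (auto simp: entry_mult_diag entry_diag)
lemma diag_cong: "(\<And>i. i < d \<Longrightarrow> f i = g i) \<Longrightarrow> diag d f = diag d g"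
  by (rule fmat_eqI) (auto simp: entry_diag)
lemma diag_const_one: "diag d (\<lambda>_. 1) = e d"
  by (rule fmat_eqI) (auto simp: entry_diag entry_e)
lemma diag_diff: "diag d f - diag d g = diag d (\<lambda>i. f i - g i)"
  by (rule fmat_eqI) (auto simp: entry_diag)

lemma inner_self: "bnd d x \<Longrightarrow> inner x x = (\<Sum>i<d. \<Sum>j<d. (cmod (entry x i j))\<^sup>2)"
  by (simp only: inner_fmat_left Re_cnj_mult_self)

lemma norm_sq: "bnd d x \<Longrightarrow> (norm x)\<^sup>2 = (\<Sum>i<d. \<Sum>j<d. (cmod (entry x i j))\<^sup>2)"
  by (simp add: inner_self power2_norm_eq_inner)

section \<open>Spectral theorem and polar decomposition\<close>

lift_definition fmat_of :: "nat \<Rightarrow> (nat \<Rightarrow> nat \<Rightarrow> complex) \<Rightarrow> fmat"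
  is "\<lambda>d f i j. if i < d \<and> j < d then f i j else 0"
  by (metis (full_types))

lemmas entry_fmat_of [simp] = fmat_of.rep_eq
lemma bnd_fmat_of [simp]: "bnd d (fmat_of d f)" by (auto simp: bnd_def)

definition eigen :: "nat \<Rightarrow> fmat \<Rightarrow> complex \<Rightarrow> (nat \<Rightarrow> complex) \<Rightarrow> bool" where
  "eigen d x l v \<longleftrightarrow> (\<exists>i<d. v i \<noteq> 0) \<and> (\<forall>i<d. (\<Sum>j<d. entry x i j * v j) = l * v i)"

lemma eigen_iff_eigenvalue:
  "(\<exists>v. eigen d x l v) \<longleftrightarrow> eigenvalue (mat d d (\<lambda>(i, j). entry x i j)) l"
proof
  assume "\<exists>v. eigen d x l v"
  then obtain v where v: "eigen d x l v" ..
  have "eigenvector (mat d d (\<lambda>(i, j). entry x i j)) (vec d v) l"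
    using v unfolding eigenvector_def eigen_def
    by (auto simp: vec_eq_iff scalar_prod_def lessThan_atLeast0)
  then show "eigenvalue (mat d d (\<lambda>(i, j). entry x i j)) l" by (auto simp: eigenvalue_def)
next
  assume "eigenvalue (mat d d (\<lambda>(i, j). entry x i j)) l"
  then obtain v where v: "eigenvector (mat d d (\<lambda>(i, j). entry x i j)) v l"
    by (auto simp: eigenvalue_def)
  then have dv: "dim_vec v = d" "v \<noteq> 0\<^sub>v d" and ev: "mat d d (\<lambda>(i, j). entry x i j) *\<^sub>v v = l \<cdot>\<^sub>v v"
    by (auto simp: eigenvector_def)
  have "\<exists>i<d. vec_index v i \<noteq> 0"
    using dv by (metis eq_vecI index_zero_vec(1) index_zero_vec(2))
  moreover have "(\<Sum>j<d. entry x i j * vec_index v j) = l * vec_index v i" if "i < d" for i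
    using arg_cong[OF ev, of "\<lambda>w. vec_index w i"] that dv(1) by (simp add: scalar_prod_def lessThan_atLeast0)
  ultimately have "eigen d x l (vec_index v)"
    unfolding eigen_def by blast
  then show "\<exists>v. eigen d x l v" by (rule exI[of _ "vec_index v"])
qed

lemma eigen_exists:
  assumes "d > 0" shows "\<exists>l v. eigen d x l v"
proof -
  let ?A = "mat d d (\<lambda>(i, j). entry x i j)"
  have A: "?A \<in> carrier_mat d d" by simp
  have "degree (char_poly ?A) = d" using degree_monic_char_poly[OF A] by simp
  then have "\<not> constant (poly (char_poly ?A))" using assms by (simp add: constant_degree)
  then obtain l where "poly (char_poly ?A) l = 0" using fundamental_theorem_of_algebra by blast
  then have "eigenvalue ?A l" by (simp add: eigenvalue_root_char_poly[OF A])
  then show ?thesis using eigen_iff_eigenvalue by blast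
qed

lemma finite_eigenvalues: "finite {l. \<exists>v. eigen d x l v}"
proof -
  let ?A = "mat d d (\<lambda>(i, j). entry x i j)"
  have A: "?A \<in> carrier_mat d d" by simp
  have "char_poly ?A \<noteq> 0" using degree_monic_char_poly[OF A] by auto
  then show ?thesis
    unfolding eigen_iff_eigenvalue eigenvalue_root_char_poly[OF A] by (rule poly_roots_finite)
qed

text \<open>The reflection that exchanges the lines of \<open>v\<close> and of the last basis vector. Its last column is
\<open>v\<close> up to a phase, which suffices for an eigenvector.\<close>

lemma householder:
  assumes v: "(\<Sum>i<Suc n. (cmod (v i))\<^sup>2) = 1"
  shows "\<exists>u\<in>uni (Suc n). \<exists>z. \<forall>i<Suc n. entry u i n = z * v i"
proof -
  (* Adding the phase of v n, instead of subtracting it, keeps w away from 0. *)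
  define \<zeta> where "\<zeta> = (if v n = 0 then 1 else sgn (v n))"
  define w where "w i = v i + (if i = n then \<zeta> else 0)" for i
  have \<zeta>: "cmod \<zeta> = 1" by (simp add: \<zeta>_def norm_sgn)
  have \<zeta>1: "cnj \<zeta> * \<zeta> = 1" using complex_norm_square[of \<zeta>] \<zeta> by (simp add: mult.commute[of "cnj \<zeta>"])
  have vn: "v n = complex_of_real (cmod (v n)) * \<zeta>" by (simp add: \<zeta>_def sgn_eq)
  define s where "s = 2 + 2 * cmod (v n)"
  have wn: "w n = complex_of_real (1 + cmod (v n)) * \<zeta>"
    unfolding w_def of_real_add distrib_right vn[symmetric] by simp
  have "(\<Sum>i<Suc n. (cmod (w i))\<^sup>2) = (\<Sum>i<n. (cmod (v i))\<^sup>2) + (1 + cmod (v n))\<^sup>2"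
  proof -
    have "cmod (w n) = 1 + cmod (v n)"
      unfolding wn norm_mult \<zeta> by (metis mult.right_neutral norm_of_real abs_of_nonneg add_nonneg_nonneg norm_ge_zero zero_le_one)
    moreover have "(\<Sum>i<n. (cmod (w i))\<^sup>2) = (\<Sum>i<n. (cmod (v i))\<^sup>2)"
      by (rule sum.cong) (auto simp: w_def)
    ultimately show ?thesis by (simp only: sum.lessThan_Suc)
  qed
  also have "\<dots> = s" using v by (simp add: s_def power2_eq_square algebra_simps)
  finally have ws: "(\<Sum>i<Suc n. (cmod (w i))\<^sup>2) = s" .
  define q where "q = fmat_of (Suc n) (\<lambda>i j. w i * cnj (w j))"
  have bq: "bnd (Suc n) q" by (simp add: q_def)
  have aq: "adj q = q" by (rule fmat_eqI) (auto simp: q_def)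
  have qq: "q * q = s *\<^sub>R q"
  proof (rule fmat_eqI)
    fix i j
    have "entry (q * q) i j = (\<Sum>k<Suc n. entry q i k * entry q k j)" by (rule entry_mult_left[OF bq])
    also have "\<dots> = (\<Sum>k<Suc n. entry q i j * complex_of_real ((cmod (w k))\<^sup>2))"
    proof (rule sum.cong)
      fix k
      have "cnj (w k) * w k = complex_of_real ((cmod (w k))\<^sup>2)" by (metis complex_norm_square mult.commute)
      then show "entry q i k * entry q k j = entry q i j * complex_of_real ((cmod (w k))\<^sup>2)" if "k \<in> {..<Suc n}"
        using that by (simp add: q_def)
    qed simp
    also have "\<dots> = entry q i j * complex_of_real (\<Sum>k<Suc n. (cmod (w k))\<^sup>2)"
      by (simp only: sum_distrib_left of_real_sum)
    finally show "entry (q * q) i j = entry (s *\<^sub>R q) i j" by (simp only: ws) simp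
  qed
  have s0: "s > 0" by (simp add: s_def add_pos_nonneg)
  define c where "c = 2 / s"
  define u where "u = e (Suc n) - c *\<^sub>R q"
  have bu: "bnd (Suc n) u" by (simp add: u_def bnd_diff bnd_scaleR bq)
  have 1: "c * c * s = c + c" using s0 by (simp add: c_def field_simps)
  have "adj u * u = e (Suc n) - c *\<^sub>R q - (c *\<^sub>R q - (c * c * s) *\<^sub>R q)"
    by (simp add: u_def adj_simps aq left_diff_distrib right_diff_distrib e_mult[OF bq] e_mult[OF bnd_e] qq
        scaleR_right_diff_distrib mult.assoc)
  then have "adj u * u = e (Suc n)" unfolding 1 scaleR_left_distrib by (simp add: algebra_simps)
  then have "u \<in> uni (Suc n)" using bu by (rule uniI_left[rotated])
  moreover have "entry u i n = - cnj \<zeta> * v i" if "i < Suc n" for i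
  proof -
    have "c * (1 + cmod (v n)) = 1" using s0 by (simp add: c_def s_def field_simps)
    then have "complex_of_real c * complex_of_real (1 + cmod (v n)) = 1"
      by (metis of_real_1 of_real_mult)
    then have "complex_of_real c * cnj (w n) = cnj \<zeta>"
      unfolding wn by (simp only: complex_cnj_mult complex_cnj_complex_of_real mult.assoc[symmetric]) simp
    then have "entry u i n = (if i = n then 1 else 0) - w i * cnj \<zeta>"
      using that unfolding u_def by (simp add: entry_e q_def) 
    then show ?thesis using \<zeta>1
      by (cases "i = n") (simp_all add: w_def distrib_right distrib_left mult.commute)
  qed
  ultimately show ?thesis by blast
qed

text \<open>Conjugating by a reflection moves an eigenvector to the last coordinate; the matrix is self-adjoint,
so the last row vanishes as well and a matrix of size \<open>n\<close> remains.\<close>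

theorem spectral:
  assumes "bnd d h" "adj h = h"
  shows "\<exists>u\<in>uni d. \<exists>l. h = u * diag d l * adj u"
  using assms
proof (induction d arbitrary: h)
  case 0
  then have "h = 0" by (intro fmat_eqI) (simp add: entry_zero_left)
  moreover have "e 0 * diag 0 (\<lambda>_. 0) * adj (e 0) = 0"
    by (rule fmat_eqI) (simp add: entry_mult_left[OF bnd_e] entry_mult_left[OF bnd_mult[OF bnd_e bnd_diag]])
  ultimately show ?case using e_uni by metis
next
  case (Suc n)
  obtain c v0 where v0: "eigen (Suc n) h c v0" using eigen_exists by blast
  define r where "r = sqrt (\<Sum>i<Suc n. (cmod (v0 i))\<^sup>2)"
  obtain i0 where "i0 < Suc n" "v0 i0 \<noteq> 0" using v0 unfolding eigen_def by blast
  then have "(\<Sum>i<Suc n. (cmod (v0 i))\<^sup>2) > 0"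
    by (intro sum_pos2[where i = i0]) auto
  then have r: "r > 0" "r\<^sup>2 = (\<Sum>i<Suc n. (cmod (v0 i))\<^sup>2)" by (simp_all add: r_def)
  define v where "v i = v0 i / r" for i
  have "(\<Sum>i<Suc n. (cmod (v i))\<^sup>2) = (\<Sum>i<Suc n. (cmod (v0 i))\<^sup>2) / r\<^sup>2"
    using r(1) by (simp only: v_def norm_divide power_divide sum_divide_distrib) simp
  then have v1: "(\<Sum>i<Suc n. (cmod (v i))\<^sup>2) = 1" using r(1) unfolding r(2)[symmetric] by simp
  obtain H z where H: "H \<in> uni (Suc n)" and Hv: "\<And>i. i < Suc n \<Longrightarrow> entry H i n = z * v i"
    using householder[OF v1] by blast
  have hv: "(\<Sum>j<Suc n. entry h i j * v j) = c * v i" if "i < Suc n" for i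
    using v0 that r(1) unfolding eigen_def v_def
    by (simp add: sum_divide_distrib[symmetric] del: sum.lessThan_Suc)
  define h' where "h' = adj H * (h * H)"
  note bH = uniD(1)[OF H]
  have bh': "bnd (Suc n) h'" unfolding h'_def using Suc.prems bH by (simp add: bnd_mult bnd_adj)
  have ah': "adj h' = h'" using Suc.prems by (simp add: h'_def adj_mult mult.assoc)
  have col: "entry h' i n = (if i = n then c else 0)" if "i < Suc n" for i
  proof -
    have 1: "entry (h * H) k n = c * entry H k n" if "k < Suc n" for k
    proof -
      have "entry (h * H) k n = (\<Sum>j<Suc n. entry h k j * (z * v j))"
        unfolding entry_mult_left[OF Suc.prems(1)] by (intro sum.cong refl) (simp add: Hv)
      also have "\<dots> = z * (\<Sum>j<Suc n. entry h k j * v j)"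
        by (simp only: sum_distrib_left mult.left_commute)
      finally show ?thesis using that by (simp only: hv Hv mult.left_commute)
    qed
    have "entry h' i n = (\<Sum>k<Suc n. entry (adj H) i k * (c * entry H k n))"
      unfolding h'_def entry_mult_left[OF bnd_adj[OF bH]] by (intro sum.cong refl) (simp add: 1)
    also have "\<dots> = c * entry (adj H * H) i n"
      unfolding entry_mult_left[OF bnd_adj[OF bH]] by (simp only: sum_distrib_left mult.left_commute)
    finally show ?thesis using that H by (simp add: uniD entry_e)
  qed
  have col': "entry h' n i = (if i = n then cnj c else 0)" if "i < Suc n" for i
    using arg_cong[OF ah', of "\<lambda>x. entry x n i"] col[OF that] by auto
  have cr: "c = Re c" using col[of n] col'[of n] by (simp add: complex_eq_iff)
  (* E is the projection onto the last coordinate; u + E embeds U(n) into U(n + 1). *)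
  define E where "E = diag (Suc n) (\<lambda>i. if i = n then 1 else 0)"
  define h2 where "h2 = fmat_of n (entry h')"
  have h'2: "h' = h2 + Re c *\<^sub>R E"
  proof (rule fmat_eqI)
    fix i j
    show "entry h' i j = entry (h2 + Re c *\<^sub>R E) i j"
      using col[of i] col'[of j] cr bh'
      by (cases "i < n"; cases "j < n"; cases "i = n"; cases "j = n")
        (auto simp: h2_def E_def entry_diag entry_zero_left entry_zero_right)
  qed
  have "adj h2 = h2"
    by (rule fmat_eqI) (use arg_cong[OF ah', of "\<lambda>x. entry x _ _"] in \<open>auto simp: h2_def\<close>)
  then obtain u l where u: "u \<in> uni n" "h2 = u * diag n l * adj u"
    using Suc.IH[of h2] by (auto simp: h2_def)
  have EE: "E * E = E" by (simp add: E_def diag_mult_diag if_distrib cong: if_cong)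
  have Ex: "E * x = 0" "x * E = 0" if "bnd n x" for x
    by (rule fmat_eqI; use that in \<open>auto simp: E_def entry_diag_mult entry_mult_diag entry_zero_left entry_zero_right\<close>)+
  have eE: "e (Suc n) = e n + E" by (rule fmat_eqI) (auto simp: E_def entry_e entry_diag)
  have dE: "diag (Suc n) (l(n := Re c)) = diag n l + Re c *\<^sub>R E"
    by (rule fmat_eqI) (auto simp: E_def entry_diag)
  have aE: "adj E = E" by (simp add: E_def)
  note bu = uniD(1)[OF u(1)] bnd_adj[OF uniD(1)[OF u(1)]]
  have u': "u + E \<in> uni (Suc n)"
  proof (rule uniI_left)
    show "bnd (Suc n) (u + E)" using bu by (intro bnd_add) (auto intro: bnd_mono simp: E_def)
    show "adj (u + E) * (u + E) = e (Suc n)"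
      by (simp add: adj_simps aE algebra_simps EE Ex bu uniD[OF u(1)] eE)
  qed
  have "(u + E) * diag (Suc n) (l(n := Re c)) = u * diag n l + Re c *\<^sub>R E"
    by (simp add: dE distrib_left distrib_right EE Ex bu)
  then have "(u + E) * diag (Suc n) (l(n := Re c)) * adj (u + E) = h'"
    by (simp add: adj_simps aE distrib_left distrib_right EE Ex bu h'2 u(2) bnd_mult)
  moreover have "(H * (u + E)) * diag (Suc n) (l(n := Re c)) * adj (H * (u + E)) =
      H * ((u + E) * diag (Suc n) (l(n := Re c)) * adj (u + E)) * adj H"
    by (simp add: adj_mult mult.assoc)
  ultimately have "(H * (u + E)) * diag (Suc n) (l(n := Re c)) * adj (H * (u + E)) = H * h' * adj H"
    by (simp only:)
  also have "\<dots> = h"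
    using uni_cancel(2)[OF H bnd_mult[OF Suc.prems(1) bH]] uni_cancel(3)[OF H Suc.prems(1)]
    by (simp add: h'_def)
  finally show ?case using mult_uni[OF H u'] by metis
qed

lemma norm_diag: "(norm (diag d f))\<^sup>2 = (\<Sum>i<d. (f i)\<^sup>2)"
proof -
  have "(norm (diag d f))\<^sup>2 = (\<Sum>i<d. \<Sum>j<d. if i = j then (f i)\<^sup>2 else 0)"
    unfolding norm_sq[OF bnd_diag] by (intro sum.cong refl) (auto simp: entry_diag)
  then show ?thesis by simp
qed

lemma norm_diag_mono:
  assumes "\<And>i. i < d \<Longrightarrow> \<bar>f i\<bar> \<le> \<bar>g i\<bar>" shows "norm (diag d f) \<le> norm (diag d g)"
proof -
  have "(norm (diag d f))\<^sup>2 \<le> (norm (diag d g))\<^sup>2"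
    unfolding norm_diag using assms by (intro sum_mono) (simp add: abs_le_square_iff)
  then show ?thesis by (rule power2_le_imp_le) simp
qed

lemma norm_conj: "u \<in> uni d \<Longrightarrow> bnd d x \<Longrightarrow> norm (u * x * adj u) = norm x"
  using norm_uni_right[OF adj_uni bnd_mult[OF uniD(1)], of u d u x] norm_uni_left[of u d x] by simp

lemma conj_diag_mult:
  assumes "u \<in> uni d"
  shows "u * diag d f * adj u * (u * diag d g * adj u) = u * diag d (\<lambda>i. f i * g i) * adj u"
proof -
  have "u * diag d f * adj u * (u * diag d g * adj u) = u * diag d f * (adj u * (u * (diag d g * adj u)))"
    by (simp add: mult.assoc)
  also have "\<dots> = u * (diag d f * diag d g) * adj u"
    using uni_cancel(1)[OF assms bnd_mult[OF bnd_diag bnd_adj[OF uniD(1)[OF assms]]]] by (simp add: mult.assoc)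
  finally show ?thesis by (simp add: diag_mult_diag)
qed

lemma conj_diag_one: "u \<in> uni d \<Longrightarrow> u * diag d (\<lambda>_. 1) * adj u = e d"
  by (simp add: diag_const_one e_mult uniD)

text \<open>In the eigenbasis, commuting with \<open>diag d l\<close> means that entries between different eigenvalues vanish;
this passes to every function of the eigenvalues.\<close>

lemma functional_calculus_commute:
  assumes u: "u \<in> uni d" and y: "bnd d y" and c: "y * (u * diag d l * adj u) = u * diag d l * adj u * y"
  shows "y * (u * diag d (\<lambda>i. f (l i)) * adj u) = u * diag d (\<lambda>i. f (l i)) * adj u * y"
proof -
  define c where "c = adj u * y * u"
  note bu = uniD(1)[OF u] bnd_adj[OF uniD(1)[OF u]]
  have bc: "bnd d c" by (simp add: c_def bnd_mult bu y)
  have tr: "y * (u * D * adj u) = u * D * adj u * y \<longleftrightarrow> c * D = D * c" if D: "bnd d D" for D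
  proof
    assume "y * (u * D * adj u) = u * D * adj u * y"
    then have "adj u * (y * (u * D * adj u)) * u = adj u * (u * D * adj u * y) * u" by simp
    then show "c * D = D * c"
      using uni_cancel(1)[OF u bnd_mult[OF bnd_mult[OF D bu(2)] bnd_mult[OF y bu(1)]]]
        uniD(2)[OF u] e_mult(2)[OF D] by (simp add: c_def mult.assoc)
  next
    assume "c * D = D * c"
    then have "u * (c * D) * adj u = u * (D * c) * adj u" by simp
    then show "y * (u * D * adj u) = u * D * adj u * y"
      using uni_cancel(2)[OF u bnd_mult[OF y bnd_mult[OF bu(1) bnd_mult[OF D bu(2)]]]]
        uniD(3)[OF u] e_mult(2)[OF y] by (simp add: c_def mult.assoc)
  qed
  have 1: "entry (c * diag d l) i j = entry (diag d l * c) i j" for i j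
    using c unfolding tr[OF bnd_diag] by simp
  have "entry c i j = 0 \<or> l i = l j" if "i < d" "j < d" for i j
    using 1[of i j] that by (auto simp: entry_mult_diag entry_diag_mult mult.commute)
  then have "c * diag d (\<lambda>i. f (l i)) = diag d (\<lambda>i. f (l i)) * c"
    by (intro fmat_eqI) (use bc in \<open>fastforce simp: entry_mult_diag entry_diag_mult entry_zero_left entry_zero_right\<close>)
  then show ?thesis by (simp add: tr)
qed

text \<open>The unitary is \<open>Z (Z\<^sup>* Z)\<^sup>-\<^sup>1\<^sup>/\<^sup>2\<close> for a small invertible perturbation \<open>Z = X + t P\<close>; invertibility makes
this unitary without a choice of bases for kernels. Being a function of \<open>Z\<close>, it inherits the
intertwining relations that \<open>X\<close> and \<open>P\<close> have in common. This is how block structure survives.\<close>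

theorem approximate_polar:
  assumes X: "bnd d X" and P: "P \<in> uni d" and \<gamma>: "\<gamma> > 0"
  shows "\<exists>U\<in>uni d. norm (U - X) \<le> norm (e d - adj X * X) + \<gamma> \<and>
    (\<forall>y y'. bnd d y \<longrightarrow> adj y = y \<longrightarrow> adj y' = y' \<longrightarrow> X * y = y' * X \<longrightarrow> P * y = y' * P
      \<longrightarrow> U * y = y' * U)"
proof -
  (* For 0 < t < 1 the perturbation t P costs at most t B in the estimate. *)
  define B where "B = 2 * norm X + 2 * sqrt d + 1"
  have B: "B > 0" by (simp add: B_def add_nonneg_pos)
  (* For t outside S the matrix X + t P is injective: a kernel vector would be an eigenvector
     of P* X with eigenvalue -t. *)
  define S where "S = (\<lambda>l. - Re l) ` {l. \<exists>v. eigen d (adj P * X) l v}"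
  have "finite S" unfolding S_def using finite_eigenvalues by blast
  moreover have "infinite {0<..<min 1 (\<gamma> / B)}" using \<gamma> B by (intro infinite_Ioo) simp
  ultimately have "infinite ({0<..<min 1 (\<gamma> / B)} - S)" by (rule Diff_infinite_finite)
  then obtain t where t: "t > 0" "t < 1" "t < \<gamma> / B" "t \<notin> S"
    by (metis (no_types, lifting) DiffE all_not_in_conv finite.emptyI greaterThanLessThan_iff min_less_iff_conj)
  define Z where "Z = X + t *\<^sub>R P"
  define K where "K = adj Z * Z"
  note bP = uniD(1)[OF P]
  have bZ: "bnd d Z" by (simp add: Z_def X bP bnd_add bnd_scaleR)
  have bK: "bnd d K" "adj K = K" by (simp_all add: K_def bZ bnd_mult bnd_adj adj_mult)
  obtain u l where u: "u \<in> uni d" and K: "K = u * diag d l * adj u" using spectral[OF bK] by blast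
  note bu = uniD(1)[OF u]
  have Zu: "adj (Z * u) * (Z * u) = diag d l"
  proof -
    have "adj (Z * u) * (Z * u) = adj u * K * u" by (simp add: K_def adj_mult mult.assoc)
    also have "\<dots> = adj u * (u * (diag d l * (adj u * u)))" by (simp add: K mult.assoc)
    finally show ?thesis using u by (simp add: uniD e_mult uni_cancel)
  qed
  have lpos: "l i > 0" if "i < d" for i
  proof -
    have "complex_of_real (l i) = entry (adj (Z * u) * (Z * u)) i i" using that by (simp add: Zu entry_diag)
    also have "\<dots> = (\<Sum>k<d. cnj (entry (Z * u) k i) * entry (Z * u) k i)"
      by (subst entry_mult_left[of d]) (simp_all add: bnd_adj bnd_mult bZ bu)
    finally have "l i = Re (\<Sum>k<d. cnj (entry (Z * u) k i) * entry (Z * u) k i)" by (metis Re_complex_of_real)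
    then have li: "l i = (\<Sum>k<d. (cmod (entry (Z * u) k i))\<^sup>2)" by (simp only: Re_sum Re_cnj_mult_self)
    have "l i \<noteq> 0"
    proof
      assume "l i = 0"
      then have z: "entry (Z * u) k i = 0" for k
        using bZ bu unfolding li by (cases "k < d") (auto simp: sum_nonneg_eq_0_iff entry_zero_left[OF bnd_mult[OF bZ bu]])
      have "entry (adj P * (Z * u)) k i = 0" for k
        by (subst entry_mult_left[OF bnd_adj[OF bP]]) (simp add: z)
      moreover have "adj P * (Z * u) = adj P * X * u + t *\<^sub>R u"
        using uni_cancel(1)[OF P bu] by (simp add: Z_def distrib_left distrib_right mult.assoc)
      ultimately have 1: "entry (adj P * X * u) k i = - complex_of_real t * entry u k i" for k
        by (simp add: add_eq_0_iff)
      have "eigen d (adj P * X) (- complex_of_real t) (\<lambda>k. entry u k i)"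
        unfolding eigen_def
      proof
        have "entry (adj u * u) i i = 1" using that u by (simp add: uniD entry_e)
        then have "(\<Sum>k<d. entry (adj u) i k * entry u k i) \<noteq> 0"
          by (subst (asm) entry_mult_left[OF bnd_adj[OF bu]]) simp
        then show "\<exists>k<d. entry u k i \<noteq> 0" by (metis (no_types, lifting) lessThan_iff mult_zero_right sum.neutral)
        show "\<forall>k<d. (\<Sum>j<d. entry (adj P * X) k j * entry u j i) = - complex_of_real t * entry u k i"
          using 1 by (simp add: entry_mult_right[OF bu])
      qed
      then have "t \<in> S" unfolding S_def by (intro image_eqI[of _ _ "- complex_of_real t"]) auto
      then show False using t by blast
    qed
    moreover have "l i \<ge> 0" unfolding li by (simp add: sum_nonneg)
    ultimately show ?thesis by simp
  qed
  define g where "g = u * diag d (\<lambda>i. 1 / sqrt (l i)) * adj u"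
  define r where "r = u * diag d (\<lambda>i. sqrt (l i)) * adj u"
  define U where "U = Z * g"
  have bg: "bnd d g" "bnd d r" by (simp_all add: g_def r_def bnd_mult bu bnd_adj)
  have ag: "adj g = g" by (simp add: g_def adj_mult mult.assoc)
  have gr: "g * r = e d"
    unfolding g_def r_def conj_diag_mult[OF u] conj_diag_one[OF u, symmetric]
    by (intro arg_cong[where f = "\<lambda>x. u * x * adj u"] diag_cong) (use lpos in fastforce)
  have gKg: "g * K * g = e d"
    unfolding g_def K conj_diag_mult[OF u] conj_diag_one[OF u, symmetric]
  proof (intro arg_cong[where f = "\<lambda>x. u * x * adj u"] diag_cong)
    fix i assume "i < d"
    then have "sqrt (l i) > 0" "sqrt (l i) * sqrt (l i) = l i" using lpos[of i] by simp_all
    then show "1 / sqrt (l i) * l i * (1 / sqrt (l i)) = 1" by (simp add: field_simps)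
  qed
  have U: "U \<in> uni d"
  proof (rule uniI_left)
    show "bnd d U" by (simp add: U_def bZ bg bnd_mult)
    show "adj U * U = e d" using gKg by (simp add: U_def adj_mult ag K_def mult.assoc)
  qed
  have UZ: "norm (U - Z) \<le> norm (e d - K)"
  proof -
    have "U * (e d - r) = U - Z"
      using uniD(1)[OF U] bZ by (simp add: right_diff_distrib e_mult) (simp add: U_def mult.assoc gr e_mult)
    then have "norm (U - Z) = norm (e d - r)" using U bg by (metis norm_uni_left bnd_diff bnd_e)
    also have "e d - r = u * diag d (\<lambda>i. 1 - sqrt (l i)) * adj u"
      unfolding r_def conj_diag_one[OF u, symmetric] diag_diff[symmetric] by (simp add: algebra_simps)
    also have "norm \<dots> = norm (diag d (\<lambda>i. 1 - sqrt (l i)))" by (rule norm_conj[OF u bnd_diag])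
    also have "\<dots> \<le> norm (diag d (\<lambda>i. 1 - l i))"
    proof (rule norm_diag_mono)
      fix i assume "i < d"
      define s where "s = sqrt (l i)"
      have "s > 0" "l i = s * s" using lpos[OF \<open>i < d\<close>] by (simp_all add: s_def)
      (* The singular values s of Z satisfy |1 - s| <= |1 - s^2|. *)
      then have "\<bar>1 - l i\<bar> = \<bar>1 - s\<bar> * (1 + s)" using abs_mult[of "1 - s" "1 + s"] by (simp add: algebra_simps)
      then show "\<bar>1 - sqrt (l i)\<bar> \<le> \<bar>1 - l i\<bar>" using \<open>s > 0\<close> mult_left_mono[of 1 "1 + s" "\<bar>1 - s\<bar>"]
        by (simp add: s_def[symmetric])
    qed
    also have "\<dots> = norm (u * diag d (\<lambda>i. 1 - l i) * adj u)" by (rule norm_conj[OF u bnd_diag, symmetric])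
    also have "u * diag d (\<lambda>i. 1 - l i) * adj u = e d - K"
      unfolding K conj_diag_one[OF u, symmetric] diag_diff[symmetric] by (simp add: algebra_simps)
    finally show ?thesis .
  qed
  have "norm (U - X) \<le> norm (U - Z) + norm (t *\<^sub>R P)"
    using norm_triangle_ineq[of "U - Z" "t *\<^sub>R P"] by (simp add: Z_def)
  moreover have "\<dots> \<le> norm (e d - K) + t * sqrt d" using UZ t norm_uni[OF P] by simp
  moreover have "norm (e d - K) \<le> norm (e d - adj X * X) + norm (K - adj X * X)"
    using norm_triangle_ineq4[of "e d - adj X * X" "K - adj X * X"] by simp
  moreover have "norm (K - adj X * X) \<le> t * (2 * norm X + sqrt d)"
  proof -
    have "K - adj X * X = t *\<^sub>R (adj X * P + adj P * X + t *\<^sub>R e d)"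
      using P by (simp add: K_def Z_def adj_simps distrib_left distrib_right uniD scaleR_add_right)
    moreover have "norm (adj X * P + adj P * X + t *\<^sub>R e d) \<le> norm (adj X * P) + norm (adj P * X) + norm (t *\<^sub>R e d)"
      by (meson norm_triangle_le norm_triangle_ineq add_right_mono)
    moreover have "norm (adj X * P) = norm X" "norm (adj P * X) = norm X"
      using norm_uni_left[OF adj_uni[OF P] X] norm_uni_right[OF P bnd_adj[OF X]] by simp_all
    moreover have "norm (t *\<^sub>R e d) \<le> sqrt d" using t by (simp add: norm_e mult_left_le_one_le)
    ultimately show ?thesis using t by simp
  qed
  moreover have "norm (e d - adj X * X) + t * (2 * norm X + sqrt d) + t * sqrt d \<le> norm (e d - adj X * X) + \<gamma>"
  proof -
    have "t * B \<le> \<gamma>" using t(3) B by (simp add: field_simps)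
    then show ?thesis using t(1) by (simp add: B_def algebra_simps)
  qed
  ultimately have main: "norm (U - X) \<le> norm (e d - adj X * X) + \<gamma>" by linarith
  have "U * y = y' * U"
    if y: "bnd d y" "adj y = y" "adj y' = y'" "X * y = y' * X" "P * y = y' * P" for y y'
  proof -
    have Zy: "Z * y = y' * Z" using y by (simp add: Z_def distrib_left distrib_right)
    have "y * adj Z = adj Z * y'" using arg_cong[OF Zy, of adj] y by (simp add: adj_mult)
    then have "y * K = K * y" using Zy by (simp add: K_def mult.assoc flip: mult.assoc[of y])
    then have "y * g = g * y" unfolding K g_def by (rule functional_calculus_commute[OF u y(1), of l "\<lambda>x. 1 / sqrt x"])
    then show ?thesis by (metis U_def Zy mult.assoc)
  qed
  then show ?thesis using U main by blast
qed

section \<open>Measuring almost commuting unitaries\<close>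

definition sgnb :: "bool \<Rightarrow> real" where "sgnb b = (if b then 1 else - 1)"

lemma sgnb_sq [simp]: "sgnb b * sgnb b = 1" by (simp add: sgnb_def)

text \<open>For a unitary \<open>a\<close> the two matrices \<open>K\<^sub>s = (1 + s a)/2\<close> satisfy \<open>\<Sum>\<^sub>s K\<^sub>s\<^sup>* K\<^sub>s = 1\<close> exactly, so they describe a measurement
with outcomes \<open>\<plusminus>1\<close>; they are the spectral projections if \<open>a\<close> is an involution. In this way the
measurement needs no preliminary correction of \<open>a\<close>.\<close>

definition kraus :: "nat \<Rightarrow> fmat \<Rightarrow> bool \<Rightarrow> fmat" where
  "kraus d a s = (1 / 2) *\<^sub>R (e d + sgnb s *\<^sub>R a)"

text \<open>The operator belonging to the outcome \<open>w\<close> of measuring the unitaries of the list successively. The lists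
have equal length in all uses.\<close>

fun instr :: "nat \<Rightarrow> fmat list \<Rightarrow> bool list \<Rightarrow> fmat" where
  "instr d (a # as) (s # w) = instr d as w * kraus d a s"
| "instr d _ _ = e d"

definition povm :: "nat \<Rightarrow> fmat list \<Rightarrow> bool list \<Rightarrow> fmat" where
  "povm d as w = adj (instr d as w) * instr d as w"

definition words :: "nat \<Rightarrow> bool list set" where "words n = {w. length w = n}"

lemma finite_words [simp]: "finite (words n)"
  using finite_lists_length_eq[of "UNIV :: bool set" n] by (simp add: words_def)

lemma words_Suc: "words (Suc n) = (#) True ` words n \<union> (#) False ` words n"
proof -
  have "w \<in> words (Suc n) \<longleftrightarrow> w \<in> (#) True ` words n \<union> (#) False ` words n" for w
    by (cases w; cases "hd w") (auto simp: words_def)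
  then show ?thesis by blast
qed

lemma sum_words_Suc: "(\<Sum>w\<in>words (Suc n). f w) = (\<Sum>w\<in>words n. f (True # w) + f (False # w))"
  unfolding words_Suc
  by (subst sum.union_disjoint) (auto simp: sum.reindex sum.distrib inj_on_def)

lemma bnd_kraus: "a \<in> uni d \<Longrightarrow> bnd d (kraus d a s)"
  by (simp add: kraus_def bnd_scaleR bnd_add uniD)

lemma bnd_instr: "set as \<subseteq> uni d \<Longrightarrow> bnd d (instr d as w)"
  by (induction d as w rule: instr.induct) (simp_all add: bnd_mult bnd_kraus)

lemma bnd_povm: "set as \<subseteq> uni d \<Longrightarrow> bnd d (povm d as w)"
  by (simp add: povm_def bnd_mult bnd_adj bnd_instr)

lemma adj_povm: "adj (povm d as w) = povm d as w"
  by (simp add: povm_def adj_mult)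

lemma povm_Cons: "povm d (a # as) (s # w) = adj (kraus d a s) * povm d as w * kraus d a s"
  by (simp add: povm_def adj_mult mult.assoc)

lemma kraus_conj:
  assumes "a \<in> uni d" "bnd d y"
  shows "adj (kraus d a s) * y * kraus d a s =
    (1 / 4) *\<^sub>R (y + adj a * y * a + sgnb s *\<^sub>R (adj a * y + y * a))"
proof -
  have "adj (kraus d a s) * y * kraus d a s
      = (1 / 2) *\<^sub>R (1 / 2) *\<^sub>R ((e d + sgnb s *\<^sub>R adj a) * y * (e d + sgnb s *\<^sub>R a))"
    by (simp add: kraus_def adj_simps)
  also have "(e d + sgnb s *\<^sub>R adj a) * y * (e d + sgnb s *\<^sub>R a) =
      y + adj a * y * a + sgnb s *\<^sub>R (adj a * y + y * a)"
    using assms bnd_mult[OF bnd_adj[OF uniD(1)[OF assms(1)]] assms(2)]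
    by (simp add: distrib_left distrib_right e_mult scaleR_add_right mult.assoc)
  finally show ?thesis by simp
qed

lemma kraus_sum:
  assumes "a \<in> uni d" "bnd d y"
  shows "adj (kraus d a True) * y * kraus d a True + adj (kraus d a False) * y * kraus d a False =
    (1 / 2) *\<^sub>R (y + adj a * y * a)"
  and "adj (kraus d a True) * y * kraus d a True - adj (kraus d a False) * y * kraus d a False =
    (1 / 2) *\<^sub>R (adj a * y + y * a)"
  unfolding kraus_conj[OF assms] sgnb_def
  by (simp_all add: scaleR_add_right scaleR_diff_right algebra_simps flip: scaleR_add_left)

lemma povm_sum: "set as \<subseteq> uni d \<Longrightarrow> (\<Sum>w\<in>words (length as). povm d as w) = e d"
proof (induction as)
  case Nil
  have "words 0 = {[]}" by (auto simp: words_def)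
  then show ?case by (simp add: povm_def e_mult)
next
  case (Cons a as)
  have "(\<Sum>w\<in>words (length (a # as)). povm d (a # as) w) =
      (\<Sum>w\<in>words (length as). (1 / 2) *\<^sub>R (povm d as w + adj a * povm d as w * a))"
    using Cons.prems by (simp add: sum_words_Suc povm_Cons kraus_sum bnd_povm)
  also have "\<dots> = (1 / 2) *\<^sub>R ((\<Sum>w\<in>words (length as). povm d as w) +
       adj a * (\<Sum>w\<in>words (length as). povm d as w) * a)"
    by (simp add: scaleR_sum_right scaleR_add_right sum.distrib sum_distrib_left sum_distrib_right)
  also have "\<dots> = e d"
    using Cons uniD[of a d] by (simp add: e_mult bnd_adj flip: scaleR_add_left scaleR_2)
  finally show ?case .
qed

text \<open>The mean of the \<open>i\<close>-th letter of the outcome.\<close>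

definition psi :: "nat \<Rightarrow> fmat list \<Rightarrow> nat \<Rightarrow> fmat" where
  "psi d as i = (\<Sum>w\<in>words (length as). sgnb (w ! i) *\<^sub>R povm d as w)"

lemma psi_0:
  assumes "set (a # as) \<subseteq> uni d"
  shows "psi d (a # as) 0 = (1 / 2) *\<^sub>R (a + adj a)"
proof -
  have "psi d (a # as) 0 = (\<Sum>w\<in>words (length as). (1 / 2) *\<^sub>R (adj a * povm d as w + povm d as w * a))"
    using assms kraus_sum(2)[of a d] by (simp add: psi_def sum_words_Suc povm_Cons sgnb_def bnd_povm)
  also have "\<dots> = (1 / 2) *\<^sub>R (adj a * (\<Sum>w\<in>words (length as). povm d as w) + (\<Sum>w\<in>words (length as). povm d as w) * a)"
    by (simp add: scaleR_sum_right scaleR_add_right sum.distrib sum_distrib_left sum_distrib_right)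
  finally show ?thesis using assms by (simp add: povm_sum e_mult uniD bnd_adj add.commute)
qed

lemma psi_Suc:
  assumes "set (a # as) \<subseteq> uni d"
  shows "psi d (a # as) (Suc i) = (1 / 2) *\<^sub>R (psi d as i + adj a * psi d as i * a)"
proof -
  have "psi d (a # as) (Suc i) =
      (\<Sum>w\<in>words (length as). sgnb (w ! i) *\<^sub>R (1 / 2) *\<^sub>R (povm d as w + adj a * povm d as w * a))"
    using assms kraus_sum(1)[of a d] by (simp add: psi_def sum_words_Suc povm_Cons bnd_povm flip: scaleR_add_right)
  also have "\<dots> = (1 / 2) *\<^sub>R (psi d as i + adj a * psi d as i * a)"
    by (simp add: psi_def scaleR_sum_right sum.distrib sum_distrib_left sum_distrib_right scaleR_add_right mult.commute)
  finally show ?thesis .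
qed

lemma bnd_psi: "set as \<subseteq> uni d \<Longrightarrow> bnd d (psi d as i)"
  unfolding psi_def by (intro bnd_sum bnd_scaleR bnd_povm)

lemma norm_commutator_adj:
  assumes "a \<in> uni d" "b \<in> uni d"
  shows "norm (adj b * a - a * adj b) = norm (a * b - b * a)"
proof -
  have "adj b * (a * b - b * a) * adj b = adj b * a - a * adj b"
    using uni_cancel[OF assms(2)] uniD[OF assms(1)] uniD[OF assms(2)]
    by (simp add: left_diff_distrib right_diff_distrib mult.assoc e_mult) 
  then show ?thesis
    using norm_conj[OF adj_uni[OF assms(2)], of "(a * b - b * a) * adj b * adj b"]
      norm_uni_left[OF adj_uni[OF assms(2)], of "(a * b - b * a) * adj b"]
      norm_uni_right[OF adj_uni[OF assms(2)], of "(a * b - b * a)"] assms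
    by (simp add: mult.assoc bnd_mult bnd_diff uniD bnd_adj)
qed

text \<open>Measuring an earlier unitary \<open>a\<close> replaces the mean \<open>y\<close> by the average of \<open>y\<close> and \<open>a\<^sup>* y a\<close>, which moves it by
at most half the commutator. The errors add up because averaging contracts.\<close>

lemma psi_close:
  assumes "set as \<subseteq> uni d" "i < length as"
    and "\<And>j. j < i \<Longrightarrow> norm (as ! j * as ! i - as ! i * as ! j) \<le> \<delta>"
  shows "norm (psi d as i - (1 / 2) *\<^sub>R (as ! i + adj (as ! i))) \<le> i * \<delta> / 2"
  using assms
proof (induction as arbitrary: i)
  case (Cons a as)
  show ?case
  proof (cases i)
    case 0
    then show ?thesis using Cons.prems by (simp add: psi_0)
  next
    case (Suc k)
    define b where "b = as ! k"
    define h where "h = (1 / 2) *\<^sub>R (b + adj b)"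
    define y where "y = psi d as k"
    have a: "a \<in> uni d" and b: "b \<in> uni d" using Cons.prems Suc by (auto simp: b_def)
    have bnds: "bnd d a" "bnd d b" "bnd d h" "bnd d y"
      using a b Cons.prems by (auto simp: h_def y_def uniD bnd_add bnd_adj bnd_scaleR bnd_psi)
    have IH: "norm (y - h) \<le> k * \<delta> / 2"
      unfolding y_def h_def b_def
    proof (rule Cons.IH)
      fix j assume "j < k"
      then show "norm (as ! j * as ! k - as ! k * as ! j) \<le> \<delta>" using Cons.prems(3)[of "Suc j"] Suc by simp
    qed (use Cons.prems Suc in auto)
    have ab: "norm (a * b - b * a) \<le> \<delta>" using Cons.prems(3)[of 0] Suc by (simp add: b_def)
    have "h * a - a * h = (1 / 2) *\<^sub>R ((b * a - a * b) + (adj b * a - a * adj b))"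
      by (simp add: h_def distrib_left distrib_right algebra_simps flip: scaleR_diff_right scaleR_add_right)
    then have "norm (h * a - a * h) \<le> (1 / 2) * (norm (b * a - a * b) + norm (adj b * a - a * adj b))"
      by (simp add: norm_triangle_ineq)
    then have ha: "norm (h * a - a * h) \<le> \<delta>"
      using ab norm_commutator_adj[OF a b] norm_minus_commute[of "b * a" "a * b"] by simp
    have "adj a * y * a - h = adj a * (y - h) * a + adj a * (h * a - a * h)"
      using uni_cancel(1)[OF a bnds(3)] by (simp add: algebra_simps)
    then have "norm (adj a * y * a - h) \<le> norm (adj a * (y - h) * a) + norm (adj a * (h * a - a * h))"
      by (simp add: norm_triangle_ineq)
    also have "\<dots> = norm (y - h) + norm (h * a - a * h)"
      using norm_conj[OF adj_uni[OF a], of "y - h"] norm_uni_left[OF adj_uni[OF a], of "h * a - a * h"] bnds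
      by (simp add: bnd_diff bnd_mult)
    finally have 1: "norm (adj a * y * a - h) \<le> norm (y - h) + \<delta>" using ha by simp
    have "psi d (a # as) i - h = (1 / 2) *\<^sub>R ((y - h) + (adj a * y * a - h))"
    proof -
      have "(1 / 2) *\<^sub>R ((y - h) + (adj a * y * a - h)) = (1 / 2) *\<^sub>R (y + adj a * y * a) - (1 / 2) *\<^sub>R (h + h)"
        unfolding scaleR_diff_right[symmetric] by (simp add: algebra_simps)
      then show ?thesis unfolding scaleR_half_double using psi_Suc[OF Cons.prems(1), of k] by (simp add: Suc y_def)
    qed
    then have "norm (psi d (a # as) i - h) \<le> (1 / 2) * (norm (y - h) + norm (adj a * y * a - h))"
      by (simp add: norm_triangle_ineq)
    also have "\<dots> \<le> i * \<delta> / 2" using 1 IH Suc by (simp add: field_simps)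
    finally show ?thesis by (simp add: h_def b_def Suc)
  qed
qed simp

lemma inner_povm_nonneg: "0 \<le> inner (adj x * x) (adj y * y)"
proof -
  have "inner (adj x * x) (adj y * y) = inner (x * adj y) (x * adj y)"
    by (metis inner_mult_left inner_mult_right adj_adj mult.assoc)
  then show ?thesis by simp
qed

lemma sum_sum_inner: "(\<Sum>p\<in>S. \<Sum>q\<in>S. r p * r q * inner (f p) (f q)) =
   inner (\<Sum>p\<in>S. r p *\<^sub>R f p) (\<Sum>p\<in>S. r p *\<^sub>R f p)"
  by (subst sum.swap) (simp add: inner_sum_left inner_sum_right sum_distrib_left mult.assoc mult.left_commute)

text \<open>Both sums are expressed by the means \<open>psi d as i\<close>. For the first one, two different words differ in some
letter, and \<open>(1 - s s')/2\<close> is the indicator of \<open>s \<noteq> s'\<close>; summing over all pairs of words turns it into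
\<open>(d - \<parallel>psi\<parallel>\<^sup>2)/2\<close>. The mean is close to the almost unitary self-adjoint part of \<open>a\<^sub>i\<close>, so this is small.\<close>

lemma povm_estimates:
  assumes as: "set as \<subseteq> uni d" and n: "length as = n"
    and comm: "\<And>i j. i < n \<Longrightarrow> j < n \<Longrightarrow> norm (as ! j * as ! i - as ! i * as ! j) \<le> \<epsilon> * sqrt d"
    and inv: "\<And>i. i < n \<Longrightarrow> norm (as ! i * as ! i - e d) \<le> \<epsilon> * sqrt d"
    and \<epsilon>: "\<epsilon> \<ge> 0"
  shows "(\<Sum>w\<in>words n. \<Sum>w'\<in>words n. if w = w' then 0 else inner (povm d as w) (povm d as w'))
      \<le> real n * (real n + 1) / 2 * \<epsilon> * d" (is ?cross)
    and "i < n \<Longrightarrow> (\<Sum>w\<in>words n. inner (adj (as ! i - sgnb (w ! i) *\<^sub>R e d) * (as ! i - sgnb (w ! i) *\<^sub>R e d)) (povm d as w))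
      \<le> (real n + 2) * \<epsilon> * d"
proof -
  define M where "M = povm d as"
  have Msum: "(\<Sum>w\<in>words n. M w) = e d" using povm_sum[OF as] n by (simp add: M_def)
  have psi: "psi d as i = (\<Sum>w\<in>words n. sgnb (w ! i) *\<^sub>R M w)" for i by (simp add: psi_def M_def n)
  define h where "h i = (1 / 2) *\<^sub>R (as ! i + adj (as ! i))" for i
  have h: "inner (h i) (h i) \<ge> d - \<epsilon> * d" "norm (h i) \<le> sqrt d"
    and hpsi: "inner (h i) (psi d as i) \<ge> inner (h i) (h i) - n / 2 * \<epsilon> * d"
    if i: "i < n" for i
  proof -
    define a where "a = as ! i"
    have a: "a \<in> uni d" using as i n by (auto simp: a_def)
    define k where "k = (1 / 2) *\<^sub>R (a - adj a)"
    have hk: "h i = a - k" by (simp add: h_def k_def a_def algebra_simps flip: scaleR_add_left)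
    have "a * (a - adj a) = a * a - e d" using a by (simp add: right_diff_distrib uniD)
    then have "norm (a - adj a) \<le> \<epsilon> * sqrt d"
      using norm_uni_left[OF a, of "a - adj a"] inv[OF i] a by (simp add: a_def bnd_diff bnd_adj uniD)
    then have k: "norm k \<le> \<epsilon> * sqrt d / 2" by (simp add: k_def)
    have na: "norm a = sqrt d" by (rule norm_uni[OF a])
    have "inner a k \<le> norm a * norm k" by (rule norm_cauchy_schwarz)
    also have "\<dots> \<le> sqrt d * (\<epsilon> * sqrt d / 2)" unfolding na by (intro mult_left_mono k) simp
    also have "\<dots> = \<epsilon> * d / 2" by (simp add: mult.left_commute[of "sqrt d"])
    finally have ak: "inner a k \<le> \<epsilon> * d / 2" .
    have "inner a a = d" using na by (simp add: norm_eq_sqrt_inner)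
    then have "inner (h i) (h i) = d - 2 * inner a k + inner k k"
      by (simp add: hk inner_diff_left inner_diff_right inner_commute)
    then show "inner (h i) (h i) \<ge> d - \<epsilon> * d" using ak by (smt (verit) inner_ge_zero field_sum_of_halves)
    have "norm (h i) \<le> (1 / 2) * (norm a + norm (adj a))"
      unfolding h_def a_def[symmetric] using norm_triangle_ineq[of a "adj a"] by simp
    then show nh: "norm (h i) \<le> sqrt d" using na by simp
    have "norm (psi d as i - h i) \<le> i * (\<epsilon> * sqrt d) / 2"
      unfolding h_def by (rule psi_close[OF as]) (use i n comm in auto)
    also have "\<dots> \<le> n * (\<epsilon> * sqrt d) / 2" using i \<epsilon> by (intro divide_right_mono mult_right_mono) auto
    finally have "norm (h i) * norm (psi d as i - h i) \<le> sqrt d * (n * (\<epsilon> * sqrt d) / 2)"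
      by (intro mult_mono nh) auto
    also have "\<dots> = n / 2 * \<epsilon> * d" by simp
    finally have "\<bar>inner (h i) (psi d as i - h i)\<bar> \<le> n / 2 * \<epsilon> * d"
      using Cauchy_Schwarz_ineq2[of "h i" "psi d as i - h i"] by linarith
    then show "inner (h i) (psi d as i) \<ge> inner (h i) (h i) - n / 2 * \<epsilon> * d"
      unfolding inner_diff_right by linarith
  qed
  have psi_large: "d - inner (psi d as i) (psi d as i) \<le> (real n + 1) * \<epsilon> * d" if i: "i < n" for i
  proof -
    have "0 \<le> inner (psi d as i - h i) (psi d as i - h i)" by simp
    then have "inner (psi d as i) (psi d as i) \<ge> 2 * inner (h i) (psi d as i) - inner (h i) (h i)"
      by (simp add: inner_diff_left inner_diff_right inner_commute)
    then show ?thesis using h(1)[OF i] hpsi[OF i] by (simp add: algebra_simps)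
  qed
  have nonneg: "0 \<le> inner (M w) (M w')" for w w' by (simp add: M_def povm_def inner_povm_nonneg)
  have "(\<Sum>w\<in>words n. \<Sum>w'\<in>words n. if w = w' then 0 else inner (M w) (M w')) \<le>
     (\<Sum>w\<in>words n. \<Sum>w'\<in>words n. \<Sum>i<n. (1 - sgnb (w ! i) * sgnb (w' ! i)) / 2 * inner (M w) (M w'))"
  proof (intro sum_mono)
    fix w w' assume w: "w \<in> words n" "w' \<in> words n"
    have c: "(1 - sgnb b * sgnb b') / 2 = (if b = b' then 0 else 1)" for b b' by (auto simp: sgnb_def)
    show "(if w = w' then 0 else inner (M w) (M w')) \<le>
      (\<Sum>i<n. (1 - sgnb (w ! i) * sgnb (w' ! i)) / 2 * inner (M w) (M w'))"
    proof (cases "w = w'")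
      case False
      then obtain i where i: "i < n" "w ! i \<noteq> w' ! i" using w by (auto simp: words_def list_eq_iff_nth_eq)
      have "inner (M w) (M w') = (1 - sgnb (w ! i) * sgnb (w' ! i)) / 2 * inner (M w) (M w')"
        using i by (simp add: c)
      also have "\<dots> \<le> (\<Sum>i<n. (1 - sgnb (w ! i) * sgnb (w' ! i)) / 2 * inner (M w) (M w'))"
        by (rule member_le_sum) (use i nonneg in \<open>auto simp: c\<close>)
      finally show ?thesis using False by simp
    qed (simp add: c)
  qed
  also have "\<dots> = (\<Sum>i<n. \<Sum>w\<in>words n. \<Sum>w'\<in>words n. (1 - sgnb (w ! i) * sgnb (w' ! i)) / 2 * inner (M w) (M w'))"
    by (subst (2) sum.swap, subst sum.swap, rule refl)
  also have "\<dots> = (\<Sum>i<n. (d - inner (psi d as i) (psi d as i)) / 2)"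
  proof (rule sum.cong[OF refl])
    fix i
    have 1: "(\<Sum>w\<in>words n. \<Sum>w'\<in>words n. inner (M w) (M w')) = d"
      using sum_sum_inner[of "\<lambda>_. 1" M "words n"] by (simp add: Msum inner_e)
    have 2: "(\<Sum>w\<in>words n. \<Sum>w'\<in>words n. sgnb (w ! i) * sgnb (w' ! i) * inner (M w) (M w')) = inner (psi d as i) (psi d as i)"
      unfolding psi by (rule sum_sum_inner)
    have "(\<Sum>w\<in>words n. \<Sum>w'\<in>words n. (1 - sgnb (w ! i) * sgnb (w' ! i)) / 2 * inner (M w) (M w')) =
      ((\<Sum>w\<in>words n. \<Sum>w'\<in>words n. inner (M w) (M w')) - (\<Sum>w\<in>words n. \<Sum>w'\<in>words n. sgnb (w ! i) * sgnb (w' ! i) * inner (M w) (M w'))) / 2"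
      unfolding sum_subtractf[symmetric] sum_divide_distrib by (intro sum.cong refl) (simp add: field_simps)
    then show "(\<Sum>w\<in>words n. \<Sum>w'\<in>words n. (1 - sgnb (w ! i) * sgnb (w' ! i)) / 2 * inner (M w) (M w')) =
      (d - inner (psi d as i) (psi d as i)) / 2" unfolding 1 2 .
  qed
  also have "\<dots> \<le> (\<Sum>i<n. (real n + 1) * \<epsilon> * d / 2)"
    by (intro sum_mono divide_right_mono psi_large) auto
  also have "\<dots> = real n * (real n + 1) / 2 * \<epsilon> * d" by (simp add: algebra_simps)
  finally show ?cross by (simp only: M_def of_nat_mult of_nat_add of_nat_1)
  assume i: "i < n"
  define a where "a = as ! i"
  have a: "a \<in> uni d" using as i n by (auto simp: a_def)
  have Z: "adj (a - s *\<^sub>R e d) * (a - s *\<^sub>R e d) = 2 *\<^sub>R e d - (2 * s) *\<^sub>R h i" if "s * s = 1" for s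
  proof -
    have "adj (a - s *\<^sub>R e d) * (a - s *\<^sub>R e d) = adj a * a - s *\<^sub>R (a + adj a) + (s * s) *\<^sub>R e d"
      using a by (simp add: adj_simps left_diff_distrib right_diff_distrib e_mult uniD bnd_adj scaleR_add_right scaleR_diff_right)
    then show ?thesis using a that by (simp add: uniD h_def a_def scaleR_2)
  qed
  have "(\<Sum>w\<in>words n. inner (adj (a - sgnb (w ! i) *\<^sub>R e d) * (a - sgnb (w ! i) *\<^sub>R e d)) (M w)) =
     (\<Sum>w\<in>words n. 2 * inner (e d) (M w) - 2 * inner (h i) (sgnb (w ! i) *\<^sub>R M w))"
    by (intro sum.cong refl) (simp add: Z inner_diff_left)
  also have "\<dots> = 2 * inner (e d) (\<Sum>w\<in>words n. M w) - 2 * inner (h i) (psi d as i)"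
    by (simp add: psi inner_sum_right sum_subtractf sum_distrib_left)
  also have "\<dots> \<le> (real n + 2) * \<epsilon> * d"
    using hpsi[OF i] h(1)[OF i] by (simp add: Msum inner_e algebra_simps)
  finally show "(\<Sum>w\<in>words n. inner (adj (as ! i - sgnb (w ! i) *\<^sub>R e d) * (as ! i - sgnb (w ! i) *\<^sub>R e d)) (povm d as w))
      \<le> (real n + 2) * \<epsilon> * d" by (simp add: a_def M_def)
qed

section \<open>Simultaneous diagonalization\<close>

lemma inner_conj_diag:
  assumes u: "u \<in> uni d" and v: "v \<in> uni d"
  shows "inner (u * diag d f * adj u) (v * diag d g * adj v) =
    (\<Sum>k<d. \<Sum>k'<d. f k * g k' * (cmod (entry (adj u * v) k k'))\<^sup>2)"
proof -
  define m where "m = adj u * v"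
  have bm: "bnd d m" using u v by (simp add: m_def bnd_mult bnd_adj uniD)
  have "inner (u * diag d f * adj u) (v * diag d g * adj v) = inner (diag d f) (adj u * (v * diag d g * adj v * u))"
    using inner_mult_right[of "u * diag d f" "adj u"] inner_mult_left[of u "diag d f"] by (simp add: mult.assoc)
  also have "adj u * (v * diag d g * adj v * u) = m * diag d g * adj m"
    by (simp add: m_def adj_mult mult.assoc)
  also have "inner (diag d f) (m * diag d g * adj m) = inner (diag d f * m) (m * diag d g)"
    using inner_mult_right[of "diag d f" m "m * diag d g"] by simp
  also have "\<dots> = (\<Sum>k<d. \<Sum>k'<d. f k * g k' * (cmod (entry m k k'))\<^sup>2)"
    unfolding inner_fmat_left[OF bnd_mult[OF bnd_diag bm]]
  proof (intro sum.cong refl)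
    fix k k' assume "k \<in> {..<d}" "k' \<in> {..<d}"
    then have "cnj (entry (diag d f * m) k k') * entry (m * diag d g) k k' =
        (f k * g k') *\<^sub>R (cnj (entry m k k') * entry m k k')"
      by (simp add: entry_mult_diag entry_diag_mult scaleR_conv_of_real)
    then show "Re (cnj (entry (diag d f * m) k k') * entry (m * diag d g) k k') = f k * g k' * (cmod (entry m k k'))\<^sup>2"
      by (simp only: Re_cnj_mult_self scaleR_complex.simps)
  qed
  finally show ?thesis by (simp only: m_def)
qed

lemma inner_conj_diag_same:
  assumes u: "u \<in> uni d"
  shows "inner (u * diag d f * adj u) (u * diag d g * adj u) = (\<Sum>k<d. f k * g k)"
proof -
  have "(\<Sum>k'<d. f k * g k' * (cmod (entry (adj u * u) k k'))\<^sup>2) = f k * g k" if "k < d" for k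
  proof -
    have "(\<Sum>k'<d. f k * g k' * (cmod (entry (adj u * u) k k'))\<^sup>2) = (\<Sum>k'<d. if k = k' then f k * g k' else 0)"
      using that by (intro sum.cong refl) (simp add: uniD(2)[OF u] entry_e)
    then show ?thesis using that by simp
  qed
  then show ?thesis unfolding inner_conj_diag[OF u u] by simp
qed

lemma inner_square_diag:
  assumes u: "u \<in> uni d" and Z: "bnd d Z"
  shows "inner (adj Z * Z) (u * diag d l * adj u) = (\<Sum>k<d. l k * (\<Sum>i<d. (cmod (entry (Z * u) i k))\<^sup>2))"
proof -
  have b: "bnd d (Z * u)" using u Z by (simp add: bnd_mult uniD)
  have "inner (adj Z * Z) (u * diag d l * adj u) = inner Z (Z * u * diag d l * adj u)"
    using inner_mult_left[of "adj Z" Z] by (simp add: mult.assoc)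
  also have "\<dots> = inner (Z * u) (Z * u * diag d l)"
    using inner_mult_right[of Z u "Z * u * diag d l"] by simp
  also have "\<dots> = (\<Sum>i<d. \<Sum>k<d. l k * (cmod (entry (Z * u) i k))\<^sup>2)"
    unfolding inner_fmat_left[OF b]
  proof (intro sum.cong refl)
    fix i k assume "i \<in> {..<d}" "k \<in> {..<d}"
    then have "cnj (entry (Z * u) i k) * entry (Z * u * diag d l) i k =
        l k *\<^sub>R (cnj (entry (Z * u) i k) * entry (Z * u) i k)"
      by (simp add: entry_mult_diag scaleR_conv_of_real)
    then show "Re (cnj (entry (Z * u) i k) * entry (Z * u * diag d l) i k) = l k * (cmod (entry (Z * u) i k))\<^sup>2"
      by (simp only: Re_cnj_mult_self scaleR_complex.simps)
  qed
  also have "\<dots> = (\<Sum>k<d. l k * (\<Sum>i<d. (cmod (entry (Z * u) i k))\<^sup>2))"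
    by (subst sum.swap) (simp add: sum_distrib_left)
  finally show ?thesis .
qed

text \<open>Let \<open>\<zeta>\<close> be the total overlap of different \<open>M\<^sub>w\<close>. It equals the sum of \<open>\<lambda>(1 - \<lambda>)\<close> over all eigenvalues of all
\<open>M\<^sub>w\<close>, so the number of eigenvalues above 1/2 is at least \<open>d - 2\<zeta>\<close>, and the Gram matrix of their
eigenvectors differs from 1 by at most \<open>6\<zeta>\<close> in squared norm.\<close>

theorem simultaneous_diagonalization:
  assumes as: "set as \<subseteq> uni d" and n: "length as = n"
    and comm: "\<And>i j. i < n \<Longrightarrow> j < n \<Longrightarrow> norm (as ! j * as ! i - as ! i * as ! j) \<le> \<epsilon> * sqrt d"
    and inv: "\<And>i. i < n \<Longrightarrow> norm (as ! i * as ! i - e d) \<le> \<epsilon> * sqrt d"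
    and \<epsilon>: "\<epsilon> > 0" and d: "d > 0"
  shows "\<exists>W\<in>uni d. \<exists>x :: nat \<Rightarrow> nat \<Rightarrow> bool. \<forall>i<n.
    norm (as ! i * W - W * diag d (\<lambda>a. sgnb (x a i))) \<le> 8 * (real n + 1) * sqrt \<epsilon> * sqrt d"
proof -
  define M where "M = povm d as"
  have "\<forall>w. \<exists>ul. fst ul \<in> uni d \<and> M w = fst ul * diag d (snd ul) * adj (fst ul)"
    using spectral[OF bnd_povm[OF as] adj_povm] unfolding M_def by (metis fst_conv snd_conv)
  then obtain ul where ul: "\<And>w. fst (ul w) \<in> uni d \<and> M w = fst (ul w) * diag d (snd (ul w)) * adj (fst (ul w))"
    unfolding choice_iff by blast
  define u l where "u w = fst (ul w)" and "l w = snd (ul w)" for w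
  have u: "u w \<in> uni d" and M: "M w = u w * diag d (l w) * adj (u w)" for w
    using ul[of w] by (simp_all add: u_def l_def)
  note bu = uniD(1)[OF u]
  have Msum: "(\<Sum>w\<in>words n. M w) = e d" using povm_sum[OF as] n by (simp add: M_def)
  have l: "0 \<le> l w k" "l w k \<le> 1" if k: "k < d" and w: "w \<in> words n" for w k
  proof -
    define D where "D = diag d (\<lambda>i. if i = k then 1 else 0)"
    define E where "E = u w * D * adj (u w)"
    have "D * D = D" by (simp add: D_def diag_mult_diag if_distrib cong: if_cong)
    moreover have "E * E = u w * (D * D) * adj (u w)"
      unfolding E_def D_def conj_diag_mult[OF u] diag_mult_diag ..
    ultimately have EE: "E = adj E * E" by (simp add: E_def D_def adj_mult mult.assoc)
    have pos: "0 \<le> inner E (M w')" for w'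
      by (subst EE) (simp add: M_def povm_def inner_povm_nonneg)
    have "inner E (M w) = l w k"
      unfolding E_def D_def M inner_conj_diag_same[OF u] using k by (simp add: if_distrib[of "\<lambda>z. z * _"] cong: if_cong)
    moreover have "(\<Sum>w\<in>words n. inner E (M w)) = 1"
    proof -
      have "(\<Sum>w\<in>words n. inner E (M w)) = inner E (u w * diag d (\<lambda>_. 1) * adj (u w))"
        by (simp only: Msum conj_diag_one[OF u] flip: inner_sum_right)
      then show ?thesis unfolding E_def D_def inner_conj_diag_same[OF u] using k by simp
    qed
    moreover have "inner E (M w) \<le> (\<Sum>w\<in>words n. inner E (M w))"
      by (rule member_le_sum) (use w pos in auto)
    ultimately show "0 \<le> l w k" "l w k \<le> 1" using pos[of w] by simp_all
  qed
  define J where "J = words n \<times> {..<d}"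
  define L where "L p = l (fst p) (snd p)" for p
  define I where "I = {p \<in> J. L p > 1 / 2}"
  have fin: "finite J" "finite I" "I \<subseteq> J" by (auto simp: I_def J_def)
  have L: "0 \<le> L p" "L p \<le> 1" if "p \<in> J" for p using that l by (auto simp: J_def L_def)
  define \<zeta> where "\<zeta> = (\<Sum>w\<in>words n. \<Sum>w'\<in>words n. if w = w' then 0 else inner (M w) (M w'))"
  have \<zeta>le: "\<zeta> \<le> real n * (real n + 1) / 2 * \<epsilon> * d"
    unfolding \<zeta>_def M_def by (rule povm_estimates[OF as n comm inv]) (use \<epsilon> in auto)
  define F where "F p q = (if fst p = fst q then 0 else (cmod (entry (adj (u (fst p)) * u (fst q)) (snd p) (snd q)))\<^sup>2)" for p q :: "bool list \<times> nat"
  have F0: "0 \<le> F p q" for p q by (simp add: F_def)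
  have Jsum: "(\<Sum>w\<in>words n. \<Sum>k<d. h (w, k)) = (\<Sum>p\<in>J. h p)" for h :: "bool list \<times> nat \<Rightarrow> real"
    by (simp add: J_def sum.cartesian_product)
  have \<zeta>F: "\<zeta> = (\<Sum>p\<in>J. \<Sum>q\<in>J. L p * L q * F p q)"
  proof -
    have "\<zeta> = (\<Sum>w\<in>words n. \<Sum>w'\<in>words n. \<Sum>k<d. \<Sum>k'<d. L (w, k) * L (w', k') * F (w, k) (w', k'))"
      unfolding \<zeta>_def by (intro sum.cong refl) (simp add: M inner_conj_diag[OF u u] L_def F_def)
    also have "\<dots> = (\<Sum>w\<in>words n. \<Sum>k<d. \<Sum>w'\<in>words n. \<Sum>k'<d. L (w, k) * L (w', k') * F (w, k) (w', k'))"
      by (intro sum.cong refl sum.swap)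
    also have "\<dots> = (\<Sum>w\<in>words n. \<Sum>k<d. \<Sum>q\<in>J. L (w, k) * L q * F (w, k) q)"
      by (intro sum.cong refl Jsum[of "\<lambda>q. L p * L q * F p q" for p])
    also have "\<dots> = (\<Sum>p\<in>J. \<Sum>q\<in>J. L p * L q * F p q)"
      by (rule Jsum[of "\<lambda>p. \<Sum>q\<in>J. L p * L q * F p q"])
    finally show ?thesis .
  qed
  have inner1: "inner (e d) (M w) = (\<Sum>k<d. l w k)" for w
    unfolding conj_diag_one[OF u[of w], symmetric] M inner_conj_diag_same[OF u] by simp
  have inner2: "inner (M w) (M w) = (\<Sum>k<d. l w k * l w k)" for w
    unfolding M by (rule inner_conj_diag_same[OF u])
  have sumL: "(\<Sum>p\<in>J. L p) = d"
  proof -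
    have "(\<Sum>p\<in>J. L p) = (\<Sum>w\<in>words n. inner (e d) (M w))"
      by (simp add: J_def L_def inner1 sum.cartesian_product case_prod_beta)
    then show ?thesis by (simp add: Msum inner_e flip: inner_sum_right)
  qed
  have \<zeta>L: "\<zeta> = (\<Sum>p\<in>J. L p * (1 - L p))"
  proof -
    have "\<zeta> = (\<Sum>w\<in>words n. (\<Sum>w'\<in>words n. inner (M w) (M w')) - inner (M w) (M w))"
      unfolding \<zeta>_def
    proof (rule sum.cong[OF refl])
      fix w assume "w \<in> words n"
      then have "(\<Sum>w'\<in>words n. inner (M w) (M w')) = inner (M w) (M w) + (\<Sum>w'\<in>words n - {w}. inner (M w) (M w'))"
        by (intro sum.remove) auto
      moreover have "(\<Sum>w'\<in>words n. if w = w' then 0 else inner (M w) (M w')) = (\<Sum>w'\<in>words n - {w}. inner (M w) (M w'))"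
        by (intro sum.mono_neutral_cong_right) auto
      ultimately show "(\<Sum>w'\<in>words n. if w = w' then 0 else inner (M w) (M w')) =
        (\<Sum>w'\<in>words n. inner (M w) (M w')) - inner (M w) (M w)" by simp
    qed
    also have "\<dots> = (\<Sum>w\<in>words n. inner (e d) (M w) - inner (M w) (M w))"
      by (simp only: Msum inner_commute[of "e d"] flip: inner_sum_right)
    also have "\<dots> = (\<Sum>p\<in>J. L p * (1 - L p))"
      by (simp add: J_def L_def inner1 inner2 sum.cartesian_product case_prod_beta right_diff_distrib flip: sum_subtractf)
    finally show ?thesis .
  qed
  have cardI: "d \<le> card I + 2 * \<zeta>"
  proof -
    have "real d = (\<Sum>p\<in>I. L p) + (\<Sum>p\<in>J - I. L p)"
      unfolding sumL[symmetric] using fin by (metis add.commute sum.subset_diff)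
    also have "(\<Sum>p\<in>I. L p) \<le> (\<Sum>p\<in>I. 1)" using L fin(3) by (intro sum_mono) auto
    also have "(\<Sum>p\<in>J - I. L p) \<le> (\<Sum>p\<in>J - I. 2 * (L p * (1 - L p)))"
    proof (rule sum_mono)
      fix p assume "p \<in> J - I"
      then have "0 \<le> L p" "L p \<le> 1 / 2" using L by (auto simp: I_def)
      then have "L p * 1 \<le> L p * (2 * (1 - L p))" by (intro mult_left_mono) auto
      then show "L p \<le> 2 * (L p * (1 - L p))" by (simp only: mult_1_right mult.left_commute[of 2])
    qed
    also have "\<dots> \<le> (\<Sum>p\<in>J. 2 * (L p * (1 - L p)))" using L fin by (intro sum_mono2) auto
    also have "\<dots> = 2 * \<zeta>" by (simp only: \<zeta>L sum_distrib_left)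
    finally show ?thesis by simp
  qed
  obtain g where g: "bij_betw g {0..<card I} I" using ex_bij_betw_nat_finite[OF fin(2)] by blast
  (* The number of kept eigenvectors need not be exactly d: surplus ones are dropped,
     and missing columns of R are zero. Both defects are controlled by \<zeta>. *)
  define m where "m = min d (card I)"
  have gI: "g a \<in> I" if "a < m" for a using g that by (auto simp: m_def bij_betw_def)
  have ginj: "inj_on g {..<m}" using g by (auto simp: m_def bij_betw_def intro: inj_on_subset)
  define R where "R = fmat_of d (\<lambda>i a. if a < m then entry (u (fst (g a))) i (snd (g a)) else 0)"
  have bR: "bnd d R" by (simp add: R_def)
  have snd_g: "snd (g a) < d" "fst (g a) \<in> words n" if "a < m" for a using gI[OF that] by (auto simp: I_def J_def)
  have sub: "(\<Sum>a<m. h (g a)) \<le> (\<Sum>p\<in>I. h p)" if "\<And>p. 0 \<le> h p" for h :: "bool list \<times> nat \<Rightarrow> real"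
  proof -
    have "(\<Sum>a<m. h (g a)) = sum h (g ` {..<m})" by (simp add: sum.reindex[OF ginj])
    also have "\<dots> \<le> sum h I" using gI that fin by (intro sum_mono2) auto
    finally show ?thesis .
  qed
  have RR: "entry (adj R * R) a b =
      (if a < m \<and> b < m then entry (adj (u (fst (g a))) * u (fst (g b))) (snd (g a)) (snd (g b)) else 0)"
    if "a < d" "b < d" for a b
  proof -
    have "entry (adj R * R) a b = (\<Sum>i<d. cnj (entry R i a) * entry R i b)"
      by (simp add: entry_mult_left[OF bnd_adj[OF bR]])
    moreover have "entry (adj (u (fst (g a))) * u (fst (g b))) (snd (g a)) (snd (g b)) =
       (\<Sum>i<d. cnj (entry (u (fst (g a))) i (snd (g a))) * entry (u (fst (g b))) i (snd (g b)))"
      by (simp add: entry_mult_left[OF bnd_adj[OF bu]])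
    ultimately show ?thesis using that by (simp add: R_def)
  qed
  have gram: "(norm (e d - adj R * R))\<^sup>2 \<le> 6 * \<zeta>"
  proof -
    have "(norm (e d - adj R * R))\<^sup>2 = (\<Sum>a<d. \<Sum>b<d. (cmod (entry (e d) a b - entry (adj R * R) a b))\<^sup>2)"
      using bR by (subst norm_sq[of d]) (simp_all add: bnd_diff bnd_mult bnd_adj)
    also have "\<dots> \<le> (\<Sum>a<d. \<Sum>b<d. (if a < m \<and> b < m then F (g a) (g b) else 0) + (if a = b \<and> m \<le> a then 1 else 0))"
    proof (intro sum_mono)
      fix a b assume "a \<in> {..<d}" "b \<in> {..<d}"
      then have ab: "a < d" "b < d" by auto
      consider "a < m" "b < m" "fst (g a) = fst (g b)" | "a < m" "b < m" "fst (g a) \<noteq> fst (g b)" | "\<not> (a < m \<and> b < m)"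
        by blast
      then show "(cmod (entry (e d) a b - entry (adj R * R) a b))\<^sup>2 \<le>
        (if a < m \<and> b < m then F (g a) (g b) else 0) + (if a = b \<and> m \<le> a then 1 else 0)"
      proof cases
        case 1
        then have "a = b \<longleftrightarrow> snd (g a) = snd (g b)"
          using ginj by (metis inj_onD lessThan_iff prod_eqI)
        then show ?thesis using 1 ab snd_g[OF 1(1)] snd_g[OF 1(2)]
          by (simp add: RR uniD(2)[OF u] entry_e F0)
      next
        case 2
        then show ?thesis using ab by (auto simp: RR entry_e F_def)
      next
        case 3
        then show ?thesis using ab by (auto simp: RR entry_e)
      qed
    qed
    also have "\<dots> = (\<Sum>a<d. \<Sum>b<d. if a < m \<and> b < m then F (g a) (g b) else 0) + (\<Sum>a<d. \<Sum>b<d. if a = b \<and> m \<le> a then 1 else 0)"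
      by (simp only: sum.distrib)
    also have "(\<Sum>a<d. \<Sum>b<d. if a < m \<and> b < m then F (g a) (g b) else 0) = (\<Sum>a<m. \<Sum>b<m. F (g a) (g b))"
    proof -
      have "(\<Sum>a<m. \<Sum>b<m. F (g a) (g b)) = (\<Sum>a<m. \<Sum>b<d. if a < m \<and> b < m then F (g a) (g b) else 0)"
        by (intro sum.cong refl sum.mono_neutral_cong_left) (auto simp: m_def)
      also have "\<dots> = (\<Sum>a<d. \<Sum>b<d. if a < m \<and> b < m then F (g a) (g b) else 0)"
        by (intro sum.mono_neutral_left) (auto simp: m_def min_le_iff_disj)
      finally show ?thesis by simp
    qed
    also have "(\<Sum>a<d. \<Sum>b<d. if a = b \<and> m \<le> a then 1 else 0) = real (d - m)"
    proof -
      have "(\<Sum>a<d. \<Sum>b<d. if a = b \<and> m \<le> a then 1 else 0) = (\<Sum>a<d. if m \<le> a then 1 else (0 :: real))"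
        by (intro sum.cong refl) (auto simp: sum.delta if_distrib cong: if_cong)
      also have "\<dots> = (\<Sum>a\<in>{m..<d}. 1)" by (intro sum.mono_neutral_cong_right) auto
      finally show ?thesis by simp
    qed
    also have "(\<Sum>a<m. \<Sum>b<m. F (g a) (g b)) \<le> (\<Sum>p\<in>I. \<Sum>q\<in>I. F p q)"
    proof -
      have "(\<Sum>a<m. \<Sum>b<m. F (g a) (g b)) \<le> (\<Sum>a<m. \<Sum>q\<in>I. F (g a) q)"
        by (intro sum_mono sub F0)
      also have "\<dots> \<le> (\<Sum>p\<in>I. \<Sum>q\<in>I. F p q)" by (rule sub) (simp add: sum_nonneg F0)
      finally show ?thesis .
    qed
    also have "(\<Sum>p\<in>I. \<Sum>q\<in>I. F p q) \<le> (\<Sum>p\<in>I. \<Sum>q\<in>I. 4 * (L p * L q * F p q))"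
    proof (intro sum_mono)
      fix p q assume "p \<in> I" "q \<in> I"
      then have "1 / 2 * (1 / 2) \<le> L p * L q" by (intro mult_mono) (auto simp: I_def)
      then have "1 * F p q \<le> (4 * (L p * L q)) * F p q" by (intro mult_right_mono F0) simp
      then show "F p q \<le> 4 * (L p * L q * F p q)" by simp
    qed
    also have "\<dots> \<le> (\<Sum>p\<in>J. \<Sum>q\<in>J. 4 * (L p * L q * F p q))"
    proof -
      have pos: "0 \<le> 4 * (L p * L q * F p q)" if "p \<in> J" "q \<in> J" for p q using L that F0 by simp
      have "(\<Sum>p\<in>I. \<Sum>q\<in>I. 4 * (L p * L q * F p q)) \<le> (\<Sum>p\<in>I. \<Sum>q\<in>J. 4 * (L p * L q * F p q))"
        using fin pos by (intro sum_mono sum_mono2) auto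
      also have "\<dots> \<le> (\<Sum>p\<in>J. \<Sum>q\<in>J. 4 * (L p * L q * F p q))"
        using fin pos by (intro sum_mono2 sum_nonneg) auto
      finally show ?thesis .
    qed
    also have "\<dots> = 4 * \<zeta>" by (simp only: \<zeta>F sum_distrib_left)
    finally have "(norm (e d - adj R * R))\<^sup>2 \<le> 4 * \<zeta> + real (d - m)" by simp
    moreover have "real (d - m) \<le> 2 * \<zeta>"
    proof -
      have "0 \<le> \<zeta>" unfolding \<zeta>L using L by (intro sum_nonneg) auto
      then show ?thesis using cardI by (auto simp: m_def min_def of_nat_diff)
    qed
    ultimately show ?thesis by simp
  qed
  (* The slack of the polar decomposition, chosen so that 7/4 + 1/4 = 2 below (7/4 bounds sqrt 3). *)
  define \<gamma> where "\<gamma> = sqrt \<epsilon> * sqrt d / 4"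
  have \<gamma>: "\<gamma> > 0" using \<epsilon> d by (simp add: \<gamma>_def)
  obtain W where W: "W \<in> uni d" and WR0: "norm (W - R) \<le> norm (e d - adj R * R) + \<gamma>"
    using approximate_polar[OF bR e_uni \<gamma>] by blast
  have "(norm (e d - adj R * R))\<^sup>2 \<le> (sqrt 3 * ((real n + 1) * sqrt \<epsilon> * sqrt d))\<^sup>2"
  proof -
    have "6 * \<zeta> \<le> 3 * (real n * (real n + 1)) * (\<epsilon> * d)" using \<zeta>le by (simp add: algebra_simps)
    also have "\<dots> \<le> 3 * ((real n + 1) * (real n + 1)) * (\<epsilon> * d)"
      using \<epsilon> by (intro mult_right_mono mult_left_mono) (auto simp: algebra_simps)
    also have "\<dots> = (sqrt 3 * ((real n + 1) * sqrt \<epsilon> * sqrt d))\<^sup>2"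
      using \<epsilon> by (simp add: power_mult_distrib) (simp add: power2_eq_square)
    finally show ?thesis using gram by simp
  qed
  then have "norm (e d - adj R * R) \<le> sqrt 3 * ((real n + 1) * sqrt \<epsilon> * sqrt d)"
    by (rule power2_le_imp_le) (use \<epsilon> in auto)
  also have "\<dots> \<le> 7 / 4 * ((real n + 1) * sqrt \<epsilon> * sqrt d)"
    by (intro mult_right_mono real_le_lsqrt) (use \<epsilon> in \<open>auto simp: power2_eq_square\<close>)
  finally have "norm (e d - adj R * R) \<le> 7 / 4 * ((real n + 1) * sqrt \<epsilon> * sqrt d)" .
  moreover have "\<gamma> \<le> 1 / 4 * ((real n + 1) * sqrt \<epsilon> * sqrt d)"
  proof -
    have "1 * (sqrt \<epsilon> * sqrt d) \<le> (real n + 1) * (sqrt \<epsilon> * sqrt d)" using \<epsilon> by (intro mult_right_mono) auto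
    then show ?thesis by (simp add: \<gamma>_def mult.assoc)
  qed
  ultimately have WR: "norm (W - R) \<le> 2 * ((real n + 1) * sqrt \<epsilon> * sqrt d)" using WR0 by linarith
  define x where "x a i = (if a < m then fst (g a) ! i else True)" for a i
  have "norm (as ! i * W - W * diag d (\<lambda>a. sgnb (x a i))) \<le> 8 * (real n + 1) * sqrt \<epsilon> * sqrt d" if i: "i < n" for i
  proof -
    define a where "a = as ! i"
    define D where "D = diag d (\<lambda>b. sgnb (x b i))"
    have a: "a \<in> uni d" using as i n by (auto simp: a_def)
    have D: "D \<in> uni d" by (simp add: uni_def D_def diag_mult_diag diag_const_one)
    define Z where "Z w = a - sgnb (w ! i) *\<^sub>R e d" for w :: "bool list"
    have bZ: "bnd d (Z w)" for w using a by (simp add: Z_def bnd_diff bnd_scaleR uniD)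
    define h where "h p = (\<Sum>j<d. (cmod (entry (Z (fst p) * u (fst p)) j (snd p)))\<^sup>2)" for p
    have h0: "0 \<le> h p" for p by (simp add: h_def sum_nonneg)
    have ent: "entry (a * R - R * D) j b = (if b < m then entry (Z (fst (g b)) * u (fst (g b))) j (snd (g b)) else 0)"
      if "j < d" "b < d" for j b
    proof -
      have "entry (a * R) j b = (\<Sum>k<d. entry a j k * entry R k b)" by (rule entry_mult_right[OF bR])
      moreover have "entry (a * u w) j k = (\<Sum>i<d. entry a j i * entry (u w) i k)" for w k by (rule entry_mult_right[OF bu])
      moreover have "Z w * u w = a * u w - sgnb (w ! i) *\<^sub>R u w" for w
        by (simp add: Z_def left_diff_distrib e_mult bu)
      ultimately show ?thesis using that by (simp add: D_def entry_mult_diag R_def x_def mult.commute)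
    qed
    have "(norm (a * R - R * D))\<^sup>2 = (\<Sum>j<d. \<Sum>b<d. (cmod (entry (a * R - R * D) j b))\<^sup>2)"
      using a bR D by (intro norm_sq) (simp add: bnd_diff bnd_mult uniD)
    also have "\<dots> = (\<Sum>j<d. \<Sum>b<d. if b < m then (cmod (entry (Z (fst (g b)) * u (fst (g b))) j (snd (g b))))\<^sup>2 else 0)"
    proof (intro sum.cong refl)
      fix j b assume "j \<in> {..<d}" "b \<in> {..<d}"
      then show "(cmod (entry (a * R - R * D) j b))\<^sup>2 =
          (if b < m then (cmod (entry (Z (fst (g b)) * u (fst (g b))) j (snd (g b))))\<^sup>2 else 0)"
        using ent[of j b] by (simp del: entry_simps)
    qed
    also have "\<dots> = (\<Sum>b<d. if b < m then h (g b) else 0)"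
      by (subst sum.swap) (intro sum.cong refl, simp add: h_def)
    also have "\<dots> = (\<Sum>b<m. h (g b))" by (intro sum.mono_neutral_cong_right) (auto simp: m_def)
    also have "\<dots> \<le> (\<Sum>p\<in>I. h p)" by (rule sub[OF h0])
    also have "\<dots> \<le> (\<Sum>p\<in>I. 2 * (L p * h p))"
    proof (rule sum_mono)
      fix p assume "p \<in> I"
      then have "1 * h p \<le> (2 * L p) * h p" by (intro mult_right_mono h0) (auto simp: I_def)
      then show "h p \<le> 2 * (L p * h p)" by simp
    qed
    also have "\<dots> \<le> (\<Sum>p\<in>J. 2 * (L p * h p))" using fin L h0 by (intro sum_mono2) auto
    also have "\<dots> = 2 * (\<Sum>w\<in>words n. inner (adj (Z w) * Z w) (M w))"
      by (simp add: M inner_square_diag[OF u bZ] J_def L_def h_def sum.cartesian_product case_prod_beta flip: sum_distrib_left)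
    also have "\<dots> \<le> 2 * ((real n + 2) * \<epsilon> * d)"
      unfolding Z_def a_def M_def
      by (intro mult_left_mono povm_estimates(2)[OF as n comm inv]) (use \<epsilon> i in auto)
    also have "\<dots> \<le> (2 * (real n + 1)) * (2 * (real n + 1)) * (\<epsilon> * d)"
    proof -
      have "2 * (real n + 2) \<le> (2 * (real n + 1)) * (2 * (real n + 1))" by (simp add: algebra_simps)
      then have "2 * (real n + 2) * (\<epsilon> * d) \<le> (2 * (real n + 1)) * (2 * (real n + 1)) * (\<epsilon> * d)"
        using \<epsilon> by (intro mult_right_mono) auto
      then show ?thesis by (simp only: mult.assoc)
    qed
    also have "\<dots> = (2 * ((real n + 1) * sqrt \<epsilon> * sqrt d))\<^sup>2"
      using \<epsilon> by (simp add: power_mult_distrib) (simp add: power2_eq_square algebra_simps)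
    finally have aR: "norm (a * R - R * D) \<le> 2 * ((real n + 1) * sqrt \<epsilon> * sqrt d)"
      by (rule power2_le_imp_le) (use \<epsilon> in auto)
    have "a * W - W * D = a * (W - R) + (a * R - R * D) - (W - R) * D"
      by (simp add: algebra_simps)
    then have "norm (a * W - W * D) \<le> norm (a * (W - R)) + norm (a * R - R * D) + norm ((W - R) * D)"
      by (metis norm_triangle_ineq4 norm_triangle_ineq order.trans add_right_mono)
    also have "\<dots> = norm (W - R) + norm (a * R - R * D) + norm (W - R)"
      using norm_uni_left[OF a, of "W - R"] norm_uni_right[OF D, of "W - R"] uniD(1)[OF W] bR by (simp add: bnd_diff)
    also have "\<dots> \<le> 8 * ((real n + 1) * sqrt \<epsilon> * sqrt d)"
      using WR aR \<epsilon> by (smt (verit) mult_nonneg_nonneg of_nat_0_le_iff real_sqrt_ge_zero)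
    finally show ?thesis by (simp only: a_def D_def mult.assoc)
  qed
  then show ?thesis using W by blast
qed

section \<open>Rounding a unitary that almost permutes labels\<close>

lemma norm_le_entrywise:
  assumes "bnd d x" "bnd d y" "\<And>i j. i < d \<Longrightarrow> j < d \<Longrightarrow> cmod (entry x i j) \<le> cmod (entry y i j)"
  shows "norm x \<le> norm y"
proof (rule power2_le_imp_le)
  show "(norm x)\<^sup>2 \<le> (norm y)\<^sup>2"
    unfolding norm_sq[OF assms(1)] norm_sq[OF assms(2)]
    by (intro sum_mono power_mono assms(3)) auto
qed simp

text \<open>Classes of equal size make room for a permutation of the indices that induces \<open>\<pi>\<close> on labels.\<close>

lemma label_permutation:
  fixes lam :: "nat \<Rightarrow> 'c"
  assumes inj: "inj \<pi>" and c: "\<And>s. card {a. a < d \<and> lam a = s} = card {a. a < d \<and> lam a = \<pi> s}"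
  obtains \<sigma> where "\<And>b. b < d \<Longrightarrow> \<sigma> b < d \<and> lam (\<sigma> b) = \<pi> (lam b)" "inj_on \<sigma> {..<d}"
proof -
  have "\<exists>h. bij_betw h {a. a < d \<and> lam a = s} {a. a < d \<and> lam a = \<pi> s}" for s
    using c by (intro finite_same_card_bij) auto
  then obtain h where h: "\<And>s. bij_betw (h s) {a. a < d \<and> lam a = s} {a. a < d \<and> lam a = \<pi> s}" by metis
  have 1: "h (lam b) b < d \<and> lam (h (lam b) b) = \<pi> (lam b)" if "b < d" for b
    using bij_betwE[OF h[of "lam b"]] that by blast
  moreover have "inj_on (\<lambda>b. h (lam b) b) {..<d}"
  proof (rule inj_onI)
    fix b b' assume b: "b \<in> {..<d}" "b' \<in> {..<d}" and eq: "h (lam b) b = h (lam b') b'"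
    then have "\<pi> (lam b) = \<pi> (lam b')" using 1 by (metis lessThan_iff)
    then have "lam b = lam b'" using inj by (simp add: inj_eq)
    then show "b = b'" using bij_betw_imp_inj_on[OF h[of "lam b"]] b eq by (auto dest: inj_onD)
  qed
  ultimately show ?thesis by (rule that)
qed

text \<open>Let \<open>X\<close> be \<open>T\<close> with all entries deleted that do not respect \<open>\<pi>\<close>. Then \<open>1 - X\<^sup>* X\<close> consists of entries of
\<open>T\<^sup>* (T - X)\<close>, so its norm is at most that of \<open>T - X\<close>. The permutation matrix compatible with \<open>\<pi>\<close> serves as
the direction of perturbation in the polar decomposition.\<close>

theorem masked_rounding:
  fixes lam :: "nat \<Rightarrow> 'c"
  assumes T: "T \<in> uni d" and inj: "inj \<pi>"
    and c: "\<And>s. card {a. a < d \<and> lam a = s} = card {a. a < d \<and> lam a = \<pi> s}" and \<gamma>: "\<gamma> > 0"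
  shows "\<exists>U\<in>uni d.
    norm (T - U) \<le> 2 * sqrt (\<Sum>a<d. \<Sum>b<d. if lam a = \<pi> (lam b) then 0 else (cmod (entry T a b))\<^sup>2) + \<gamma> \<and>
    (\<forall>f. U * diag d (\<lambda>b. f (\<pi> (lam b))) = diag d (\<lambda>a. f (lam a)) * U)"
proof -
  note bT = uniD(1)[OF T]
  obtain \<sigma> where \<sigma>: "\<And>b. b < d \<Longrightarrow> \<sigma> b < d \<and> lam (\<sigma> b) = \<pi> (lam b)" and \<sigma>inj: "inj_on \<sigma> {..<d}"
    using label_permutation[OF inj c] by metis
  define P where "P = fmat_of d (\<lambda>a b. if a = \<sigma> b then 1 else 0)"
  have bP: "bnd d P" by (simp add: P_def)
  have "adj P * P = e d"
  proof (rule fmat_eqI)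
    fix b b'
    have "entry (adj P * P) b b' = (\<Sum>a<d. if b < d \<and> b' < d \<and> a = \<sigma> b \<and> a = \<sigma> b' then 1 else 0)"
      unfolding entry_mult_left[OF bnd_adj[OF bP]] by (intro sum.cong refl) (auto simp: P_def)
    also have "\<dots> = (\<Sum>a<d. if a = \<sigma> b then (if b < d \<and> b = b' then 1 else 0) else 0)"
      using \<sigma>inj by (intro sum.cong refl) (auto dest: inj_onD)
    also have "\<dots> = entry (e d) b b'" using \<sigma> by (auto simp: entry_e)
    finally show "entry (adj P * P) b b' = entry (e d) b b'" .
  qed
  then have P: "P \<in> uni d" using bP by (rule uniI_left[rotated])
  define X where "X = fmat_of d (\<lambda>a b. if lam a = \<pi> (lam b) then entry T a b else 0)"
  have bX: "bnd d X" by (simp add: X_def)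
  have "norm (e d - adj X * X) \<le> norm (adj T * (T - X))"
  proof (rule norm_le_entrywise)
    show "bnd d (e d - adj X * X)" "bnd d (adj T * (T - X))"
      using bX bT by (simp_all add: bnd_diff bnd_mult bnd_adj)
    fix b' b assume b: "b' < d" "b < d"
    have XX: "entry (adj X * X) b' b = (\<Sum>a<d. cnj (entry X a b') * entry X a b)"
      by (simp add: entry_mult_left[OF bnd_adj[OF bX]])
    show "cmod (entry (e d - adj X * X) b' b) \<le> cmod (entry (adj T * (T - X)) b' b)"
    proof (cases "lam b' = lam b")
      case True
      have "entry (adj X * X) b' b = (\<Sum>a<d. cnj (entry T a b') * entry X a b)"
        unfolding XX by (intro sum.cong refl) (use True b in \<open>auto simp: X_def\<close>)
      also have "\<dots> = entry (adj T * X) b' b" by (simp add: entry_mult_left[OF bnd_adj[OF bT]])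
      finally show ?thesis using T by (simp add: right_diff_distrib uniD)
    next
      case False
      then have "b' \<noteq> b" by auto
      moreover have "entry (adj X * X) b' b = 0"
        unfolding XX by (intro sum.neutral ballI) (use False inj in \<open>auto simp: X_def inj_eq\<close>)
      ultimately show ?thesis by (simp add: entry_e)
    qed
  qed
  also have "\<dots> = norm (T - X)" using norm_uni_left[OF adj_uni[OF T]] bT bX by (simp add: bnd_diff)
  finally have 1: "norm (e d - adj X * X) \<le> norm (T - X)" .
  have "(norm (T - X))\<^sup>2 = (\<Sum>a<d. \<Sum>b<d. if lam a = \<pi> (lam b) then 0 else (cmod (entry T a b))\<^sup>2)"
    unfolding norm_sq[OF bnd_diff[OF bT bX]] by (intro sum.cong refl) (auto simp: X_def)
  then have 2: "norm (T - X) = sqrt (\<Sum>a<d. \<Sum>b<d. if lam a = \<pi> (lam b) then 0 else (cmod (entry T a b))\<^sup>2)"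
    by (metis norm_ge_zero real_sqrt_unique)
  obtain U where U: "U \<in> uni d" "norm (U - X) \<le> norm (e d - adj X * X) + \<gamma>"
    and com: "\<And>y y'. bnd d y \<Longrightarrow> adj y = y \<Longrightarrow> adj y' = y' \<Longrightarrow> X * y = y' * X \<Longrightarrow> P * y = y' * P \<Longrightarrow> U * y = y' * U"
    using approximate_polar[OF bX P \<gamma>] by blast
  have "U * diag d (\<lambda>b. f (\<pi> (lam b))) = diag d (\<lambda>a. f (lam a)) * U" for f
  proof (rule com)
    show "X * diag d (\<lambda>b. f (\<pi> (lam b))) = diag d (\<lambda>a. f (lam a)) * X"
      by (rule fmat_eqI) (auto simp: entry_mult_diag entry_diag_mult X_def)
    show "P * diag d (\<lambda>b. f (\<pi> (lam b))) = diag d (\<lambda>a. f (lam a)) * P"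
      by (rule fmat_eqI) (use \<sigma> in \<open>auto simp: entry_mult_diag entry_diag_mult P_def\<close>)
  qed simp_all
  moreover have "norm (T - U) \<le> norm (T - X) + norm (U - X)"
    by (metis norm_minus_commute norm_triangle_ineq diff_add_cancel add_diff_eq)
  ultimately show ?thesis using U 1 2 by (intro bexI[OF _ U(1)]) auto
qed

section \<open>Cyclic labels of words\<close>

context
  fixes k l :: nat and H :: "bool list \<Rightarrow> bool"
begin

text \<open>The letters \<open>y i\<close> of a word are read as time passes. Time \<open>i\<close> is a cut if the block of \<open>4k\<close> letters that starts
there is selected by \<open>H\<close>. The time \<open>l\<close> is the present, so that about \<open>l\<close> times in the past and in the future are visible, and
the letter that belongs to time \<open>i\<close> is \<open>y (i + k)\<close>: a repetition among the blocks of the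
next \<open>k\<close> times yields a period only from \<open>k\<close> letters later on.\<close>

definition blk :: "(nat \<Rightarrow> bool) \<Rightarrow> nat \<Rightarrow> bool list" where
  "blk y i = map (\<lambda>j. y (i + j)) [0..<4 * k]"

definition cut_at :: "(nat \<Rightarrow> bool) \<Rightarrow> nat \<Rightarrow> bool" where
  "cut_at y i \<longleftrightarrow> H (blk y i)"

definition quiet :: "(nat \<Rightarrow> bool) \<Rightarrow> nat \<Rightarrow> bool" where
  "quiet y i \<longleftrightarrow> (\<forall>j. i \<le> j \<longrightarrow> j < i + l \<longrightarrow> \<not> cut_at y j)"

text \<open>A stretch begins after a cut or at the end of a quiet period.\<close>

definition base :: "(nat \<Rightarrow> bool) \<Rightarrow> nat \<Rightarrow> bool" where
  "base y i \<longleftrightarrow> (\<exists>j. i = Suc j \<and> (cut_at y j \<or> quiet y j))"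

definition recurs :: "(nat \<Rightarrow> bool) \<Rightarrow> bool" where
  "recurs y \<longleftrightarrow> (\<exists>i j. i < j \<and> j < k \<and> blk y (l + i) = blk y (l + j))"

definition has_period :: "(nat \<Rightarrow> bool) \<Rightarrow> nat \<Rightarrow> bool" where
  "has_period y p \<longleftrightarrow> 1 \<le> p \<and> p \<le> k \<and> (\<forall>t. l + k \<le> t \<longrightarrow> t + p < l + 4 * k \<longrightarrow> y t = y (t + p))"

definition period :: "(nat \<Rightarrow> bool) \<Rightarrow> nat" where
  "period y = (LEAST p. has_period y p)"

definition last_base :: "(nat \<Rightarrow> bool) \<Rightarrow> nat" where
  "last_base y = (GREATEST i. i \<le> l \<and> base y i)"

definition next_cut :: "(nat \<Rightarrow> bool) \<Rightarrow> nat" where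
  "next_cut y = (LEAST j. l \<le> j \<and> cut_at y j)"

text \<open>The stretch around the present. The marker singles out its first letter, so that rotations of the
stretch are distinguished and the step that closes the cycle can be recognized.\<close>

definition tower :: "(nat \<Rightarrow> bool) \<Rightarrow> (bool \<times> bool) list" where
  "tower y = map (\<lambda>i. (y (i + k), i = last_base y)) [last_base y..<Suc (next_cut y)]"

text \<open>The head of a label is the present letter, and \<^const>\<open>rotate1\<close> is the expected effect of one step. The
one-letter label of a quiet word without repetition is a fixed point of the rotation.\<close>

definition label :: "(nat \<Rightarrow> bool) \<Rightarrow> (bool \<times> bool) list" where
  "label y = (if quiet y l
     then if recurs y then map (\<lambda>j. (y (l + k + j), False)) [0..<period y] else [(y (l + k), False)]
     else rotate (l - last_base y) (tower y))"

text \<open>The labels whose next step does not close a stretch.\<close>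

definition unmarked_next :: "(bool \<times> bool) list set" where
  "unmarked_next = {s. \<not> snd (hd (rotate1 s))}"

definition shifted :: "(nat \<Rightarrow> bool) \<Rightarrow> (nat \<Rightarrow> bool) \<Rightarrow> bool" where
  "shifted y z \<longleftrightarrow> (\<forall>i < 2 * l + 4 * k. z i = y (Suc i))"

lemma cut_at_shifted: "shifted y z \<Longrightarrow> i \<le> 2 * l \<Longrightarrow> cut_at z i = cut_at y (Suc i)"
  unfolding cut_at_def blk_def shifted_def
  by (rule arg_cong[of _ _ H]) auto

lemma quiet_shifted: assumes "shifted y z" "i \<le> l" shows "quiet z i = quiet y (Suc i)"
proof -
  have "quiet z i \<longleftrightarrow> (\<forall>j. i \<le> j \<longrightarrow> j < i + l \<longrightarrow> \<not> cut_at y (Suc j))"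
    unfolding quiet_def using cut_at_shifted[OF assms(1)] assms(2) by auto
  also have "\<dots> \<longleftrightarrow> quiet y (Suc i)"
    unfolding quiet_def by (metis Suc_le_D Suc_le_mono add_Suc not_less_eq)
  finally show ?thesis .
qed

lemma base_shifted: assumes "shifted y z" "i < l" shows "base z (Suc i) = base y (Suc (Suc i))"
  using cut_at_shifted[OF assms(1), of i] quiet_shifted[OF assms(1), of i] assms(2) by (auto simp: base_def)

text \<open>Going back from a time that is not quiet, without meeting a base, one meets neither a cut nor a quiet
time. After \<open>l\<close> steps back this contradicts that the earliest time is not quiet.\<close>

lemma base_exists: assumes "\<not> quiet y l" shows "\<exists>i\<le>l. base y i"
proof (rule ccontr)
  assume no: "\<not> (\<exists>i\<le>l. base y i)"
  have "\<not> quiet y (l - j) \<and> (\<forall>t. l - j \<le> t \<longrightarrow> t < l \<longrightarrow> \<not> cut_at y t)" if "j \<le> l" for j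
    using that
  proof (induction j)
    case (Suc j)
    then have eq: "Suc (l - Suc j) = l - j" by simp
    have "\<not> base y (Suc (l - Suc j))" using no Suc.prems by auto
    then have "\<not> cut_at y (l - Suc j)" "\<not> quiet y (l - Suc j)" by (auto simp: base_def)
    then show ?case using Suc by (metis Suc_leD eq not_less_eq_eq order_antisym)
  qed (use assms in simp)
  from this[of l] show False by (auto simp: quiet_def)
qed

lemma last_base:
  assumes "\<not> quiet y l"
  shows "1 \<le> last_base y" "last_base y \<le> l" "base y (last_base y)"
    "\<And>i. base y i \<Longrightarrow> i \<le> l \<Longrightarrow> i \<le> last_base y"
proof -
  obtain i where i: "i \<le> l \<and> base y i" using base_exists[OF assms] by blast
  have 1: "last_base y \<le> l \<and> base y (last_base y)"
    unfolding last_base_def by (rule GreatestI_nat[of _ i l]) (use i in auto)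
  then show "last_base y \<le> l" "base y (last_base y)" by auto
  then show "1 \<le> last_base y" by (auto simp: base_def)
  show "\<And>i. base y i \<Longrightarrow> i \<le> l \<Longrightarrow> i \<le> last_base y"
    unfolding last_base_def by (rule Greatest_le_nat[of _ _ l]) auto
qed

lemma next_cut:
  assumes "\<not> quiet y l"
  shows "l \<le> next_cut y" "next_cut y < 2 * l" "cut_at y (next_cut y)"
    "\<And>j. l \<le> j \<Longrightarrow> cut_at y j \<Longrightarrow> next_cut y \<le> j"
proof -
  obtain j where j: "l \<le> j \<and> cut_at y j" "j < 2 * l" using assms by (auto simp: quiet_def)
  have 1: "l \<le> next_cut y \<and> cut_at y (next_cut y)" unfolding next_cut_def using j(1) by (rule LeastI)
  then show "l \<le> next_cut y" "cut_at y (next_cut y)" by auto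
  show 2: "\<And>j. l \<le> j \<Longrightarrow> cut_at y j \<Longrightarrow> next_cut y \<le> j" unfolding next_cut_def by (rule Least_le) simp
  show "next_cut y < 2 * l" using 2[of j] j by simp
qed

text \<open>As long as the present is no cut, the base and the next cut of the stretch do not change.\<close>

lemma tower_shifted:
  assumes sh: "shifted y z" and y: "\<not> quiet y l" "\<not> cut_at y l"
  shows "\<not> quiet z l" "label z = rotate1 (label y)"
proof -
  note Ly = last_base[OF y(1)] and Ny = next_cut[OF y(1)]
  have ny: "l < next_cut y" using Ny(1,3) y(2) by (metis le_neq_implies_less)
  then have "cut_at z (next_cut y - 1)" using cut_at_shifted[OF sh, of "next_cut y - 1"] Ny by simp
  then show z: "\<not> quiet z l" using ny Ny unfolding quiet_def
    by (metis Suc_diff_1 Suc_leI add_0 diff_less gr_implies_not0 less_SucE less_imp_diff_less less_nat_zero_code mult_2 not_less_eq_eq order_le_less_trans zero_less_iff_neq_zero less_Suc_eq_le)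
  note Lz = last_base[OF z] and Nz = next_cut[OF z]
  have n: "next_cut y = Suc (next_cut z)"
  proof (rule antisym)
    show "next_cut y \<le> Suc (next_cut z)"
      using Ny(4)[of "Suc (next_cut z)"] cut_at_shifted[OF sh, of "next_cut z"] Nz by simp
    show "Suc (next_cut z) \<le> next_cut y"
    proof -
      have "l \<le> next_cut y - 1" using ny by simp
      from Nz(4)[OF this \<open>cut_at z (next_cut y - 1)\<close>] show ?thesis using ny by simp
    qed
  qed
  have nb: "\<not> base y (Suc l)" using y by (simp add: base_def)
  have b: "last_base y = Suc (last_base z)"
  proof (rule antisym)
    obtain j where j: "last_base z = Suc j" using Lz(1) by (cases "last_base z") auto
    have "base y (Suc (last_base z))" using base_shifted[OF sh, of j] Lz j by simp
    moreover from this have "last_base z \<noteq> l" using nb by metis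
    ultimately show le: "Suc (last_base z) \<le> last_base y" using Ly(4)[of "Suc (last_base z)"] Lz(2) by simp
    obtain i where i: "last_base y = Suc (Suc i)" using le j by (cases "last_base y"; cases "last_base y - 1") auto
    have "base z (Suc i)" using base_shifted[OF sh, of i] Ly i by simp
    then show "last_base y \<le> Suc (last_base z)" using Lz(4)[of "Suc i"] Ly(2) i by simp
  qed
  have "tower z = tower y"
    unfolding tower_def n b
    by (rule nth_equalityI) (use sh Nz in \<open>auto simp: shifted_def nth_append simp del: upt_Suc\<close>)
  moreover have "l - last_base z = Suc (l - last_base y)" using b Ly(2) by simp
  ultimately show "label z = rotate1 (label y)" using y z by (simp add: label_def)
qed

lemma recurs_period: assumes "recurs y" shows "has_period y (period y)"
proof -
  obtain i j where ij: "i < j" "j < k" "blk y (l + i) = blk y (l + j)" using assms by (auto simp: recurs_def)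
  have eq: "y (l + i + t) = y (l + j + t)" if "t < 4 * k" for t
    using arg_cong[OF ij(3), of "\<lambda>xs. xs ! t"] that by (simp add: blk_def)
  have "has_period y (j - i)"
    unfolding has_period_def
  proof (intro conjI allI impI)
    fix t assume t: "l + k \<le> t" "t + (j - i) < l + 4 * k"
    then have "l + i + (t - (l + i)) = t" "l + j + (t - (l + i)) = t + (j - i)" "t - (l + i) < 4 * k"
      using ij(1,2) by auto
    then show "y t = y (t + (j - i))" using eq[of "t - (l + i)"] by simp
  qed (use ij in auto)
  then show ?thesis unfolding period_def by (rule LeastI)
qed

lemma period_least: "has_period y p \<Longrightarrow> period y \<le> p"
  unfolding period_def by (rule Least_le)

text \<open>A window of \<open>3k\<close> letters with period \<open>p \<le> k\<close> and its translate with period \<open>q \<le> k\<close> share so many letters that each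
period extends to the other window. In particular the least periods agree.\<close>

lemma has_period_shifted:
  assumes sh: "shifted y z" and p: "has_period y p" and q: "has_period z q"
  shows "has_period y q" "has_period z p"
proof -
  have zq: "y t = y (t + q)" if tt: "l + k < t" "t + q \<le> l + 4 * k" for t
  proof -
    obtain t' where t': "t = Suc t'" using tt(1) by (cases t) auto
    then have "z t' = z (t' + q)" using q tt by (auto simp: has_period_def)
    then show ?thesis using sh tt t' unfolding shifted_def has_period_def by simp
  qed
  have yp: "y t = y (t + p)" if "l + k \<le> t" "t + p < l + 4 * k" for t using p that by (auto simp: has_period_def)
  have pq: "1 \<le> p" "p \<le> k" "1 \<le> q" "q \<le> k" using p q by (auto simp: has_period_def)
  show "has_period y q"
    unfolding has_period_def
  proof (intro conjI allI impI)
    fix t assume t: "l + k \<le> t" "t + q < l + 4 * k"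
    show "y t = y (t + q)"
    proof (cases "t = l + k")
      case True
      have "y t = y (t + p)" using yp True pq by simp
      also have "\<dots> = y (t + p + q)" using zq True pq by simp
      also have "\<dots> = y (t + q)" using yp[of "t + q"] True pq by (simp add: add.commute add.left_commute)
      finally show ?thesis .
    qed (use zq t in auto)
  qed (use pq in auto)
  show "has_period z p"
    unfolding has_period_def
  proof (intro conjI allI impI)
    fix t assume t: "l + k \<le> t" "t + p < l + 4 * k"
    have "y (Suc t) = y (Suc t + p)"
    proof (cases "Suc t + p = l + 4 * k")
      case True
      define v where "v = l + 4 * k"
      have v: "Suc t = v - p" "v \<ge> 4 * k + l" using True by (simp_all add: v_def)
      have c: "l + k < v - q" "v - q + q \<le> l + 4 * k" "v - q + q = v" "l + k \<le> v - q - p"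
        "v - q - p + p < l + 4 * k" "v - q - p + p = v - q" "l + k < v - q - p"
        "v - q - p + q \<le> l + 4 * k" "v - q - p + q = v - p"
        using pq v v_def by auto
      have "y v = y (v - q)" using zq[OF c(1,2)] c(3) by simp
      also have "\<dots> = y (v - q - p)" using yp[OF c(4,5)] c(6) by simp
      also have "\<dots> = y (v - p)" using zq[OF c(7,8)] c(9) by simp
      finally show ?thesis using v True v_def by simp
    next
      case False
      then show ?thesis using yp[of "Suc t"] t by simp
    qed
    moreover have "z t = y (Suc t)" "z (t + p) = y (Suc (t + p))" using sh t by (auto simp: shifted_def)
    ultimately show "z t = z (t + p)" by simp
  qed (use pq in auto)
qed

lemma periodic_shifted:
  assumes sh: "shifted y z" and y: "quiet y l" "recurs y" and z: "quiet z l" "recurs z"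
  shows "label z = rotate1 (label y)"
proof -
  note py = recurs_period[OF y(2)] and pz = recurs_period[OF z(2)]
  have eq: "period z = period y"
    using has_period_shifted[OF sh py pz, THEN period_least] by simp
  define p where "p = period y"
  have p: "1 \<le> p" "p \<le> k" using py by (auto simp: has_period_def p_def)
  have "y (l + k) = y (l + k + p)" using py p by (auto simp: has_period_def p_def)
  moreover have "z (l + k + j) = y (l + k + Suc j)" if "j < p" for j using sh p that by (auto simp: shifted_def)
  ultimately have "map (\<lambda>j. (z (l + k + j), False)) [0..<p] = rotate1 (map (\<lambda>j. (y (l + k + j), False)) [0..<p])"
    by (intro nth_equalityI) (auto simp: nth_rotate1 mod_Suc)
  then show ?thesis using y z by (simp add: label_def eq p_def)
qed

lemma tower_length: assumes "\<not> quiet y l" shows "length (tower y) = Suc (next_cut y) - last_base y"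
    "l - last_base y < length (tower y)" "length (tower y) < 2 * l"
  using last_base(1,2)[OF assms] next_cut(1,2)[OF assms] by (auto simp: tower_def simp del: upt_Suc)

lemma tower_nth:
  assumes "\<not> quiet y l" "i < length (tower y)"
  shows "tower y ! i = (y (last_base y + i + k), i = 0)"
proof -
  have "last_base y + i < Suc (next_cut y)" using assms by (simp add: tower_def del: upt_Suc)
  then have "[last_base y..<Suc (next_cut y)] ! i = last_base y + i" by (rule nth_upt)
  then show ?thesis using assms by (simp add: tower_def del: upt_Suc)
qed

lemma label_length:
  assumes "1 \<le> k" "k \<le> l"
  shows "0 < length (label y)" "length (label y) \<le> 2 * l" "quiet y l \<Longrightarrow> length (label y) \<le> k"
proof -
  have p: "1 \<le> period y \<and> period y \<le> k" if "recurs y" using recurs_period[OF that] by (auto simp: has_period_def)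
  show "0 < length (label y)"
    using p tower_length(2)[of y] assms by (cases "quiet y l"; cases "recurs y") (auto simp: label_def)
  show 1: "length (label y) \<le> k" if "quiet y l"
    using p that assms by (cases "recurs y") (auto simp: label_def)
  show "length (label y) \<le> 2 * l"
    using 1 tower_length(3)[of y] assms by (cases "quiet y l") (auto simp: label_def)
qed

lemma hd_label: assumes "1 \<le> k" "k \<le> l" shows "fst (hd (label y)) = y (l + k)"
proof (cases "quiet y l")
  case True
  have "1 \<le> period y" if "recurs y" using recurs_period[OF that] by (auto simp: has_period_def)
  then show ?thesis using True by (auto simp: label_def hd_map hd_conv_nth)
next
  case False
  have ne: "tower y \<noteq> []" using tower_length(2)[OF False] by auto
  show ?thesis using False ne tower_length[OF False] last_base(2)[OF False]
    by (simp add: label_def hd_rotate_conv_nth tower_nth)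
qed

lemma quiet_label_unmarked: "quiet y l \<Longrightarrow> x \<in> set (label y) \<Longrightarrow> \<not> snd x"
  by (auto simp: label_def split: if_splits)

lemma label_unmarked_next:
  assumes "1 \<le> k" "k \<le> l"
  shows "label y \<in> unmarked_next \<longleftrightarrow> quiet y l \<or> \<not> cut_at y l"
proof (cases "quiet y l")
  case True
  have ne: "label y \<noteq> []" using label_length(1)[OF assms] by force
  then have "hd (rotate1 (label y)) \<in> set (label y)" by (metis hd_in_set rotate1_is_Nil_conv set_rotate1)
  then show ?thesis using True quiet_label_unmarked by (auto simp: unmarked_next_def)
next
  case False
  note T = tower_length[OF False]
  have ne: "tower y \<noteq> []" using T(2) by auto
  have "rotate1 (label y) = rotate (Suc (l - last_base y)) (tower y)" using False by (simp add: label_def)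
  then have hd: "hd (rotate1 (label y)) = tower y ! (Suc (l - last_base y) mod length (tower y))"
    by (simp only: hd_rotate_conv_nth[OF ne])
  have L: "last_base y \<le> l" "l \<le> next_cut y" using last_base[OF False] next_cut[OF False] by auto
  show ?thesis
  proof (cases "cut_at y l")
    case True
    then have "next_cut y = l" using next_cut[OF False] by (metis order_antisym order_refl)
    then have "length (tower y) = Suc (l - last_base y)" using T(1) L by simp
    then show ?thesis using False True hd tower_nth[OF False, of 0] by (simp add: unmarked_next_def)
  next
    case nc: False
    then have "l < next_cut y" using next_cut(1,3)[OF False] by (metis le_neq_implies_less)
    then have "Suc (l - last_base y) < length (tower y)" using T(1) L by simp
    then show ?thesis using False nc hd by (simp add: unmarked_next_def tower_nth)
  qed
qed

lemma unmarked_hd_tower: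
  assumes sh: "shifted y z" and z: "\<not> quiet z l" "\<not> snd (hd (label z))"
  shows "\<not> quiet y l" "\<not> cut_at y l"
proof -
  note Lz = last_base[OF z(1)] and T = tower_length[OF z(1)]
  have "tower z \<noteq> []" using T(2) by auto
  then have "hd (label z) = tower z ! (l - last_base z)" using z T by (simp add: label_def hd_rotate_conv_nth)
  then have "last_base z \<noteq> l" using z tower_nth[OF z(1), of 0] T(2) by auto
  then have "\<not> base z l" using Lz(4)[of l] Lz(2) by auto
  then have nb: "\<not> (cut_at z j \<or> quiet z j)" if "l = Suc j" for j using that unfolding base_def by blast
  obtain j where "l = Suc j" using Lz(1,2) by (metis One_nat_def Suc_le_D le_trans)
  with nb have j: "l = Suc j" "\<not> cut_at z j" "\<not> quiet z j" by blast+
  then show "\<not> quiet y l" "\<not> cut_at y l" using cut_at_shifted[OF sh, of j] quiet_shifted[OF sh, of j] by auto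
qed

text \<open>Some rotation of every label starts at the marker, if there is one, so that all steps but the last are
unmarked.\<close>

lemma label_arc:
  assumes "1 \<le> k" "k \<le> l"
  shows "\<exists>m. \<forall>j. Suc j < length (label y) \<longrightarrow> (rotate1 ^^ (m + j)) (label y) \<in> unmarked_next"
proof (cases "quiet y l")
  case True
  have ne: "label y \<noteq> []" using label_length(1)[OF assms] by force
  have "rotate j (label y) \<in> unmarked_next" for j
  proof -
    have "hd (rotate1 (rotate j (label y))) \<in> set (label y)"
      using ne by (metis hd_in_set rotate1_is_Nil_conv rotate_is_Nil_conv set_rotate1 set_rotate)
    then show ?thesis using True quiet_label_unmarked by (auto simp: unmarked_next_def)
  qed
  then show ?thesis by (simp flip: rotate_def)
next
  case False
  note T = tower_length[OF False]
  have ne: "tower y \<noteq> []" using T(2) by auto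
  define r where "r = l - last_base y"
  have lab: "label y = rotate r (tower y)" using False by (simp add: label_def r_def)
  show ?thesis
  proof (intro exI allI impI)
    fix j assume j: "Suc j < length (label y)"
    have "rotate1 ((rotate1 ^^ (length (tower y) - r + j)) (label y)) = rotate (Suc (length (tower y) - r + j)) (label y)"
      by (simp add: rotate_def)
    also have "\<dots> = rotate (length (tower y) + Suc j) (tower y)"
      using T(2) by (simp only: lab rotate_rotate) (simp add: r_def)
    also have "\<dots> = rotate (Suc j) (tower y)" by (metis mod_add_self1 rotate_conv_mod)
    finally have "hd (rotate1 ((rotate1 ^^ (length (tower y) - r + j)) (label y))) = tower y ! Suc j"
      using j by (simp only: hd_rotate_conv_nth[OF ne]) (simp add: lab)
    then show "(rotate1 ^^ (length (tower y) - r + j)) (label y) \<in> unmarked_next"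
      using j by (simp add: unmarked_next_def lab tower_nth[OF False])
  qed
qed

end

section \<open>Random selection of cuts\<close>

lemma sum_shift_periodic:
  fixes f :: "nat \<Rightarrow> 'a :: ab_group_add"
  assumes "\<And>k. f (k + n) = f k"
  shows "(\<Sum>k<n. f (m + k)) = (\<Sum>k<n. f k)"
proof (induction m)
  case (Suc m)
  have "(\<Sum>k<n. f (Suc m + k)) + f m = (\<Sum>k<Suc n. f (m + k))"
    by (subst sum.lessThan_Suc_shift) (simp add: add.commute)
  then show ?case using Suc assms[of m] by simp
qed simp

lemma abs_diff_le_sum:
  fixes c :: "nat \<Rightarrow> real"
  assumes "\<And>k. Suc k < n \<Longrightarrow> \<bar>c k - c (Suc k)\<bar> \<le> g k" "\<And>k. k < n \<Longrightarrow> 0 \<le> g k" "i \<le> j" "j < n"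
  shows "\<bar>c i - c j\<bar> \<le> (\<Sum>k<n. g k)"
proof -
  have "\<bar>c i - c j\<bar> \<le> (\<Sum>k\<in>{i..<j}. g k)"
    using assms(3,4)
  proof (induction j rule: dec_induct)
    case (step j)
    then have "\<bar>c i - c (Suc j)\<bar> \<le> \<bar>c i - c j\<bar> + \<bar>c j - c (Suc j)\<bar>" by simp
    also have "\<dots> \<le> (\<Sum>k\<in>{i..<j}. g k) + g j" using step assms(1)[of j] by simp
    finally show ?case using step by simp
  qed simp
  also have "\<dots> \<le> (\<Sum>k<n. g k)" using assms by (intro sum_mono2) auto
  finally show ?thesis .
qed

lemma card_PiE_restrict:
  assumes "finite U" "B \<subseteq> U" "T \<subseteq> {..<Q}"
  shows "card {f \<in> U \<rightarrow>\<^sub>E {..<Q :: nat}. \<forall>v\<in>B. f v \<in> T} * Q ^ card B = card T ^ card B * card (U \<rightarrow>\<^sub>E {..<Q})"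
proof -
  have "{f \<in> U \<rightarrow>\<^sub>E {..<Q}. \<forall>v\<in>B. f v \<in> T} = (\<Pi>\<^sub>E v\<in>U. if v \<in> B then T else {..<Q})"
  proof -
    have "(\<forall>v\<in>U. f v < Q) \<and> (\<forall>v\<in>B. f v \<in> T) \<longleftrightarrow> (\<forall>v\<in>U. f v \<in> (if v \<in> B then T else {..<Q}))" for f
      using assms(2,3) by (smt (verit) subset_iff lessThan_iff)
    then show ?thesis unfolding PiE_iff set_eq_iff mem_Collect_eq lessThan_iff by blast
  qed
  then have "card {f \<in> U \<rightarrow>\<^sub>E {..<Q}. \<forall>v\<in>B. f v \<in> T} = (\<Prod>v\<in>U. if v \<in> B then card T else Q)"
    using assms(1) by (simp add: card_PiE if_distrib cong: if_cong)
  also have "\<dots> = card T ^ card B * Q ^ card (U - B)"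
    using assms(1,2) by (simp add: prod.If_cases Int_absorb1 Diff_eq[symmetric] Int_absorb2 Collect_mem_eq flip: Diff_eq)
  finally have "card {f \<in> U \<rightarrow>\<^sub>E {..<Q}. \<forall>v\<in>B. f v \<in> T} * Q ^ card B = card T ^ card B * Q ^ (card (U - B) + card B)"
    by (simp add: power_add)
  also have "card (U - B) + card B = card U"
    using assms(1,2) by (metis card_Diff_subset card_mono finite_subset le_add_diff_inverse2)
  finally show ?thesis using assms(1) by (simp add: card_PiE)
qed

text \<open>Each point of \<open>U\<close> is selected with probability \<open>1/Q\<close> independently, by a uniformly random map from \<open>U\<close> to \<open>Q\<close>
values. A set of \<open>k\<close> points is missed with probability \<open>(1 - 1/Q)\<^sup>k\<close>, and some selection is not worse
than the average.\<close>

theorem random_marking: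
  fixes u :: "nat \<Rightarrow> 'u" and B :: "nat \<Rightarrow> 'u set" and d k Q :: nat and w :: real
  assumes U: "finite U" and u: "\<And>b. b < d \<Longrightarrow> u b \<in> U"
    and J: "J \<subseteq> {..<d}" and B: "\<And>a. a \<in> J \<Longrightarrow> B a \<subseteq> U \<and> card (B a) = k"
    and Q: "1 \<le> Q" and w: "0 \<le> w"
  shows "\<exists>Z. real (card {b. b < d \<and> u b \<in> Z}) + w * card {a \<in> J. B a \<inter> Z = {}} \<le> d * (1 / Q + w * (1 - 1 / Q) ^ k)"
proof -
  define F where "F = U \<rightarrow>\<^sub>E {..<Q}"
  have F: "finite F" "F \<noteq> {}" using U Q by (auto simp: F_def PiE_eq_empty_iff lessThan_empty_iff intro!: finite_PiE)
  then have F0: "0 < card F" by (simp add: card_gt_0_iff)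
  define Z where "Z f = {v. f v = (0 :: nat)}" for f :: "'u \<Rightarrow> nat"
  define cost where "cost f = real (card {b. b < d \<and> u b \<in> Z f}) + w * card {a \<in> J. B a \<inter> Z f = {}}" for f
  have finJ: "finite J" using J finite_subset by blast
  have swap: "(\<Sum>f\<in>F. real (card {a \<in> A. R a f})) = (\<Sum>a\<in>A. real (card {f \<in> F. R a f}))"
    if "finite A" for A :: "nat set" and R
  proof -
    have "(\<Sum>f\<in>F. card {a \<in> A. R a f}) = (\<Sum>a\<in>A. card {f \<in> F. R a f})"
      using sum_multicount_gen[of F A "\<lambda>f a. R a f" "\<lambda>a. card {f \<in> F. R a f}"] F that by simp
    then show ?thesis unfolding of_nat_sum[symmetric] by (simp only:)
  qed
  have c1: "real (card {f \<in> F. u b \<in> Z f}) = card F * (1 / Q)" if "b < d" for b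
  proof -
    have "card {f \<in> F. \<forall>v\<in>{u b}. f v \<in> {0}} * Q ^ card {u b} = card {0 :: nat} ^ card {u b} * card F"
      unfolding F_def using U u[OF that] Q by (intro card_PiE_restrict) auto
    then have "real (card {f \<in> F. u b \<in> Z f}) * Q = card F" by (simp add: Z_def flip: of_nat_mult)
    then show ?thesis using Q by (simp add: field_simps)
  qed
  have c2: "real (card {f \<in> F. B a \<inter> Z f = {}}) = card F * (1 - 1 / Q) ^ k" if "a \<in> J" for a
  proof -
    have "card {f \<in> F. \<forall>v\<in>B a. f v \<in> {1..<Q}} * Q ^ card (B a) = card {1..<Q} ^ card (B a) * card F"
      unfolding F_def using U B[OF that] by (intro card_PiE_restrict) auto
    moreover have "{f \<in> F. \<forall>v\<in>B a. f v \<in> {1..<Q}} = {f \<in> F. B a \<inter> Z f = {}}"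
      using B[OF that] by (auto simp: Z_def F_def PiE_iff Suc_le_eq)
    ultimately have "card {f \<in> F. B a \<inter> Z f = {}} * Q ^ k = (Q - 1) ^ k * card F" using B[OF that] by simp
    then have "real (card {f \<in> F. B a \<inter> Z f = {}} * Q ^ k) = real ((Q - 1) ^ k * card F)" by (simp only:)
    then have "real (card {f \<in> F. B a \<inter> Z f = {}}) * real Q ^ k = (real Q - 1) ^ k * card F"
      unfolding of_nat_mult of_nat_power of_nat_diff[OF Q] of_nat_1 .
    then have "real (card {f \<in> F. B a \<inter> Z f = {}}) = card F * ((real Q - 1) ^ k / real Q ^ k)"
      using Q by (simp add: field_simps)
    also have "(real Q - 1) ^ k / real Q ^ k = (1 - 1 / Q) ^ k" using Q by (simp add: power_divide[symmetric] diff_divide_distrib)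
    finally show ?thesis .
  qed
  have "(\<Sum>f\<in>F. cost f) = (\<Sum>b\<in>{..<d}. real (card {f \<in> F. u b \<in> Z f})) + w * (\<Sum>a\<in>J. real (card {f \<in> F. B a \<inter> Z f = {}}))"
    using swap[of "{..<d}" "\<lambda>b f. u b \<in> Z f"] swap[OF finJ, of "\<lambda>a f. B a \<inter> Z f = {}"]
    by (simp add: cost_def sum.distrib sum_distrib_left[symmetric])
  also have "\<dots> = d * (card F * (1 / Q)) + w * (card J * (card F * (1 - 1 / Q) ^ k))"
    by (simp add: c1 c2)
  also have "\<dots> \<le> d * (card F * (1 / Q)) + w * (d * (card F * (1 - 1 / Q) ^ k))"
  proof -
    have "card J \<le> d" using J card_mono[of "{..<d}" J] by simp
    moreover have "0 \<le> 1 - 1 / real Q" using Q by simp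
    ultimately show ?thesis using w by (intro add_left_mono mult_left_mono mult_right_mono) auto
  qed
  also have "\<dots> = card F * (d * (1 / Q + w * (1 - 1 / Q) ^ k))" by (simp add: algebra_simps)
  finally have le: "(\<Sum>f\<in>F. cost f) \<le> card F * (d * (1 / Q + w * (1 - 1 / Q) ^ k))" .
  have "\<exists>f\<in>F. cost f \<le> d * (1 / Q + w * (1 - 1 / Q) ^ k)"
  proof (rule ccontr)
    assume "\<not> ?thesis"
    then have "(\<Sum>f\<in>F. d * (1 / Q + w * (1 - 1 / Q) ^ k)) < (\<Sum>f\<in>F. cost f)"
      using F by (intro sum_strict_mono) auto
    then show False using le by simp
  qed
  then show ?thesis by (auto simp: cost_def)
qed

lemma mismatch_cases:
  assumes "shifted k l y z" "label k l H z \<noteq> rotate1 (label k l H y)"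
  shows "(quiet k l H y l \<and> \<not> quiet k l H z l) \<or> (quiet k l H y l \<and> \<not> recurs k l y) \<or>
    (quiet k l H z l \<and> \<not> recurs k l z) \<or> (\<not> quiet k l H y l \<and> cut_at k H y l)"
  using tower_shifted(2)[OF assms(1)] periodic_shifted[OF assms(1)] assms(2) by blast

text \<open>The weights are those of \<open>equalize_orbits\<close>: the length of a label, for steps that are not supposed to close a
stretch. Such mismatches have length up to \<open>2l\<close> only if the step does not shift the word; otherwise they
involve a quiet word, whose label is no longer than \<open>k\<close>.\<close>

lemma mismatch_cost:
  fixes H :: "bool list \<Rightarrow> bool"
  assumes kl: "1 \<le> k" "k \<le> l"
  defines "q \<equiv> \<lambda>y. quiet k l H y l" and "J \<equiv> \<lambda>y. quiet k l H y l \<and> \<not> recurs k l y"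
  shows "real (if label k l H z = rotate1 (label k l H y) then 0 else
      (if label k l H y \<in> unmarked_next then length (label k l H y) else 0) +
      (if label k l H z \<in> rotate1 ` unmarked_next then length (label k l H z) else 0))
    \<le> 4 * real l * of_bool (\<not> shifted k l y z) + real k * of_bool (q y \<and> \<not> q z) + real k * of_bool (\<not> q y \<and> q z)
      + 2 * real k * of_bool (J y) + 2 * real k * of_bool (J z)" (is "real (if _ then 0 else ?t1 + ?t2) \<le> _")
proof (cases "shifted k l y z \<and> label k l H z \<noteq> rotate1 (label k l H y)")
  case False
  have "length (label k l H y) \<le> 2 * l" "length (label k l H z) \<le> 2 * l" using label_length(2)[OF kl] by auto
  then have "?t1 + ?t2 \<le> 4 * l" by simp
  then have "real (?t1 + ?t2) \<le> 4 * l" by (metis of_nat_le_iff of_nat_mult of_nat_numeral)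
  then show ?thesis using False by (auto simp: add_increasing2 add_increasing)
next
  case True
  have len: "length (label k l H v) \<le> k" if "q v" for v using label_length(3)[OF kl] that by (simp add: q_def)
  have 1: "?t1 = 0 \<or> (q y \<and> ?t1 \<le> k)"
  proof (cases "label k l H y \<in> unmarked_next \<and> \<not> q y")
    case T: True
    then have "\<not> cut_at k H y l" using label_unmarked_next[OF kl, of H y] T unfolding q_def by blast
    then show ?thesis using T True tower_shifted(2) by (auto simp: q_def)
  qed (use len in auto)
  have 2: "?t2 = 0 \<or> (q z \<and> ?t2 \<le> k)"
  proof (cases "label k l H z \<in> rotate1 ` unmarked_next \<and> \<not> q z")
    case T: True
    then have "\<not> snd (hd (label k l H z))" by (auto simp: unmarked_next_def)
    then have "\<not> quiet k l H y l" "\<not> cut_at k H y l" using unmarked_hd_tower T True by (auto simp: q_def)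
    then show ?thesis using True tower_shifted(2) by blast
  qed (use len in auto)
  have c: "(q y \<and> \<not> q z) \<or> J y \<or> J z \<or> \<not> q y"
    using mismatch_cases[of k l y z H] True by (auto simp: q_def J_def)
  have "real ?t1 \<le> real k * of_bool (q y \<and> \<not> q z) + real k * of_bool (J y) + real k * of_bool (J z)"
    using 1 c by auto
  moreover have "real ?t2 \<le> real k * of_bool (\<not> q y \<and> q z) + real k * of_bool (J y) + real k * of_bool (J z)"
    using 2 c by auto
  ultimately show ?thesis using True by simp
qed

section \<open>Labels under a stationary step\<close>

text \<open>\<open>P a b\<close> is the probability of the step from \<open>b\<close> to \<open>a\<close>. The uniform distribution is stationary, and
\<open>mass R\<close> is \<open>d\<close> times the probability that a stationary step satisfies \<open>R\<close>.\<close>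

locale bistochastic =
  fixes d :: nat and P :: "nat \<Rightarrow> nat \<Rightarrow> real"
  assumes P0: "\<And>a b. 0 \<le> P a b"
    and col: "\<And>b. b < d \<Longrightarrow> (\<Sum>a<d. P a b) = 1"
    and row: "\<And>a. a < d \<Longrightarrow> (\<Sum>b<d. P a b) = 1"
begin

definition mass :: "(nat \<Rightarrow> nat \<Rightarrow> bool) \<Rightarrow> real" where
  "mass R = (\<Sum>a<d. \<Sum>b<d. P a b * of_bool (R a b))"

lemma mass_nonneg: "0 \<le> mass R"
  by (auto simp: mass_def intro!: sum_nonneg P0)

lemma mass_le:
  assumes "\<And>a b. a < d \<Longrightarrow> b < d \<Longrightarrow> R a b \<Longrightarrow> R1 a b \<or> R2 a b"
  shows "mass R \<le> mass R1 + mass R2"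
  unfolding mass_def sum.distrib[symmetric] distrib_left[symmetric]
  by (intro sum_mono mult_left_mono P0) (use assms in \<open>auto simp: of_bool_def\<close>)

lemma mass_split: "mass R = mass (\<lambda>a b. R a b \<and> S a b) + mass (\<lambda>a b. R a b \<and> \<not> S a b)"
  unfolding mass_def sum.distrib[symmetric] distrib_left[symmetric] by (intro sum.cong refl) auto

lemma mass_target: "mass (\<lambda>a b. A a) = card {a. a < d \<and> A a}"
proof -
  have "mass (\<lambda>a b. A a) = (\<Sum>a<d. of_bool (A a))"
    unfolding mass_def sum_distrib_right[symmetric] using row by (intro sum.cong refl) simp
  also have "\<dots> = card {a. a < d \<and> A a}" by (simp add: of_bool_def sum.If_cases Collect_conj_eq lessThan_def)
  finally show ?thesis .
qed

lemma mass_source: "mass (\<lambda>a b. A b) = card {b. b < d \<and> A b}"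
proof -
  have "mass (\<lambda>a b. A b) = (\<Sum>b<d. of_bool (A b))"
    unfolding mass_def by (subst sum.swap, unfold sum_distrib_right[symmetric]) (use col in \<open>intro sum.cong refl; simp\<close>)
  also have "\<dots> = card {b. b < d \<and> A b}" by (simp add: of_bool_def sum.If_cases Collect_conj_eq lessThan_def)
  finally show ?thesis .
qed

lemma mass_UN_le:
  assumes "finite I" "\<And>a b. R a b \<Longrightarrow> \<exists>i\<in>I. R' i a b"
  shows "mass R \<le> (\<Sum>i\<in>I. mass (R' i))"
proof -
  have "of_bool (R a b) \<le> (\<Sum>i\<in>I. of_bool (R' i a b) :: real)" for a b
  proof (cases "R a b")
    case True
    then obtain i where i: "i \<in> I" "R' i a b" using assms(2) by blast
    have "of_bool (R' i a b) \<le> (\<Sum>i\<in>I. of_bool (R' i a b) :: real)"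
      by (rule member_le_sum) (use i assms(1) in auto)
    then show ?thesis using True i by simp
  qed (simp add: sum_nonneg)
  then have "mass R \<le> (\<Sum>a<d. \<Sum>b<d. \<Sum>i\<in>I. P a b * of_bool (R' i a b))"
    unfolding mass_def sum_distrib_left[symmetric] by (intro sum_mono mult_left_mono P0)
  also have "\<dots> = (\<Sum>i\<in>I. mass (R' i))"
    unfolding mass_def by (subst (2) sum.swap, subst sum.swap, rule refl)
  finally show ?thesis .
qed

lemma mass_cong: "(\<And>a b. R a b \<longleftrightarrow> R' a b) \<Longrightarrow> mass R = mass R'"
  by (simp add: mass_def)

lemma sum_weighted_mass:
  fixes f :: "nat \<Rightarrow> nat \<Rightarrow> 'c" and w :: "'c \<Rightarrow> nat"
  assumes "finite S" "\<And>a b. a < d \<Longrightarrow> b < d \<Longrightarrow> f a b \<in> S"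
  shows "(\<Sum>s\<in>S. w s * mass (\<lambda>a b. f a b = s \<and> R a b)) = (\<Sum>a<d. \<Sum>b<d. P a b * (if R a b then w (f a b) else 0))"
proof -
  have "(\<Sum>s\<in>S. w s * mass (\<lambda>a b. f a b = s \<and> R a b)) =
      (\<Sum>s\<in>S. \<Sum>a<d. \<Sum>b<d. P a b * (if f a b = s then (if R a b then w s else 0) else 0))"
    unfolding mass_def sum_distrib_left by (intro sum.cong refl) auto
  also have "\<dots> = (\<Sum>a<d. \<Sum>b<d. \<Sum>s\<in>S. P a b * (if f a b = s then (if R a b then w s else 0) else 0))"
    by (subst sum.swap, subst (2) sum.swap, rule refl)
  also have "\<dots> = (\<Sum>a<d. \<Sum>b<d. P a b * (if R a b then w (f a b) else 0))"
    using assms by (intro sum.cong refl) (simp add: sum_distrib_left[symmetric] if_distrib[of real] cong: if_cong)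
  finally show ?thesis .
qed

text \<open>Stationarity bounds the difference of the sizes of the classes \<open>s\<close> and \<open>\<pi> s\<close> by the mass of the steps that
leave \<open>s\<close> or enter \<open>\<pi> s\<close> irregularly. Each orbit is, up to one exceptional step outside \<open>G\<close>, a path of such
comparisons, so the sizes in an orbit differ by at most the sum of these masses over the orbit; summing
over the classes of the orbit contributes the factor \<open>len\<close>.\<close>

theorem equalize_orbits:
  fixes lam :: "nat \<Rightarrow> 'c" and len :: "'c \<Rightarrow> nat"
  assumes fin: "finite S" and lamS: "\<And>a. a < d \<Longrightarrow> lam a \<in> S"
    and inj: "inj \<pi>" and \<pi>S: "\<pi> ` S \<subseteq> S"
    and len: "\<And>s. s \<in> S \<Longrightarrow> 0 < len s \<and> len (\<pi> s) = len s \<and> (\<pi> ^^ len s) s = s"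
    and reset: "\<And>s. s \<in> S \<Longrightarrow> reset s \<in> S \<and> \<pi> (reset s) = reset s"
    and arc: "\<And>s. s \<in> S \<Longrightarrow> \<exists>m. \<forall>k. Suc k < len s \<longrightarrow> (\<pi> ^^ (m + k)) s \<in> G"
  shows "\<exists>lam'. (\<forall>a<d. lam' a = lam a \<or> lam' a = reset (lam a)) \<and>
    (\<forall>s. card {a. a < d \<and> lam' a = s} = card {a. a < d \<and> lam' a = \<pi> s}) \<and>
    card {a. a < d \<and> lam' a \<noteq> lam a} \<le>
      (\<Sum>a<d. \<Sum>b<d. P a b * (if lam a = \<pi> (lam b) then 0 else
         (if lam b \<in> G then len (lam b) else 0) + (if lam a \<in> \<pi> ` G then len (lam a) else 0)))"
proof -
  have \<pi>bij: "bij_betw \<pi> S S"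
    using inj_on_subset[OF inj subset_UNIV] endo_inj_surj[OF fin \<pi>S] by (simp add: bij_betw_def)
  have pwS: "(\<pi> ^^ k) s \<in> S" if "s \<in> S" for k s using that \<pi>S by (induction k) auto
  have pwlen: "len ((\<pi> ^^ k) s) = len s" if "s \<in> S" for k s
    using that len pwS[OF that] by (induction k) auto
  have pwbij: "bij_betw (\<pi> ^^ k) S S" for k
  proof (induction k)
    case (Suc k)
    then show ?case using bij_betw_trans[OF Suc \<pi>bij] by (simp only: funpow.simps)
  qed (simp add: bij_betw_def)
  have per: "(\<pi> ^^ (k + len s)) s = (\<pi> ^^ k) s" if "s \<in> S" for k s
    using len[OF that] by (simp add: funpow_add)
  define C where "C s = {a. a < d \<and> lam a = s}" for s
  define c where "c s = card (C s)" for s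
  define flow where "flow s = mass (\<lambda>a b. lam b = s \<and> lam a = \<pi> s)" for s
  define out where "out s = mass (\<lambda>a b. lam b = s \<and> lam a \<noteq> \<pi> (lam b))" for s
  define inn where "inn s = mass (\<lambda>a b. lam a = s \<and> lam a \<noteq> \<pi> (lam b))" for s
  have Cd: "finite (C s)" for s by (auto simp: C_def)
  have cout: "real (c s) = flow s + out s" for s
    unfolding c_def C_def mass_source[symmetric] flow_def out_def
    by (subst mass_split[of _ "\<lambda>a b. lam a = \<pi> s"]) (intro arg_cong2[of _ _ _ _ "(+)"] mass_cong; auto)
  have cinn: "real (c (\<pi> s)) = flow s + inn (\<pi> s)" for s
    unfolding c_def C_def mass_target[symmetric] flow_def inn_def
    by (subst mass_split[of _ "\<lambda>a b. lam b = s"]) (intro arg_cong2[of _ _ _ _ "(+)"] mass_cong; use inj in \<open>auto simp: inj_eq\<close>)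
  define cost where "cost s = (if s \<in> G then out s + inn (\<pi> s) else 0)" for s
  have out0: "0 \<le> out s" "0 \<le> inn s" for s by (simp_all add: out_def inn_def mass_nonneg)
  have cost0: "0 \<le> cost s" for s by (simp add: cost_def out0)
  have diff: "\<bar>real (c s) - real (c (\<pi> s))\<bar> \<le> cost s" if "s \<in> G" for s
    using cout[of s] cinn[of s] out0[of s] out0[of "\<pi> s"] that by (simp add: cost_def)
  have osc: "\<bar>real (c ((\<pi> ^^ i) s)) - real (c ((\<pi> ^^ j) s))\<bar> \<le> (\<Sum>k<len s. cost ((\<pi> ^^ k) s))"
    if s: "s \<in> S" for s i j
  proof -
    let ?n = "len s"
    obtain m where m: "\<And>k. Suc k < ?n \<Longrightarrow> (\<pi> ^^ (m + k)) s \<in> G" using arc[OF s] by blast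
    have per': "(\<pi> ^^ (k + l * ?n)) s = (\<pi> ^^ k) s" for k l
      by (induction l) (simp_all add: per[OF s] add.assoc[symmetric] add.commute[of ?n] flip: add.assoc)
    have red: "\<exists>k<?n. (\<pi> ^^ i) s = (\<pi> ^^ (m + k)) s" for i
    proof (intro exI conjI)
      (* m + ?k is congruent to i + m * ?n, hence to i, modulo ?n. *)
      let ?k = "(i + m * (?n - 1)) mod ?n"
      show "?k < ?n" using len[OF s] by simp
      have "m + ?k + (i + m * (?n - 1)) div ?n * ?n = m + (i + m * (?n - 1))"
        by (metis add.assoc add.commute mod_div_mult_eq)
      also have "\<dots> = i + m * ?n" using len[OF s] by (cases ?n) auto
      finally show "(\<pi> ^^ i) s = (\<pi> ^^ (m + ?k)) s" by (metis per')
    qed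
    have main: "\<bar>real (c ((\<pi> ^^ (m + k)) s)) - real (c ((\<pi> ^^ (m + l)) s))\<bar> \<le> (\<Sum>k<?n. cost ((\<pi> ^^ (m + k)) s))"
      if "k \<le> l" "l < ?n" for k l
      by (rule abs_diff_le_sum[OF _ _ that]) (use diff m cost0 in auto)
    obtain k l where kl: "k < ?n" "(\<pi> ^^ i) s = (\<pi> ^^ (m + k)) s" "l < ?n" "(\<pi> ^^ j) s = (\<pi> ^^ (m + l)) s"
      using red by metis
    have "\<bar>real (c ((\<pi> ^^ i) s)) - real (c ((\<pi> ^^ j) s))\<bar> \<le> (\<Sum>k<?n. cost ((\<pi> ^^ (m + k)) s))"
      using main[of k l] main[of l k] kl by (cases "k \<le> l") (auto simp: abs_minus_commute)
    also have "\<dots> = (\<Sum>k<?n. cost ((\<pi> ^^ k) s))"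
      by (rule sum_shift_periodic[where f = "\<lambda>k. cost ((\<pi> ^^ k) s)"]) (simp add: per[OF s])
    finally show ?thesis .
  qed
  define r where "r s = (MIN k\<in>{..<len s}. c ((\<pi> ^^ k) s))" for s
  have rex: "\<exists>k. r s = c ((\<pi> ^^ k) s)" if "s \<in> S" for s
  proof -
    have "r s \<in> (\<lambda>k. c ((\<pi> ^^ k) s)) ` {..<len s}" unfolding r_def using len[OF that] by (intro Min_in) auto
    then show ?thesis by blast
  qed
  have rle: "r s \<le> c s" if "s \<in> S" for s
    unfolding r_def using len[OF that] by (intro Min_le) (auto intro: image_eqI[of _ _ 0])
  have r\<pi>: "r (\<pi> s) = r s" if s: "s \<in> S" for s
  proof -
    have "(\<lambda>k. c ((\<pi> ^^ k) (\<pi> s))) ` {..<len s} = (\<lambda>k. c ((\<pi> ^^ k) s)) ` {..<len s}"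
    proof (intro equalityI subsetI)
      fix x assume "x \<in> (\<lambda>k. c ((\<pi> ^^ k) (\<pi> s))) ` {..<len s}"
      then obtain k where k: "k < len s" "x = c ((\<pi> ^^ Suc k) s)" by (auto simp: funpow_swap1)
      show "x \<in> (\<lambda>k. c ((\<pi> ^^ k) s)) ` {..<len s}"
      proof (cases "Suc k < len s")
        case True then show ?thesis using k by blast
      next
        case False
        then have "Suc k = len s" using k by simp
        then have "x = c ((\<pi> ^^ 0) s)" using k(2) len[OF s] by simp
        then show ?thesis using len[OF s] by blast
      qed
    next
      fix x assume "x \<in> (\<lambda>k. c ((\<pi> ^^ k) s)) ` {..<len s}"
      then obtain k where k: "k < len s" "x = c ((\<pi> ^^ k) s)" by auto
      show "x \<in> (\<lambda>k. c ((\<pi> ^^ k) (\<pi> s))) ` {..<len s}"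
      proof (cases k)
        case 0
        have "(\<pi> ^^ (len s - 1)) (\<pi> s) = (\<pi> ^^ len s) s"
          using len[OF s] by (metis One_nat_def Suc_pred comp_apply funpow_Suc_right)
        then have "x = c ((\<pi> ^^ (len s - 1)) (\<pi> s))" using k 0 len[OF s] by simp
        then show ?thesis using len[OF s] by (intro image_eqI[of _ _ "len s - 1"]) auto
      next
        case (Suc j)
        then have "x = c ((\<pi> ^^ j) (\<pi> s))" using k by (simp add: funpow_swap1)
        then show ?thesis using k Suc by auto
      qed
    qed
    then show ?thesis unfolding r_def using len[OF s] by simp
  qed
  have "\<forall>s\<in>S. \<exists>A\<subseteq>C s. card A = r s" using rle obtain_subset_with_card_n unfolding c_def by metis
  then obtain A where A: "\<And>s. s \<in> S \<Longrightarrow> A s \<subseteq> C s \<and> card (A s) = r s" by metis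
  (* In every class as many indices are kept as the smallest class of its orbit has; the others
     move to fixed points of \<pi>, whose class sizes are unconstrained. *)
  define lam' where "lam' a = (if a \<in> A (lam a) then lam a else reset (lam a))" for a
  have cards: "card {a. a < d \<and> lam' a = s} = card {a. a < d \<and> lam' a = \<pi> s}" for s
  proof (cases "\<pi> s = s")
    case False
    have not_reset: "reset t \<noteq> s" "reset t \<noteq> \<pi> s" if "t \<in> S" for t
      using reset[OF that] False inj by (metis, metis inj_eq)
    have lam'S: "lam' a \<in> S" if "a < d" for a using lamS[OF that] reset by (simp add: lam'_def)
    show ?thesis
    proof (cases "s \<in> S")
      case True
      have eq: "{a. a < d \<and> lam' a = t} = A t" if "t \<in> S" "\<And>u. u \<in> S \<Longrightarrow> reset u \<noteq> t" for t
        using A[OF that(1)] that lamS by (auto simp: lam'_def C_def)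
      have "\<pi> s \<in> S" using True \<pi>S by blast
      then show ?thesis using eq[OF True] eq[of "\<pi> s"] not_reset A r\<pi> True by simp
    next
      case False
      then have "\<pi> s \<notin> S" using \<pi>bij inj by (metis bij_betw_imp_surj_on imageE inj_eq)
      then have "lam' a \<noteq> s" "lam' a \<noteq> \<pi> s" if "a < d" for a using lam'S[OF that] False by metis+
      then have "{a. a < d \<and> lam' a = s} = {}" "{a. a < d \<and> lam' a = \<pi> s} = {}" by simp_all
      then show ?thesis by (simp only:)
    qed
  qed simp
  have "{a. a < d \<and> lam' a \<noteq> lam a} \<subseteq> (\<Union>s\<in>S. C s - A s)"
    using lamS by (auto simp: lam'_def C_def)
  then have "card {a. a < d \<and> lam' a \<noteq> lam a} \<le> card (\<Union>s\<in>S. C s - A s)"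
    using fin Cd by (intro card_mono) auto
  also have "\<dots> \<le> (\<Sum>s\<in>S. card (C s - A s))" using fin by (rule card_UN_le)
  finally have "real (card {a. a < d \<and> lam' a \<noteq> lam a}) \<le> (\<Sum>s\<in>S. real (card (C s - A s)))"
    by (metis of_nat_mono of_nat_sum)
  also have "\<dots> \<le> (\<Sum>s\<in>S. \<Sum>k<len s. cost ((\<pi> ^^ k) s))"
  proof (rule sum_mono)
    fix s assume s: "s \<in> S"
    have "card (C s - A s) = c s - r s" using A[OF s] Cd by (metis c_def card_Diff_subset finite_subset)
    moreover obtain k where "r s = c ((\<pi> ^^ k) s)" using rex[OF s] by blast
    ultimately show "real (card (C s - A s)) \<le> (\<Sum>k<len s. cost ((\<pi> ^^ k) s))"
      using osc[OF s, of 0 k] rle[OF s] by (simp add: of_nat_diff)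
  qed
  also have "\<dots> = (\<Sum>s\<in>S. len s * cost s)"
  proof -
    define N where "N = Max (len ` S)"
    have N: "len s \<le> N" if "s \<in> S" for s using that fin by (simp add: N_def)
    have "(\<Sum>s\<in>S. \<Sum>k<len s. cost ((\<pi> ^^ k) s)) = (\<Sum>s\<in>S. \<Sum>k<N. if k < len s then cost ((\<pi> ^^ k) s) else 0)"
      by (rule sum.cong[OF refl], rule sum.mono_neutral_cong_left) (use N in \<open>auto intro: order_less_le_trans\<close>)
    also have "\<dots> = (\<Sum>k<N. \<Sum>s\<in>S. if k < len s then cost ((\<pi> ^^ k) s) else 0)" by (rule sum.swap)
    also have "\<dots> = (\<Sum>k<N. \<Sum>s\<in>S. if k < len ((\<pi> ^^ k) s) then cost ((\<pi> ^^ k) s) else 0)"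
      by (intro sum.cong refl) (simp add: pwlen)
    also have "\<dots> = (\<Sum>k<N. \<Sum>s\<in>S. if k < len s then cost s else 0)"
      by (intro sum.cong refl sum.reindex_bij_betw[OF pwbij])
    also have "\<dots> = (\<Sum>s\<in>S. \<Sum>k<N. if k < len s then cost s else 0)" by (rule sum.swap)
    also have "\<dots> = (\<Sum>s\<in>S. \<Sum>k<len s. cost s)"
      by (rule sum.cong[OF refl], rule sum.mono_neutral_cong_right) (use N in \<open>auto intro: order_less_le_trans\<close>)
    finally show ?thesis by simp
  qed
  also have "\<dots> = (\<Sum>s\<in>S. len s * (if s \<in> G then out s else 0)) + (\<Sum>s\<in>S. len s * (if s \<in> G then inn (\<pi> s) else 0))"
    unfolding sum.distrib[symmetric] by (intro sum.cong refl) (simp add: cost_def distrib_left)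
  also have "(\<Sum>s\<in>S. len s * (if s \<in> G then inn (\<pi> s) else 0)) =
      (\<Sum>s\<in>S. len (\<pi> s) * (if \<pi> s \<in> \<pi> ` G then inn (\<pi> s) else 0))"
    using inj len by (intro sum.cong refl) (simp add: inj_image_mem_iff)
  also have "\<dots> = (\<Sum>s\<in>S. len s * (if s \<in> \<pi> ` G then inn s else 0))"
    by (rule sum.reindex_bij_betw[OF \<pi>bij])
  also have "(\<Sum>s\<in>S. len s * (if s \<in> G then out s else 0)) =
     (\<Sum>a<d. \<Sum>b<d. P a b * (if lam a \<noteq> \<pi> (lam b) then if lam b \<in> G then len (lam b) else 0 else 0))"
    unfolding out_def using lamS
    by (subst sum_weighted_mass[OF fin, symmetric]) (auto intro!: sum.cong)
  also have "(\<Sum>s\<in>S. len s * (if s \<in> \<pi> ` G then inn s else 0)) =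
     (\<Sum>a<d. \<Sum>b<d. P a b * (if lam a \<noteq> \<pi> (lam b) then if lam a \<in> \<pi> ` G then len (lam a) else 0 else 0))"
    unfolding inn_def using lamS
    by (subst sum_weighted_mass[OF fin, symmetric]) (auto intro!: sum.cong)
  finally have "real (card {a. a < d \<and> lam' a \<noteq> lam a}) \<le>
      (\<Sum>a<d. \<Sum>b<d. P a b * (if lam a = \<pi> (lam b) then 0 else
         (if lam b \<in> G then len (lam b) else 0) + (if lam a \<in> \<pi> ` G then len (lam a) else 0)))"
    unfolding sum.distrib[symmetric] distrib_left[symmetric]
    by (rule order_trans) (intro sum_mono, simp)
  then show ?thesis using cards by (intro exI[of _ lam']) (auto simp: lam'_def)
qed

text \<open>Besides the steps that do not shift the word, the rotation of labels fails at cuts, when a quiet period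
is entered or left, and at quiet words without repetition. The cuts and the last kind are rare on average over
the selection of blocks. The quiet periods have to be rarer, because their labels are
counted with weight \<open>k\<close>: an exit at time \<open>i\<close> means no cut during \<open>l\<close> times and then a cut, which happens at most
once within \<open>l\<close> times.\<close>

theorem coding:
  fixes x :: "nat \<Rightarrow> nat \<Rightarrow> bool" and k l Q :: nat and \<eta> :: real
  assumes kl: "1 \<le> k" "k \<le> l" and Q: "1 \<le> Q"
    and sh: "mass (\<lambda>a b. \<not> shifted k l (x b) (x a)) \<le> \<eta> * d"
  shows "\<exists>lam :: nat \<Rightarrow> (bool \<times> bool) list. (\<forall>a<d. fst (hd (lam a)) = x a (l + k)) \<and>
    (\<forall>s. card {a. a < d \<and> lam a = s} = card {a. a < d \<and> lam a = rotate1 s}) \<and>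
    mass (\<lambda>a b. lam a \<noteq> rotate1 (lam b)) \<le>
      d * ((8 * real l + 1) * \<eta> + (4 * real k + 1) * (\<eta> + 1 / l + l * \<eta>) + 1 / Q + (8 * real k + 2) * (1 - 1 / Q) ^ k)"
proof -
  define U where "U = {w :: bool list. length w = 4 * k}"
  have U: "finite U" using finite_lists_length_eq[of "UNIV :: bool set" "4 * k"] by (simp add: U_def)
  define J0 where "J0 = {a. a < d \<and> \<not> recurs k l (x a)}"
  define B where "B a = (\<lambda>i. blk k (x a) (l + i)) ` {..<k}" for a
  have B: "B a \<subseteq> U \<and> card (B a) = k" if "a \<in> J0" for a
  proof -
    have "inj_on (\<lambda>i. blk k (x a) (l + i)) {..<k}"
    proof (rule linorder_inj_onI)
      fix i j assume "i < j" "i \<in> {..<k}" "j \<in> {..<k}"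
      then show "blk k (x a) (l + i) \<noteq> blk k (x a) (l + j)" using that by (auto simp: J0_def recurs_def)
    qed auto
    then show ?thesis by (auto simp: B_def U_def blk_def card_image)
  qed
  have "\<exists>Z. real (card {b. b < d \<and> blk k (x b) l \<in> Z}) + (8 * real k + 2) * card {a \<in> J0. B a \<inter> Z = {}}
      \<le> d * (1 / Q + (8 * real k + 2) * (1 - 1 / Q) ^ k)"
  proof (rule random_marking[OF U _ _ _ Q])
    show "blk k (x b) l \<in> U" for b by (simp add: U_def blk_def)
    show "J0 \<subseteq> {..<d}" by (auto simp: J0_def)
    show "B a \<subseteq> U \<and> card (B a) = k" if "a \<in> J0" for a using B[OF that] .
  qed simp
  then obtain Z where Z: "real (card {b. b < d \<and> blk k (x b) l \<in> Z}) + (8 * real k + 2) * card {a \<in> J0. B a \<inter> Z = {}}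
      \<le> d * (1 / Q + (8 * real k + 2) * (1 - 1 / Q) ^ k)" by blast
  define H where "H w = (w \<in> Z)" for w
  define lam where "lam a = label k l H (x a)" for a
  define q where "q a = quiet k l H (x a) l" for a
  define J where "J a = (q a \<and> \<not> recurs k l (x a))" for a
  define n_cut where "n_cut = real (card {b. b < d \<and> cut_at k H (x b) l})"
  define n_J where "n_J = real (card {a. a < d \<and> J a})"
  have "card {a. a < d \<and> J a} \<le> card {a \<in> J0. B a \<inter> Z = {}}"
  proof (rule card_mono)
    show "{a. a < d \<and> J a} \<subseteq> {a \<in> J0. B a \<inter> Z = {}}"
      using kl by (auto simp: J_def q_def J0_def B_def quiet_def cut_at_def H_def)
  qed (simp add: J0_def)
  then have "(8 * real k + 2) * n_J \<le> (8 * real k + 2) * card {a \<in> J0. B a \<inter> Z = {}}"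
    unfolding n_J_def by (intro mult_left_mono) auto
  moreover have "n_cut = card {b. b < d \<and> blk k (x b) l \<in> Z}" by (simp add: n_cut_def cut_at_def H_def)
  ultimately have hash: "n_cut + (8 * real k + 2) * n_J \<le> d * (1 / Q + (8 * real k + 2) * (1 - 1 / Q) ^ k)"
    using Z by linarith
  define ns where "ns a b = (\<not> shifted k l (x b) (x a))" for a b
  have ns: "mass ns \<le> \<eta> * d" using sh by (simp add: ns_def[abs_def])
  define X where "X = mass (\<lambda>a b. q b \<and> \<not> q a)"
  (* A stationary flow leaves a set as often as it enters it. *)
  have X': "mass (\<lambda>a b. \<not> q b \<and> q a) = X"
  proof -
    have "mass (\<lambda>a b. q b) = mass (\<lambda>a b. q b \<and> q a) + X" unfolding X_def by (rule mass_split)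
    moreover have "mass (\<lambda>a b. q a) = mass (\<lambda>a b. q a \<and> q b) + mass (\<lambda>a b. q a \<and> \<not> q b)" by (rule mass_split)
    ultimately show ?thesis by (simp add: mass_target mass_source conj_commute)
  qed
  have X: "X \<le> d * (\<eta> + 1 / l + l * \<eta>)"
  proof -
    define ex where "ex i a = (quiet k l H (x a) i \<and> cut_at k H (x a) (i + l))" for i a
    define z where "z i = real (card {a. a < d \<and> ex i a})" for i
    have "X \<le> mass ns + mass (\<lambda>a b. ex l b)"
      unfolding X_def
    proof (rule mass_le)
      fix a b assume qq: "q b \<and> \<not> q a"
      show "ns a b \<or> ex l b"
      proof (rule disjCI)
        assume "\<not> ex l b"
        show "ns a b"
        proof (rule ccontr)
          assume "\<not> ns a b"
          then have s: "shifted k l (x b) (x a)" by (simp add: ns_def)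
          obtain j where j: "l \<le> j" "j < l + l" "cut_at k H (x a) j" using qq by (auto simp: q_def quiet_def)
          then have "cut_at k H (x b) (Suc j)" using cut_at_shifted[OF s, of j H] by simp
          moreover have "\<not> cut_at k H (x b) i" if "l \<le> i" "i < l + l" for i using qq that by (auto simp: q_def quiet_def)
          ultimately have "Suc j = l + l" using j by (metis Suc_leI le_SucI le_neq_implies_less)
          then show False using \<open>\<not> ex l b\<close> \<open>cut_at k H (x b) (Suc j)\<close> qq by (auto simp: ex_def q_def)
        qed
      qed
    qed
    then have 1: "X \<le> mass ns + z l" by (simp add: mass_source z_def)
    have step: "z (Suc i) \<le> \<eta> * d + z i" if "Suc i \<le> l" for i
    proof -
      have "mass (\<lambda>a b. ex (Suc i) b) \<le> mass ns + mass (\<lambda>a b. ex i a)"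
        by (rule mass_le) (use that in \<open>auto simp: ns_def ex_def quiet_shifted cut_at_shifted\<close>)
      then show ?thesis using ns by (simp add: mass_target mass_source z_def)
    qed
    have \<eta>0: "0 \<le> \<eta> * d" using ns by (rule order_trans[rotated]) (rule mass_nonneg)
    (* By approximate stationarity, the exit event at time l is hardly more likely than at time i;
       the exit events at the times 1, ..., l exclude each other, so their average is at most 1/l. *)
    have far: "z l \<le> (l - i) * (\<eta> * d) + z i" if "i \<le> l" for i
      using that
    proof (induction i rule: inc_induct)
      case (step i)
      then have "real (l - i) = real (l - Suc i) + 1" by (simp add: of_nat_diff)
      then show ?case using step \<open>\<And>i. Suc i \<le> l \<Longrightarrow> z (Suc i) \<le> \<eta> * d + z i\<close>[of i] by (simp add: algebra_simps)
    qed simp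
    have "l * z l = (\<Sum>i\<in>{1..l}. z l)" by simp
    also have "\<dots> \<le> (\<Sum>i\<in>{1..l}. l * (\<eta> * d) + z i)"
    proof (rule sum_mono)
      fix i assume "i \<in> {1..l}"
      then have "z l \<le> (l - i) * (\<eta> * d) + z i" using far by simp
      also have "\<dots> \<le> l * (\<eta> * d) + z i" using \<eta>0 by (intro add_right_mono mult_right_mono) auto
      finally show "z l \<le> l * (\<eta> * d) + z i" .
    qed
    also have "\<dots> = l * (l * (\<eta> * d)) + (\<Sum>i\<in>{1..l}. z i)" by (simp add: sum.distrib)
    also have "(\<Sum>i\<in>{1..l}. z i) \<le> d"
    proof -
      have "(\<Sum>i\<in>{1..l}. z i) = card (\<Union>i\<in>{1..l}. {a. a < d \<and> ex i a})"
        unfolding z_def of_nat_sum[symmetric]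
      proof (subst card_UN_disjoint)
        have no: "\<not> (ex i a \<and> ex j a)" if "1 \<le> i" "i < j" "j \<le> l" for i j a
          using that by (auto simp: ex_def quiet_def)
        show "\<forall>i\<in>{1..l}. \<forall>j\<in>{1..l}. i \<noteq> j \<longrightarrow> {a. a < d \<and> ex i a} \<inter> {a. a < d \<and> ex j a} = {}"
        proof (intro ballI impI)
          fix i j assume "i \<in> {1..l}" "j \<in> {1..l}" "i \<noteq> j"
          then show "{a. a < d \<and> ex i a} \<inter> {a. a < d \<and> ex j a} = {}"
            using no[of i j] no[of j i] by (cases "i < j") auto
        qed
      qed auto
      also have "\<dots> \<le> card {..<d}" by (intro of_nat_mono card_mono) auto
      finally show ?thesis by simp
    qed
    finally have "l * z l \<le> l * (l * (\<eta> * d)) + d" by simp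
    then have "z l \<le> l * (\<eta> * d) + d / l" using kl by (simp add: field_simps)
    then show ?thesis using 1 ns by (simp add: algebra_simps)
  qed
  define S :: "(bool \<times> bool) list set" where "S = {s. 1 \<le> length s \<and> length s \<le> 2 * l \<and>
    (\<exists>m. \<forall>j. Suc j < length s \<longrightarrow> (rotate1 ^^ (m + j)) s \<in> unmarked_next)}"
  have rot_len: "(rotate1 ^^ length s) s = s" for s :: "(bool \<times> bool) list" by (simp flip: rotate_def)
  have ex: "\<exists>lam'. (\<forall>a<d. lam' a = lam a \<or> lam' a = [(fst (hd (lam a)), False)]) \<and>
      (\<forall>s. card {a. a < d \<and> lam' a = s} = card {a. a < d \<and> lam' a = rotate1 s}) \<and>
      card {a. a < d \<and> lam' a \<noteq> lam a} \<le>
      (\<Sum>a<d. \<Sum>b<d. P a b * (if lam a = rotate1 (lam b) then 0 else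
         (if lam b \<in> unmarked_next then length (lam b) else 0) + (if lam a \<in> rotate1 ` unmarked_next then length (lam a) else 0)))"
    proof (rule equalize_orbits[where S = S])
      have "S \<subseteq> {s. set s \<subseteq> UNIV \<and> length s \<le> 2 * l}" by (auto simp: S_def)
      then show "finite S" by (rule finite_subset) (rule finite_lists_length_le, simp)
      show "lam a \<in> S" for a
        using label_length(1,2)[OF kl, of H "x a"] label_arc[OF kl, of H "x a"] by (auto simp: S_def lam_def Suc_le_eq)
      show "inj (rotate1 :: (bool \<times> bool) list \<Rightarrow> _)" by (rule inj_rotate1)
      show "rotate1 ` S \<subseteq> S"
      proof
        fix t assume "t \<in> rotate1 ` S"
        then obtain s where s: "s \<in> S" "t = rotate1 s" by blast
        then obtain m where m: "\<And>j. Suc j < length s \<Longrightarrow> (rotate1 ^^ (m + j)) s \<in> unmarked_next" by (auto simp: S_def)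
        have eqm: "(rotate1 ^^ (m + (length s - 1) + j)) t = (rotate1 ^^ (m + j)) s" for j
        proof -
          have "(rotate1 ^^ (m + (length s - 1) + j)) t = (rotate1 ^^ Suc (m + (length s - 1) + j)) s"
            by (simp only: s funpow_Suc_right comp_apply)
          also have "Suc (m + (length s - 1) + j) = (m + j) + length s" using s by (auto simp: S_def)
          finally show ?thesis by (simp only: funpow_add comp_apply rot_len)
        qed
        have "\<forall>j. Suc j < length t \<longrightarrow> (rotate1 ^^ (m + (length s - 1) + j)) t \<in> unmarked_next"
        proof (intro allI impI)
          fix j assume "Suc j < length t"
          then have "Suc j < length s" using s(2) by simp
          then show "(rotate1 ^^ (m + (length s - 1) + j)) t \<in> unmarked_next" unfolding eqm by (rule m)
        qed
        moreover have "1 \<le> length t" "length t \<le> 2 * l" using s by (auto simp: S_def)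
        ultimately show "t \<in> S" unfolding S_def mem_Collect_eq by blast
      qed
      show "0 < length s \<and> length (rotate1 s) = length s \<and> (rotate1 ^^ length s) s = s" if "s \<in> S" for s
        using that rot_len by (auto simp: S_def)
      show "[(fst (hd s), False)] \<in> S \<and> rotate1 [(fst (hd s), False)] = [(fst (hd s), False)]" if "s \<in> S" for s
        using that by (auto simp: S_def)
      show "\<exists>m. \<forall>j. Suc j < length s \<longrightarrow> (rotate1 ^^ (m + j)) s \<in> unmarked_next" if "s \<in> S" for s
        using that by (auto simp: S_def)
    qed
  from ex obtain lam' where lam'_all: "\<forall>a<d. lam' a = lam a \<or> lam' a = [(fst (hd (lam a)), False)]"
    and cards_all: "\<forall>s. card {a. a < d \<and> lam' a = s} = card {a. a < d \<and> lam' a = rotate1 s}"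
    and count: "card {a. a < d \<and> lam' a \<noteq> lam a} \<le>
      (\<Sum>a<d. \<Sum>b<d. P a b * (if lam a = rotate1 (lam b) then 0 else
         (if lam b \<in> unmarked_next then length (lam b) else 0) + (if lam a \<in> rotate1 ` unmarked_next then length (lam a) else 0)))"
    by (elim exE conjE)
  note lam' = lam'_all[rule_format] and cards = cards_all[rule_format]
  define n_new where "n_new = real (card {a. a < d \<and> lam' a \<noteq> lam a})"
  have n_new: "n_new \<le> 4 * real l * (\<eta> * d) + 2 * real k * X + 4 * real k * n_J"
  proof -
    have "n_new \<le> (\<Sum>a<d. \<Sum>b<d. P a b * (4 * real l * of_bool (ns a b) + real k * of_bool (q b \<and> \<not> q a) + real k * of_bool (\<not> q b \<and> q a)
      + 2 * real k * of_bool (J b) + 2 * real k * of_bool (J a)))"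
      unfolding n_new_def
    proof (rule order_trans[OF count], intro sum_mono mult_left_mono P0)
      fix a b
      show "real (if lam a = rotate1 (lam b) then 0 else
         (if lam b \<in> unmarked_next then length (lam b) else 0) + (if lam a \<in> rotate1 ` unmarked_next then length (lam a) else 0))
        \<le> 4 * real l * of_bool (ns a b) + real k * of_bool (q b \<and> \<not> q a) + real k * of_bool (\<not> q b \<and> q a)
      + 2 * real k * of_bool (J b) + 2 * real k * of_bool (J a)"
        unfolding lam_def ns_def J_def q_def by (rule mismatch_cost[OF kl])
    qed
    also have "\<dots> = 4 * real l * mass ns + real k * X + real k * mass (\<lambda>a b. \<not> q b \<and> q a) + 2 * real k * mass (\<lambda>a b. J b) + 2 * real k * mass (\<lambda>a b. J a)"
      unfolding X_def mass_def sum_distrib_left sum.distrib[symmetric] by (intro sum.cong refl) (simp only: distrib_left mult.left_commute)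
    also have "\<dots> = 4 * real l * mass ns + 2 * real k * X + 4 * real k * n_J"
      unfolding X' by (simp add: mass_target mass_source n_J_def)
    also have "\<dots> \<le> 4 * real l * (\<eta> * d) + 2 * real k * X + 4 * real k * n_J"
      using ns by (intro add_right_mono mult_left_mono) auto
    finally show ?thesis .
  qed
  have viol: "mass (\<lambda>a b. lam a \<noteq> rotate1 (lam b)) \<le> \<eta> * d + X + 2 * n_J + n_cut"
  proof -
    have "mass (\<lambda>a b. lam a \<noteq> rotate1 (lam b)) \<le> mass ns + mass (\<lambda>a b. (q b \<and> \<not> q a) \<or> J b \<or> J a \<or> cut_at k H (x b) l)"
      by (rule mass_le) (use mismatch_cases[of k l "x b" "x a" H for a b] in \<open>auto simp: lam_def ns_def J_def q_def\<close>)
    moreover have "mass (\<lambda>a b. (q b \<and> \<not> q a) \<or> J b \<or> J a \<or> cut_at k H (x b) l) \<le> X + mass (\<lambda>a b. J b \<or> J a \<or> cut_at k H (x b) l)"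
      unfolding X_def by (rule mass_le) auto
    moreover have "mass (\<lambda>a b. J b \<or> J a \<or> cut_at k H (x b) l) \<le> mass (\<lambda>a b. J b) + mass (\<lambda>a b. J a \<or> cut_at k H (x b) l)"
      by (rule mass_le) auto
    moreover have "mass (\<lambda>a b. J a \<or> cut_at k H (x b) l) \<le> mass (\<lambda>a b. J a) + mass (\<lambda>a b. cut_at k H (x b) l)"
      by (rule mass_le) auto
    ultimately show ?thesis using ns by (simp add: mass_target mass_source n_J_def n_cut_def)
  qed
  have "mass (\<lambda>a b. lam' a \<noteq> rotate1 (lam' b)) \<le> mass (\<lambda>a b. lam a \<noteq> rotate1 (lam b)) + mass (\<lambda>a b. lam' a \<noteq> lam a \<or> lam' b \<noteq> lam b)"
    by (rule mass_le) auto
  moreover have "mass (\<lambda>a b. lam' a \<noteq> lam a \<or> lam' b \<noteq> lam b) \<le> mass (\<lambda>a b. lam' a \<noteq> lam a) + mass (\<lambda>a b. lam' b \<noteq> lam b)"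
    by (rule mass_le) auto
  ultimately have "mass (\<lambda>a b. lam' a \<noteq> rotate1 (lam' b)) \<le> \<eta> * d + X + 2 * n_J + n_cut + 2 * n_new"
    using viol by (simp add: mass_target mass_source n_new_def)
  also have "\<dots> \<le> (8 * real l + 1) * (\<eta> * d) + (4 * real k + 1) * X + (n_cut + (8 * real k + 2) * n_J)"
    using n_new by (simp add: algebra_simps)
  also have "\<dots> \<le> (8 * real l + 1) * (\<eta> * d) + (4 * real k + 1) * (d * (\<eta> + 1 / l + l * \<eta>)) + d * (1 / Q + (8 * real k + 2) * (1 - 1 / Q) ^ k)"
    using mult_left_mono[OF X, of "4 * real k + 1"] hash by linarith
  also have "\<dots> = d * ((8 * real l + 1) * \<eta> + (4 * real k + 1) * (\<eta> + 1 / l + l * \<eta>) + 1 / Q + (8 * real k + 2) * (1 - 1 / Q) ^ k)"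
    by (simp only: distrib_left mult.left_commute[of "real d"] mult.commute[of \<eta> "real d"] add.assoc)
  finally have "mass (\<lambda>a b. lam' a \<noteq> rotate1 (lam' b)) \<le> d * ((8 * real l + 1) * \<eta> + (4 * real k + 1) * (\<eta> + 1 / l + l * \<eta>) + 1 / Q + (8 * real k + 2) * (1 - 1 / Q) ^ k)" .
  moreover have "fst (hd (lam' a)) = x a (l + k)" if "a < d" for a
    using lam'[OF that] hd_label[OF kl, of H "x a"] by (auto simp: lam_def)
  ultimately show ?thesis using cards by (intro exI[of _ lam']) blast
qed

end

section \<open>Stability for matrices in the corner\<close>

text \<open>Conjugation, as an operator that is iterated: \<open>(cj T ^^ i) y\<close> is \<open>T\<^sup>-\<^sup>i y T\<^sup>i\<close>.\<close>

definition cj :: "fmat \<Rightarrow> fmat \<Rightarrow> fmat" where "cj T y = adj T * y * T"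

lemma bnd_cj: "T \<in> uni d \<Longrightarrow> bnd d y \<Longrightarrow> bnd d (cj T y)"
  by (simp add: cj_def bnd_mult bnd_adj uniD)

lemma cj_uni: "T \<in> uni d \<Longrightarrow> y \<in> uni d \<Longrightarrow> cj T y \<in> uni d"
  by (simp add: cj_def mult_uni adj_uni)

lemma cj_mult:
  assumes "T \<in> uni d" "bnd d x" "bnd d y" shows "cj T (x * y) = cj T x * cj T y"
  using uni_cancel(2)[OF assms(1) bnd_mult[OF assms(3) uniD(1)[OF assms(1)]]] by (simp add: cj_def mult.assoc)

lemma cj_diff: "cj T (x - y) = cj T x - cj T y"
  by (simp add: cj_def left_diff_distrib right_diff_distrib)

lemma cj_e: "T \<in> uni d \<Longrightarrow> cj T (e d) = e d"
  using uniD[of T d] by (simp add: cj_def e_mult bnd_adj)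

lemma norm_cj: "T \<in> uni d \<Longrightarrow> bnd d x \<Longrightarrow> norm (cj T x) = norm x"
  using norm_conj[OF adj_uni, of T d x] by (simp add: cj_def)

lemma cj_inverse: "T \<in> uni d \<Longrightarrow> bnd d x \<Longrightarrow> cj T (cj (adj T) x) = x"
  using uni_cancel(1)[of T d "x * adj T * T"] uni_cancel(4)[of T d x]
  by (simp add: cj_def mult.assoc bnd_mult bnd_adj uniD)

lemma bnd_cj_pow: "T \<in> uni d \<Longrightarrow> bnd d y \<Longrightarrow> bnd d ((cj T ^^ i) y)"
  by (induction i) (auto intro: bnd_cj)

lemma cj_pow_uni: "T \<in> uni d \<Longrightarrow> y \<in> uni d \<Longrightarrow> (cj T ^^ i) y \<in> uni d"
  by (induction i) (auto intro: cj_uni)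

lemma cj_pow_inverse:
  assumes "T \<in> uni d" "bnd d x" shows "(cj T ^^ i) ((cj (adj T) ^^ i) x) = x"
proof (induction i)
  case (Suc i)
  have "(cj T ^^ Suc i) ((cj (adj T) ^^ Suc i) x) = (cj T ^^ i) (cj T (cj (adj T) ((cj (adj T) ^^ i) x)))"
    by (simp add: funpow_swap1)
  then show ?case
    using cj_inverse[OF assms(1) bnd_cj_pow[OF adj_uni[OF assms(1)] assms(2)]] Suc by simp
qed simp

lemma norm_commutator_cj_pow:
  assumes T: "T \<in> uni d" and x: "bnd d x" and y: "bnd d y"
  shows "norm ((cj T ^^ i) x * (cj T ^^ i) y - (cj T ^^ i) y * (cj T ^^ i) x) = norm (x * y - y * x)"
proof (induction i)
  case (Suc i)
  let ?x = "(cj T ^^ i) x" and ?y = "(cj T ^^ i) y"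
  have b: "bnd d ?x" "bnd d ?y" using T x y by (auto intro: bnd_cj_pow)
  have "cj T ?x * cj T ?y - cj T ?y * cj T ?x = cj T (?x * ?y - ?y * ?x)"
    by (simp add: cj_mult[OF T] b cj_diff)
  then show ?case using Suc norm_cj[OF T, of "?x * ?y - ?y * ?x"] b by (simp add: bnd_diff bnd_mult)
qed simp

lemma norm_involution_cj_pow:
  assumes T: "T \<in> uni d" and x: "bnd d x"
  shows "norm ((cj T ^^ i) x * (cj T ^^ i) x - e d) = norm (x * x - e d)"
proof (induction i)
  case (Suc i)
  let ?x = "(cj T ^^ i) x"
  have b: "bnd d ?x" using T x by (rule bnd_cj_pow)
  have "cj T ?x * cj T ?x - e d = cj T (?x * ?x - e d)"
    by (simp add: cj_mult[OF T] b cj_diff cj_e[OF T])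
  then show ?case using Suc norm_cj[OF T, of "?x * ?x - e d"] b by (simp add: bnd_diff bnd_mult)
qed simp

lemma uni_col_sum: assumes "T \<in> uni d" "b < d" shows "(\<Sum>a<d. (cmod (entry T a b))\<^sup>2) = 1"
proof -
  have "(\<Sum>a<d. Re (cnj (entry T a b) * entry T a b)) = Re (entry (adj T * T) b b)"
    by (simp only: entry_mult_left[OF bnd_adj[OF uniD(1)[OF assms(1)]]] entry_adj Re_sum)
  then show ?thesis using assms by (simp only: Re_cnj_mult_self uniD(2)) (simp add: entry_e)
qed

lemma uni_row_sum: assumes "T \<in> uni d" "a < d" shows "(\<Sum>b<d. (cmod (entry T a b))\<^sup>2) = 1"
  using uni_col_sum[OF adj_uni[OF assms(1)] assms(2)] by simp

lemma sgnb_diff_sq: "(sgnb p - sgnb q)\<^sup>2 = 4 * of_bool (p \<noteq> q)" by (simp add: sgnb_def)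

text \<open>In the basis \<open>W\<close> of \<open>simultaneous_diagonalization\<close>, \<open>\<delta>\<close> bounds the distance of each conjugate of \<open>A\<close> to a diagonal
involution, \<open>\<eta>\<close> the probability that a step does not shift the word, and \<open>\<beta>\<close> the probability that it does not
rotate the label. The unitary \<open>T'\<close> permutes the label classes as the rotation does, and \<open>A'\<close> is on each class the sign at the
head of the label, so all conjugates of \<open>A'\<close> are diagonal in this basis.\<close>

theorem fmat_stability:
  fixes d k l Q :: nat and \<epsilon> \<delta> \<eta> \<beta> :: real
  assumes d: "0 < d" and A: "A \<in> uni d" and T: "T \<in> uni d" and kl: "1 \<le> k" "k \<le> l" and Q: "1 \<le> Q" and \<epsilon>: "0 < \<epsilon>"
    and inv: "norm (A * A - e d) \<le> \<epsilon> * sqrt d"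
    and comm: "\<And>i. i \<le> 2 * l + 4 * k \<Longrightarrow> norm (A * (cj T ^^ i) A - (cj T ^^ i) A * A) \<le> \<epsilon> * sqrt d"
  defines "\<delta> \<equiv> 8 * (real (2 * l + 4 * k + 1) + 1) * sqrt \<epsilon>"
  defines "\<eta> \<equiv> real (2 * l + 4 * k) * \<delta>\<^sup>2"
  defines "\<beta> \<equiv> (8 * real l + 1) * \<eta> + (4 * real k + 1) * (\<eta> + 1 / l + l * \<eta>) + 1 / Q + (8 * real k + 2) * (1 - 1 / Q) ^ k"
  shows "\<exists>A'\<in>uni d. \<exists>T'\<in>uni d. A' * A' = e d \<and> (\<forall>i. (cj T' ^^ i) A' * A' = A' * (cj T' ^^ i) A') \<and>
    norm (A - A') \<le> \<delta> * sqrt d \<and> norm (T - T') \<le> (2 * sqrt \<beta> + sqrt \<epsilon>) * sqrt d"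
proof -
  define n where "n = 2 * l + 4 * k + 1"
  define o' where "o' = l + k"
  (* The current letter of a word is its coordinate o', so A has to be the o'-th conjugate. *)
  define A0 where "A0 = (cj (adj T) ^^ o') A"
  have A0: "A0 \<in> uni d" unfolding A0_def by (intro cj_pow_uni adj_uni T A)
  define a where "a i = (cj T ^^ i) A0" for i
  have a: "a i \<in> uni d" for i unfolding a_def by (intro cj_pow_uni T A0)
  note ba = uniD(1)[OF a]
  have ao: "a o' = A" unfolding a_def A0_def by (rule cj_pow_inverse[OF T uniD(1)[OF A]])
  have a_inv: "norm (a i * a i - e d) \<le> \<epsilon> * sqrt d" for i
    using inv norm_involution_cj_pow[OF T uniD(1)[OF A0], of i] norm_involution_cj_pow[OF adj_uni[OF T] uniD(1)[OF A], of o']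
    by (simp add: a_def A0_def)
  have shift0: "norm (A0 * (cj T ^^ m) A0 - (cj T ^^ m) A0 * A0) = norm (A * (cj T ^^ m) A - (cj T ^^ m) A * A)" for m
  proof -
    have "norm (A0 * (cj T ^^ m) A0 - (cj T ^^ m) A0 * A0) =
      norm ((cj T ^^ o') A0 * (cj T ^^ o') ((cj T ^^ m) A0) - (cj T ^^ o') ((cj T ^^ m) A0) * (cj T ^^ o') A0)"
      by (rule norm_commutator_cj_pow[symmetric, OF T uniD(1)[OF A0] bnd_cj_pow[OF T uniD(1)[OF A0]]])
    also have "(cj T ^^ o') ((cj T ^^ m) A0) = (cj T ^^ m) ((cj T ^^ o') A0)"
      by (metis add.commute comp_apply funpow_add)
    also have "(cj T ^^ o') A0 = A" using ao by (simp add: a_def)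
    finally show ?thesis .
  qed
  have a_comm_le: "norm (a j * a i - a i * a j) \<le> \<epsilon> * sqrt d" if "i \<le> j" "j < n" for i j
  proof -
    have "a j = (cj T ^^ i) ((cj T ^^ (j - i)) A0)" using that(1) unfolding a_def by (metis comp_apply funpow_add le_add_diff_inverse)
    then have "norm (a i * a j - a j * a i) = norm (A0 * (cj T ^^ (j - i)) A0 - (cj T ^^ (j - i)) A0 * A0)"
      using norm_commutator_cj_pow[OF T uniD(1)[OF A0] bnd_cj_pow[OF T uniD(1)[OF A0]], of i "j - i"] by (simp add: a_def)
    also have "\<dots> \<le> \<epsilon> * sqrt d" unfolding shift0 using that by (intro comm) (simp add: n_def)
    finally show ?thesis by (simp add: norm_minus_commute[of "a j * a i"])
  qed
  have a_comm: "norm (a j * a i - a i * a j) \<le> \<epsilon> * sqrt d" if "i < n" "j < n" for i j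
    using a_comm_le[of i j] a_comm_le[of j i] that norm_minus_commute[of "a j * a i"] by (cases "i \<le> j") auto
  have "\<exists>W\<in>uni d. \<exists>x :: nat \<Rightarrow> nat \<Rightarrow> bool. \<forall>i<n.
    norm (map a [0..<n] ! i * W - W * diag d (\<lambda>a. sgnb (x a i))) \<le> 8 * (real n + 1) * sqrt \<epsilon> * sqrt d"
    by (rule simultaneous_diagonalization) (use a a_comm a_inv \<epsilon> d in auto)
  then obtain W and x :: "nat \<Rightarrow> nat \<Rightarrow> bool" where W: "W \<in> uni d"
    and aW: "\<And>i. i < n \<Longrightarrow> norm (a i * W - W * diag d (\<lambda>a. sgnb (x a i))) \<le> \<delta> * sqrt d"
    unfolding \<delta>_def n_def[symmetric] by (auto simp: mult.assoc)
  note bW = uniD(1)[OF W]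
  define D where "D i = diag d (\<lambda>a. sgnb (x a i))" for i
  have bD: "bnd d (D i)" for i by (simp add: D_def)
  define b where "b i = W * D i * adj W" for i
  have bb: "bnd d (b i)" for i by (simp add: b_def bnd_mult bW bD bnd_adj)
  have ab: "norm (a i - b i) \<le> \<delta> * sqrt d" if "i < n" for i
  proof -
    have "(a i - b i) * W = a i * W - W * D i"
      using uni_cancel(4)[OF W bnd_mult[OF bW bD[of i]]] by (simp add: b_def left_diff_distrib)
    then have "norm (a i - b i) = norm (a i * W - W * D i)"
      using norm_uni_right[OF W bnd_diff[OF ba bb]] by metis
    then show ?thesis using aW[OF that] by (simp add: D_def)
  qed
  define T1 where "T1 = adj W * T * W"
  have T1: "T1 \<in> uni d" unfolding T1_def by (intro mult_uni adj_uni W T)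
  define P where "P i j = (cmod (entry T1 i j))\<^sup>2" for i j
  interpret bistochastic d P
    by unfold_locales (simp_all add: P_def uni_col_sum[OF T1] uni_row_sum[OF T1])
  have step: "mass (\<lambda>p q. x p i \<noteq> x q (Suc i)) \<le> \<delta>\<^sup>2 * d" if i: "Suc i < n" for i
  proof -
    have aT: "a i * T = T * a (Suc i)"
      using uni_cancel(2)[OF T bnd_mult[OF ba uniD(1)[OF T]]] by (simp add: a_def cj_def mult.assoc)
    have "b i * T - T * b (Suc i) = T * (a (Suc i) - b (Suc i)) - (a i - b i) * T"
      using aT by (simp add: left_diff_distrib right_diff_distrib)
    then have "norm (b i * T - T * b (Suc i)) \<le> norm (T * (a (Suc i) - b (Suc i))) + norm ((a i - b i) * T)"
      by (metis norm_triangle_ineq4)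
    also have "\<dots> = norm (a (Suc i) - b (Suc i)) + norm (a i - b i)"
      using norm_uni_left[OF T bnd_diff[OF ba bb]] norm_uni_right[OF T bnd_diff[OF ba bb]] by simp
    also have "\<dots> \<le> 2 * (\<delta> * sqrt d)" using ab[of i] ab[of "Suc i"] i by simp
    finally have 1: "norm (b i * T - T * b (Suc i)) \<le> 2 * (\<delta> * sqrt d)" .
    have "cj W (b i * T - T * b (Suc i)) = D i * T1 - T1 * D (Suc i)"
    proof -
      have "cj W (b i) = D i" for i
        using uni_cancel(1)[OF W bD[of i]] uniD(2)[OF W] e_mult(2)[OF bD[of i]] by (simp add: cj_def b_def mult.assoc)
      then show ?thesis
        by (simp add: cj_diff cj_mult[OF W] bb uniD(1)[OF T]) (simp add: cj_def T1_def)
    qed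
    then have 2: "norm (D i * T1 - T1 * D (Suc i)) \<le> 2 * (\<delta> * sqrt d)"
      using 1 norm_cj[OF W, of "b i * T - T * b (Suc i)"] bb uniD(1)[OF T] by (simp add: bnd_diff bnd_mult)
    have "4 * mass (\<lambda>p q. x p i \<noteq> x q (Suc i)) = (norm (D i * T1 - T1 * D (Suc i)))\<^sup>2"
      unfolding mass_def norm_sq[OF bnd_diff[OF bnd_mult[OF bD uniD(1)[OF T1]] bnd_mult[OF uniD(1)[OF T1] bD]]] sum_distrib_left
    proof (intro sum.cong refl)
      fix p q assume "p \<in> {..<d}" "q \<in> {..<d}"
      then have "entry (D i * T1 - T1 * D (Suc i)) p q = complex_of_real (sgnb (x p i) - sgnb (x q (Suc i))) * entry T1 p q"
        by (simp add: D_def entry_diag_mult entry_mult_diag algebra_simps)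
      then have "(cmod (entry (D i * T1 - T1 * D (Suc i)) p q))\<^sup>2 = (sgnb (x p i) - sgnb (x q (Suc i)))\<^sup>2 * P p q"
        by (simp only: norm_mult norm_of_real power_mult_distrib power2_abs P_def)
      then show "4 * (P p q * of_bool (x p i \<noteq> x q (Suc i))) = (cmod (entry (D i * T1 - T1 * D (Suc i)) p q))\<^sup>2"
        by (simp only: sgnb_diff_sq mult.assoc mult.commute[of "P p q"])
    qed
    also have "\<dots> \<le> (2 * (\<delta> * sqrt d))\<^sup>2" using 2 by (intro power_mono) auto
    also have "\<dots> = 4 * (\<delta>\<^sup>2 * d)" by (simp add: power_mult_distrib)
    finally show ?thesis by simp
  qed
  have "mass (\<lambda>p q. \<not> shifted k l (x q) (x p)) \<le> (\<Sum>i\<in>{..<2 * l + 4 * k}. mass (\<lambda>p q. x p i \<noteq> x q (Suc i)))"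
    by (rule mass_UN_le) (auto simp: shifted_def)
  also have "\<dots> \<le> (\<Sum>i\<in>{..<2 * l + 4 * k}. \<delta>\<^sup>2 * d)" by (intro sum_mono step) (simp add: n_def)
  also have "\<dots> = \<eta> * d" by (simp add: \<eta>_def)
  finally have sh: "mass (\<lambda>p q. \<not> shifted k l (x q) (x p)) \<le> \<eta> * d" .
  obtain lam :: "nat \<Rightarrow> (bool \<times> bool) list" where lam: "\<And>p. p < d \<Longrightarrow> fst (hd (lam p)) = x p o'"
    and cards: "\<And>s. card {p. p < d \<and> lam p = s} = card {p. p < d \<and> lam p = rotate1 s}"
    and viol: "mass (\<lambda>p q. lam p \<noteq> rotate1 (lam q)) \<le> d * \<beta>"
    using coding[OF kl Q sh] unfolding o'_def \<beta>_def by blast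
  have \<gamma>: "0 < sqrt \<epsilon> * sqrt d" using \<epsilon> d by simp
  obtain U where U: "U \<in> uni d"
    and TU: "norm (T1 - U) \<le> 2 * sqrt (\<Sum>p<d. \<Sum>q<d. if lam p = rotate1 (lam q) then 0 else (cmod (entry T1 p q))\<^sup>2) + sqrt \<epsilon> * sqrt d"
    and com_all: "\<forall>f. U * diag d (\<lambda>q. f (rotate1 (lam q))) = diag d (\<lambda>p. f (lam p)) * U"
    using masked_rounding[OF T1 inj_rotate1 cards \<gamma>] by (elim bexE conjE)
  note com = com_all[rule_format]
  have "(\<Sum>p<d. \<Sum>q<d. if lam p = rotate1 (lam q) then 0 else (cmod (entry T1 p q))\<^sup>2) =
     mass (\<lambda>p q. lam p \<noteq> rotate1 (lam q))"
    unfolding mass_def by (intro sum.cong refl) (simp add: P_def)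
  then have "sqrt (\<Sum>p<d. \<Sum>q<d. if lam p = rotate1 (lam q) then 0 else (cmod (entry T1 p q))\<^sup>2) \<le> sqrt (d * \<beta>)"
    using viol by simp
  then have TU': "norm (T1 - U) \<le> (2 * sqrt \<beta> + sqrt \<epsilon>) * sqrt d"
    using TU by (simp add: real_sqrt_mult algebra_simps)
  define f where "f s = sgnb (fst (hd s))" for s :: "(bool \<times> bool) list"
  define A' where "A' = W * diag d (\<lambda>p. f (lam p)) * adj W"
  define T' where "T' = W * U * adj W"
  have Do: "diag d (\<lambda>p. f (lam p)) = D o'" unfolding D_def by (rule diag_cong) (simp add: f_def lam)
  have A'b: "A' = b o'" by (simp add: A'_def b_def Do)
  have "A' * A' = e d"
    unfolding A'_def conj_diag_mult[OF W] f_def by (simp add: conj_diag_one[OF W])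
  moreover have "adj A' = A'" by (simp add: A'_def adj_mult mult.assoc)
  ultimately have A'uni: "A' \<in> uni d" by (simp add: uni_def A'b bb)
  have T': "T' \<in> uni d" unfolding T'_def by (intro mult_uni adj_uni W U)
  have pow: "(cj T' ^^ i) A' = W * diag d (\<lambda>p. f ((rotate1 ^^ i) (lam p))) * adj W" for i
  proof (induction i)
    case (Suc i)
    let ?D = "diag d (\<lambda>p. f ((rotate1 ^^ i) (lam p)))"
    let ?D' = "diag d (\<lambda>p. f ((rotate1 ^^ Suc i) (lam p)))"
    have UD: "U * ?D' = ?D * U" using com[of "\<lambda>s. f ((rotate1 ^^ i) s)"] by (simp add: funpow_swap1)
    have "cj T' (W * ?D * adj W) = W * (adj U * (adj W * (W * (?D * (adj W * (W * (U * adj W)))))))"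
      by (simp add: cj_def T'_def adj_mult mult.assoc)
    also have "adj W * (W * (U * adj W)) = U * adj W"
      by (rule uni_cancel(1)[OF W bnd_mult[OF uniD(1)[OF U] bnd_adj[OF bW]]])
    also have "adj W * (W * (?D * (U * adj W))) = ?D * (U * adj W)"
      by (rule uni_cancel(1)[OF W]) (simp add: bnd_mult bnd_adj bW uniD(1)[OF U])
    also have "W * (adj U * (?D * (U * adj W))) = W * (adj U * (U * (?D' * adj W)))"
      using UD by (metis mult.assoc)
    also have "adj U * (U * (?D' * adj W)) = ?D' * adj W"
      by (rule uni_cancel(1)[OF U bnd_mult[OF bnd_diag bnd_adj[OF bW]]])
    finally show ?case using Suc by (simp add: mult.assoc)
  qed (simp add: A'_def)
  have comm': "(cj T' ^^ i) A' * A' = A' * (cj T' ^^ i) A'" for i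
    unfolding pow unfolding A'_def conj_diag_mult[OF W] by (simp add: mult.commute)
  have o'n: "o' < n" using kl by (simp add: n_def o'_def)
  have "norm (A - A') \<le> \<delta> * sqrt d" using ab[OF o'n] by (simp add: ao A'b)
  moreover have "norm (T - T') = norm (T1 - U)"
  proof -
    have "cj W (T - T') = T1 - U"
      using uni_cancel(1)[OF W uniD(1)[OF U]] uniD(2)[OF W] e_mult(2)[OF uniD(1)[OF U]]
      by (simp add: cj_diff) (simp add: cj_def T1_def T'_def mult.assoc)
    then show ?thesis using norm_cj[OF W, of "T - T'"] uniD(1)[OF T] uniD(1)[OF T'] by (simp add: bnd_diff)
  qed
  ultimately show ?thesis using A'uni T' \<open>A' * A' = e d\<close> comm' TU' by (intro bexI[of _ A'] bexI[of _ T']) auto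
qed

section \<open>Translation of the matrix notions\<close>

text \<open>The two directions of the identification of matrices of the dimension \<open>d\<close> with the corner.\<close>

definition fm :: "nat \<Rightarrow> complex mat \<Rightarrow> fmat" where "fm d A = fmat_of d (\<lambda>i j. A $$ (i, j))"
definition mf :: "nat \<Rightarrow> fmat \<Rightarrow> complex mat" where "mf d x = mat d d (\<lambda>(i, j). entry x i j)"

lemma bnd_fm [simp]: "bnd d (fm d A)" by (simp add: fm_def)
lemma mf_carrier [simp]: "mf d x \<in> carrier_mat d d" by (simp add: mf_def)
lemma mf_fm: "A \<in> carrier_mat d d \<Longrightarrow> mf d (fm d A) = A"
  by (rule eq_matI) (auto simp: mf_def fm_def)
lemma fm_mf: "bnd d x \<Longrightarrow> fm d (mf d x) = x"
  by (rule fmat_eqI) (auto simp: mf_def fm_def entry_zero_left entry_zero_right)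
lemma fm_inj: "A \<in> carrier_mat d d \<Longrightarrow> B \<in> carrier_mat d d \<Longrightarrow> fm d A = fm d B \<Longrightarrow> A = B"
  by (metis mf_fm)

lemma fm_mult: "A \<in> carrier_mat d d \<Longrightarrow> B \<in> carrier_mat d d \<Longrightarrow> fm d (A * B) = fm d A * fm d B"
  by (rule fmat_eqI, unfold entry_mult_left[OF bnd_fm]) (auto simp: fm_def scalar_prod_def lessThan_atLeast0)
lemma fm_diff: "A \<in> carrier_mat d d \<Longrightarrow> B \<in> carrier_mat d d \<Longrightarrow> fm d (A - B) = fm d A - fm d B"
  by (rule fmat_eqI) (auto simp: fm_def)
lemma fm_one: "fm d (1\<^sub>m d) = e d" by (rule fmat_eqI) (auto simp: fm_def entry_e)
lemma fm_adjoint: "A \<in> carrier_mat d d \<Longrightarrow> fm d (mat_adjoint A) = adj (fm d A)"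
  by (rule fmat_eqI) (auto simp: fm_def mat_adjoint_index)
lemma hs_norm_fm: assumes A: "A \<in> carrier_mat d d" shows "hs_norm A = norm (fm d A) / sqrt d"
proof -
  have "Re (ntr (mat_adjoint A * A)) = Re (\<Sum>i<d. entry (fm d (mat_adjoint A * A)) i i) / d"
    using A by (simp add: ntr_def fm_def)
  also have "(\<Sum>i<d. entry (fm d (mat_adjoint A * A)) i i) = (\<Sum>i<d. \<Sum>k<d. cnj (entry (fm d A) k i) * entry (fm d A) k i)"
    using A by (simp add: fm_mult mat_adjoint_carrier fm_adjoint entry_mult_left[OF bnd_adj[OF bnd_fm]])
  also have "Re \<dots> = (norm (fm d A))\<^sup>2"
    unfolding norm_sq[OF bnd_fm] Re_sum by (subst sum.swap) (simp only: Re_cnj_mult_self)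
  finally show ?thesis by (simp add: hs_norm_def real_sqrt_divide)
qed

lemma unitary_group_carrier: "A \<in> carrier (unitary_group d) \<longleftrightarrow> A \<in> carrier_mat d d \<and> fm d A \<in> uni d"
proof -
  have "fm d A \<in> uni d \<longleftrightarrow> mat_adjoint A * A = 1\<^sub>m d \<and> A * mat_adjoint A = 1\<^sub>m d" if A: "A \<in> carrier_mat d d"
  proof -
    note A' = mat_adjoint_carrier[OF A]
    have "adj (fm d A) * fm d A = e d \<longleftrightarrow> mat_adjoint A * A = 1\<^sub>m d"
      using fm_inj[of "mat_adjoint A * A" d "1\<^sub>m d"] A A' by (metis fm_adjoint fm_mult fm_one mult_carrier_mat one_carrier_mat)
    moreover have "fm d A * adj (fm d A) = e d \<longleftrightarrow> A * mat_adjoint A = 1\<^sub>m d"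
      using fm_inj[of "A * mat_adjoint A" d "1\<^sub>m d"] A A' by (metis fm_adjoint fm_mult fm_one mult_carrier_mat one_carrier_mat)
    ultimately show ?thesis by (simp add: uni_def)
  qed
  then show ?thesis by (auto simp: unitary_group_def)
qed

lemma mf_unitary: "x \<in> uni d \<Longrightarrow> mf d x \<in> carrier (unitary_group d)"
  by (simp add: unitary_group_carrier fm_mf uniD(1))

context
  fixes d :: nat and A T :: "complex mat"
  assumes A: "A \<in> carrier_mat d d" and T: "T \<in> carrier (unitary_group d)"
begin

lemma pow_carrier: "T [^]\<^bsub>unitary_group d\<^esub> (i :: int) \<in> carrier_mat d d"
  using group.int_pow_closed[OF group_unitary_group T, of i] by (simp add: unitary_group_def)

lemma fm_conj_pow:
  "fm d (T [^]\<^bsub>unitary_group d\<^esub> (- int n) * A * T [^]\<^bsub>unitary_group d\<^esub> (int n)) = (cj (fm d T) ^^ n) (fm d A)"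
proof -
  define p where "p n = fm d (T [^]\<^bsub>unitary_group d\<^esub> (int n))" for n
  have Tc: "T \<in> carrier_mat d d" using T by (simp add: unitary_group_carrier)
  have p0: "p 0 = e d" unfolding p_def of_nat_0 int_pow_0 by (simp add: unitary_group_def fm_one)
  have pS: "p (Suc n) = p n * fm d T" for n
  proof -
    have "T [^]\<^bsub>unitary_group d\<^esub> (int (Suc n)) = T [^]\<^bsub>unitary_group d\<^esub> (int n) * T"
      unfolding int_pow_int by (simp add: unitary_group_def)
    then show ?thesis unfolding p_def by (simp only: fm_mult[OF pow_carrier Tc])
  qed
  have neg: "T [^]\<^bsub>unitary_group d\<^esub> (- int n) = mat_adjoint (T [^]\<^bsub>unitary_group d\<^esub> (int n))"
    by (simp add: group.int_pow_neg[OF group_unitary_group T] inv_unitary_group group.int_pow_closed[OF group_unitary_group T])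
  have "fm d (T [^]\<^bsub>unitary_group d\<^esub> (- int n) * A * T [^]\<^bsub>unitary_group d\<^esub> (int n)) = adj (p n) * fm d A * p n"
    unfolding neg by (simp add: p_def fm_mult fm_adjoint A pow_carrier mat_adjoint_carrier mult_carrier_mat[of _ d d])
  also have "\<dots> = (cj (fm d T) ^^ n) (fm d A)"
  proof (induction n)
    case (Suc n)
    have "adj (p (Suc n)) * fm d A * p (Suc n) = cj (fm d T) (adj (p n) * fm d A * p n)"
      by (simp add: pS adj_mult cj_def mult.assoc)
    then show ?case using Suc by simp
  qed (simp add: p0 e_mult)
  finally show ?thesis .
qed

text \<open>For a negative exponent, the relation for its absolute value is conjugated by the power of \<open>T\<close>.\<close>

lemma conj_pow_commute:
  assumes "\<And>n. (cj (fm d T) ^^ n) (fm d A) * fm d A = fm d A * (cj (fm d T) ^^ n) (fm d A)"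
  shows "(T [^]\<^bsub>unitary_group d\<^esub> (- i) * A * T [^]\<^bsub>unitary_group d\<^esub> i) * A =
    A * (T [^]\<^bsub>unitary_group d\<^esub> (- i) * A * T [^]\<^bsub>unitary_group d\<^esub> (i :: int))"
proof -
  define p where "p i = fm d (T [^]\<^bsub>unitary_group d\<^esub> (i :: int))" for i
  have bp: "bnd d (p i)" for i by (simp add: p_def)
  have pp: "p (- i) * p i = e d" for i
  proof -
    have "T [^]\<^bsub>unitary_group d\<^esub> (- i) \<otimes>\<^bsub>unitary_group d\<^esub> T [^]\<^bsub>unitary_group d\<^esub> i = \<one>\<^bsub>unitary_group d\<^esub>"
      using group.int_pow_mult[OF group_unitary_group T, of "- i" i] by (simp add: int_pow_0)
    then have "T [^]\<^bsub>unitary_group d\<^esub> (- i) * T [^]\<^bsub>unitary_group d\<^esub> i = 1\<^sub>m d" by (simp add: unitary_group_def)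
    then show ?thesis unfolding p_def by (metis fm_mult fm_one pow_carrier)
  qed
  have tr: "fm d (T [^]\<^bsub>unitary_group d\<^esub> (- i) * A * T [^]\<^bsub>unitary_group d\<^esub> i) = p (- i) * fm d A * p i" for i
    by (simp add: p_def fm_mult A pow_carrier mult_carrier_mat[of _ d d])
  have nn: "p (- int n) * fm d A * p (int n) * fm d A = fm d A * (p (- int n) * fm d A * p (int n))" for n
    using assms[of n] fm_conj_pow[of n] tr[of "int n"] by simp
  have "p (- i) * fm d A * p i * fm d A = fm d A * (p (- i) * fm d A * p i)"
  proof (cases "0 \<le> i")
    case True
    then show ?thesis using nn[of "nat i"] by simp
  next
    case False
    define n where "n = nat (- i)"
    have i: "i = - int n" using False by (simp add: n_def)
    let ?p = "p (int n)" and ?q = "p (- int n)" and ?a = "fm d A"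
    have pq: "?p * ?q = e d" "?q * ?p = e d" using pp[of "int n"] pp[of "- int n"] by simp_all
    have "?p * (?q * ?a * ?p * ?a) * ?q = ?p * (?a * (?q * ?a * ?p)) * ?q" using nn[of n] by simp
    moreover have "?p * (?q * ?a * ?p * ?a) * ?q = ?a * (?p * ?a * ?q)"
    proof -
      have "?p * (?q * ?a * ?p * ?a) * ?q = (?p * ?q) * ?a * ?p * ?a * ?q" by (simp add: mult.assoc)
      then show ?thesis by (simp add: pq e_mult mult.assoc)
    qed
    moreover have "?p * (?a * (?q * ?a * ?p)) * ?q = ?p * ?a * ?q * ?a"
    proof -
      have "?p * (?a * (?q * ?a * ?p)) * ?q = ?p * ?a * ?q * ?a * (?p * ?q)" by (simp add: mult.assoc)
      then show ?thesis by (simp add: pq e_mult bp bnd_mult)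
    qed
    ultimately show ?thesis unfolding i by simp
  qed
  then have "fm d ((T [^]\<^bsub>unitary_group d\<^esub> (- i) * A * T [^]\<^bsub>unitary_group d\<^esub> i) * A) =
    fm d (A * (T [^]\<^bsub>unitary_group d\<^esub> (- i) * A * T [^]\<^bsub>unitary_group d\<^esub> i))"
    by (simp add: fm_mult A pow_carrier mult_carrier_mat[of _ d d] tr flip: mult.assoc)
  then show ?thesis by (rule fm_inj[rotated 2]) (simp_all add: A pow_carrier mult_carrier_mat[of _ d d])
qed

end

section \<open>Choice of the scales\<close>

text \<open>The product of \<open>1 - 1/q\<close> and \<open>1 + 1/q\<close> is at most 1, and Bernoulli's inequality bounds the power of the second
factor from below.\<close>

lemma geometric_decay:
  fixes q :: real
  assumes q: "1 \<le> q" and m: "0 < m"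
  shows "(1 - 1 / q) ^ m \<le> q / real m"
proof -
  have "(1 - 1 / q) ^ m * (1 + 1 / q) ^ m = (1 - (1 / q)\<^sup>2) ^ m"
    by (simp add: power_mult_distrib[symmetric] power2_eq_square algebra_simps)
  also have "\<dots> \<le> 1"
  proof -
    have "(1 / q)\<^sup>2 \<le> 1" using q by (intro power_le_one) auto
    then show ?thesis by (intro power_le_one) auto
  qed
  finally have le: "(1 - 1 / q) ^ m * (1 + 1 / q) ^ m \<le> 1" .
  have "0 \<le> 1 / q" using q by simp
  then have "1 + real m * (1 / q) \<le> (1 + 1 / q) ^ m" by (intro Bernoulli_inequality) linarith
  then have "m / q \<le> (1 + 1 / q) ^ m" by simp
  moreover have "0 \<le> (1 - 1 / q) ^ m" using q by simp
  ultimately have "(1 - 1 / q) ^ m * (m / q) \<le> 1" using le by (meson mult_left_mono order_trans)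
  then show ?thesis using q m by (simp add: field_simps)
qed

text \<open>The scales are \<open>Q \<sim> \<kappa>\<^sup>-\<^sup>2\<close>, \<open>k \<sim> \<kappa>\<^sup>-\<^sup>4\<close> and \<open>l \<sim> \<kappa>\<^sup>-\<^sup>6\<close>, so the window fits easily into \<open>2M \<sim> \<kappa>\<^sup>-\<^sup>2\<^sup>1\<close>. The hypothesis gives
\<open>\<epsilon> \<sim> \<kappa>\<^sup>4\<^sup>9\<close>, and the errors amount to \<open>Q\<^sup>1\<^sup>4 \<epsilon>\<close>, up to a constant that is absorbed by \<open>2\<^sup>2\<^sup>2\<^sup>0\<close>.\<close>

lemma parameters:
  fixes \<kappa> \<epsilon> :: real and M :: int
  assumes \<kappa>: "0 < \<kappa>" "\<kappa> < 2" and M: "M = \<lceil>2 ^ 220 * \<kappa> powi (- 21)\<rceil>" and \<epsilon>: "\<epsilon> = 1 * \<kappa> ^ 7 / (real_of_int M)\<^sup>2"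
  obtains k l Q :: nat and \<delta> \<eta> \<beta> :: real where "1 \<le> k" "k \<le> l" "1 \<le> Q" "0 < \<epsilon>" "int (2 * l + 4 * k) \<le> 2 * M"
    "\<delta> = 8 * (real (2 * l + 4 * k + 1) + 1) * sqrt \<epsilon>"
    "\<eta> = real (2 * l + 4 * k) * \<delta>\<^sup>2"
    "\<beta> = (8 * real l + 1) * \<eta> + (4 * real k + 1) * (\<eta> + 1 / l + l * \<eta>) + 1 / Q + (8 * real k + 2) * (1 - 1 / Q) ^ k"
    "\<delta> \<le> \<kappa>" "2 * sqrt \<beta> + sqrt \<epsilon> \<le> \<kappa>"
proof -
  define u where "u = 1 / \<kappa>"
  have u: "1 / 2 < u" "\<kappa> = 1 / u" using \<kappa> by (simp_all add: u_def field_simps)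
  (* An integer of order 1 / \<kappa>: all scales are polynomials in t. *)
  define t where "t = nat \<lceil>2 / \<kappa>\<rceil>"
  have t: "2 * u \<le> t" "t \<le> 4 * u"
  proof -
    have "0 \<le> 2 / \<kappa>" using \<kappa> by simp
    then have "real t = of_int \<lceil>2 / \<kappa>\<rceil>" unfolding t_def by (simp add: of_nat_nat)
    moreover have "2 / \<kappa> = 2 * u" by (simp add: u_def)
    ultimately show "2 * u \<le> t" "t \<le> 4 * u"
      using u(1) of_int_ceiling_le_add_one[of "2 / \<kappa>"] le_of_int_ceiling[of "2 / \<kappa>"] by linarith+
  qed
  have t1: "1 \<le> t" using t u by (cases t) auto
  (* 1 / Q, the density of the cuts, has to be of order \<kappa>^2. The power of Q in k makes the
     probability of k uncut distinct blocks, multiplied by k, of the same order, and l = 5 k Q makes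
     the exit probability 1 / l, multiplied by the maximal period k, of the same order. *)
  define Q where "Q = 64 * t ^ 2"
  define k where "k = 18 * Q ^ 2"
  define l where "l = 5 * k * Q"
  define q where "q = real Q"
  have Q1: "1 \<le> Q" using t1 by (simp add: Q_def)
  have q1: "1 \<le> q" using Q1 by (simp add: q_def)
  have kq: "real k = 18 * q\<^sup>2" and lq: "real l = 90 * q ^ 3"
    by (simp_all add: k_def l_def q_def power2_eq_square power3_eq_cube)
  have k1: "1 \<le> k" using Q1 by (simp add: k_def)
  have "k * 1 \<le> k * (5 * Q)" using Q1 by (intro mult_le_mono) auto
  then have kl: "k \<le> l" by (simp add: l_def mult.commute mult.left_commute)
  have M_ge: "2 ^ 220 * u ^ 21 \<le> real_of_int M"
  proof -
    have "\<kappa> powi (- 21) = u ^ 21" using \<kappa> by (simp add: u_def power_int_minus power_one_over inverse_eq_divide)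
    then show ?thesis unfolding M by (metis le_of_int_ceiling)
  qed
  have u0: "0 < u" using u by simp
  have M0: "0 < real_of_int M" using M_ge u0 by (metis less_le_trans mult_pos_pos zero_less_numeral zero_less_power)
  have \<epsilon>0: "0 < \<epsilon>" using \<epsilon> M0 \<kappa> by simp
  have \<epsilon>u: "\<epsilon> * u ^ 49 \<le> 1 / 2 ^ 440"
  proof -
    have "(2 ^ 220 * u ^ 21)\<^sup>2 \<le> (real_of_int M)\<^sup>2" using M_ge u0 by (intro power_mono) auto
    then have "(2 ^ 440 * u ^ 42) * \<epsilon> \<le> (real_of_int M)\<^sup>2 * \<epsilon>"
      using \<epsilon>0 by (intro mult_right_mono) (simp_all add: power_mult_distrib flip: power_mult)
    also have "(real_of_int M)\<^sup>2 * \<epsilon> = \<kappa> ^ 7" using M0 by (simp add: \<epsilon>)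
    also have "\<dots> = 1 / u ^ 7" by (simp add: u(2) power_one_over)
    finally have "(2 ^ 440 * u ^ 42) * \<epsilon> * u ^ 7 \<le> 1" using u0 by (simp only: pos_le_divide_eq zero_less_power)
    then have "2 ^ 440 * (\<epsilon> * (u ^ 42 * u ^ 7)) \<le> 1" by (simp only: mult.assoc mult.commute mult.left_commute)
    moreover have "u ^ 42 * u ^ 7 = u ^ 49" by (simp flip: power_add)
    ultimately show ?thesis by (simp add: field_simps)
  qed
  have q_u: "q \<le> 2 ^ 10 * u\<^sup>2"
  proof -
    have "(real t)\<^sup>2 \<le> (4 * u)\<^sup>2" using t by (intro power_mono) auto
    then show ?thesis by (simp add: q_def Q_def power_mult_distrib)
  qed
  (* All error terms involving \<eta> add up to at most 2^50 q^14 \<epsilon>, which is below 1 / q by this bound. *)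
  have q15: "q ^ 15 * \<epsilon> \<le> 1 / 2 ^ 271"
  proof -
    have "q ^ 15 \<le> (2 ^ 10 * u\<^sup>2) ^ 15" using q_u q1 by (intro power_mono) auto
    also have "\<dots> = 2 ^ 150 * u ^ 30" by (simp add: power_mult_distrib flip: power_mult)
    also have "\<dots> \<le> 2 ^ 150 * (u ^ 30 * (2 * u) ^ 19)"
    proof -
      have "1 \<le> (2 * u) ^ 19" using u by (intro one_le_power) simp
      then have "u ^ 30 * 1 \<le> u ^ 30 * (2 * u) ^ 19" using u0 by (intro mult_left_mono) auto
      then show ?thesis by (intro mult_left_mono) auto
    qed
    also have "\<dots> = 2 ^ 169 * u ^ 49" by (simp add: power_mult_distrib flip: power_add)
    finally have "q ^ 15 * \<epsilon> \<le> 2 ^ 169 * u ^ 49 * \<epsilon>" using \<epsilon>0 by (intro mult_right_mono) auto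
    also have "\<dots> = 2 ^ 169 * (\<epsilon> * u ^ 49)" by (simp only: mult.assoc mult.commute)
    also have "\<dots> \<le> 2 ^ 169 * (1 / 2 ^ 440)" using \<epsilon>u by (intro mult_left_mono) auto
    also have "\<dots> = 1 / 2 ^ 271" by simp
    finally show ?thesis .
  qed
  define \<delta> where "\<delta> = 8 * (real (2 * l + 4 * k + 1) + 1) * sqrt \<epsilon>"
  define \<eta> where "\<eta> = real (2 * l + 4 * k) * \<delta>\<^sup>2"
  define \<beta> where "\<beta> = (8 * real l + 1) * \<eta> + (4 * real k + 1) * (\<eta> + 1 / l + l * \<eta>) + 1 / Q + (8 * real k + 2) * (1 - 1 / Q) ^ k"
  have l1: "1 \<le> real l" "1 \<le> real k" "real k \<le> real l" using k1 kl by auto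
  have \<delta>sq: "\<delta>\<^sup>2 \<le> 4096 * (real l)\<^sup>2 * \<epsilon>"
  proof -
    have "\<delta> = 8 * (2 * real l + 4 * real k + 2) * sqrt \<epsilon>" by (simp add: \<delta>_def)
    then have "\<delta>\<^sup>2 = 8\<^sup>2 * (2 * real l + 4 * real k + 2)\<^sup>2 * (sqrt \<epsilon>)\<^sup>2" by (simp only: power_mult_distrib)
    also have "\<dots> = 64 * (2 * real l + 4 * real k + 2)\<^sup>2 * \<epsilon>" using \<epsilon>0 by simp
    also have "\<dots> \<le> 64 * (8 * real l)\<^sup>2 * \<epsilon>"
      using l1 \<epsilon>0 by (intro mult_right_mono mult_left_mono power_mono) auto
    finally show ?thesis by (simp add: power_mult_distrib)
  qed
  have \<eta>0: "0 \<le> \<eta>" by (simp add: \<eta>_def)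
  have \<eta>le: "\<eta> \<le> 2 ^ 35 * q ^ 9 * \<epsilon>"
  proof -
    have "\<eta> \<le> 6 * real l * (4096 * (real l)\<^sup>2 * \<epsilon>)"
      unfolding \<eta>_def using l1 \<delta>sq by (intro mult_mono) auto
    also have "\<dots> = 24576 * 729000 * q ^ 9 * \<epsilon>"
      by (simp add: lq power_mult_distrib flip: power_mult)
    also have "\<dots> \<le> 2 ^ 35 * q ^ 9 * \<epsilon>" using q1 \<epsilon>0 by (intro mult_right_mono) auto
    finally show ?thesis .
  qed
  have main: "19 * (real k * real l) * \<eta> \<le> 1 / q"
  proof -
    have "19 * (real k * real l) = 30780 * q ^ 5" by (simp add: kq lq)
    then have "19 * (real k * real l) * \<eta> \<le> 2 ^ 15 * q ^ 5 * (2 ^ 35 * q ^ 9 * \<epsilon>)"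
      using \<eta>le \<eta>0 q1 by (simp only:) (intro mult_mono, auto)
    also have "\<dots> = 2 ^ 50 * q ^ 14 * \<epsilon>" by (simp flip: power_add)
    finally have "19 * (real k * real l) * \<eta> * q \<le> 2 ^ 50 * q ^ 14 * \<epsilon> * q" using q1 by (intro mult_right_mono) auto
    also have "\<dots> = 2 ^ 50 * (q ^ 15 * \<epsilon>)" by (simp add: eval_nat_numeral)
    also have "\<dots> \<le> 2 ^ 50 * (1 / 2 ^ 271)" using q15 by (intro mult_left_mono) auto
    also have "\<dots> \<le> 1" by simp
    finally show ?thesis using q1 by (simp add: pos_le_divide_eq)
  qed
  have b1: "(8 * real l + 1) * \<eta> + (4 * real k + 1) * (\<eta> + l * \<eta>) \<le> 1 / q"
  proof -
    have "(8 * real l + 1) * \<eta> \<le> 9 * (real k * real l) * \<eta>"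
    proof -
      have "1 * real l \<le> real k * real l" using l1 by (intro mult_right_mono) auto
      then have "8 * real l + 1 \<le> 9 * (real k * real l)" using l1 by linarith
      then show ?thesis using \<eta>0 by (rule mult_right_mono)
    qed
    moreover have "(4 * real k + 1) * (\<eta> + l * \<eta>) \<le> (5 * real k) * (2 * (l * \<eta>))"
    proof -
      have "1 * \<eta> \<le> real l * \<eta>" using l1 \<eta>0 by (intro mult_right_mono) auto
      then have "\<eta> + l * \<eta> \<le> 2 * (l * \<eta>)" by linarith
      moreover have "4 * real k + 1 \<le> 5 * real k" using l1 by linarith
      ultimately show ?thesis using \<eta>0 by (intro mult_mono) auto
    qed
    ultimately show ?thesis using main by (simp add: algebra_simps)
  qed
  have b2: "(4 * real k + 1) * (1 / l) \<le> 1 / q"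
  proof -
    have "real l = 5 * real k * q" by (simp add: l_def q_def)
    moreover have "(4 * real k + 1) / (5 * real k * q) \<le> (5 * real k) / (5 * real k * q)"
      using l1 q1 by (intro divide_right_mono) auto
    moreover have "(5 * real k) / (5 * real k * q) = 1 / q" using l1 by simp
    ultimately show ?thesis by simp
  qed
  have b3: "(8 * real k + 2) * (1 - 1 / Q) ^ k \<le> 1 / q"
  proof -
    define m where "m = 6 * Q ^ 2"
    have m: "0 < m" "k = m * 3" "real m = 6 * q\<^sup>2" using Q1 by (simp_all add: m_def k_def q_def)
    have 0: "0 \<le> 1 - 1 / q" using q1 by simp
    have "(1 - 1 / q) ^ m \<le> q / real m" by (rule geometric_decay[OF q1 m(1)])
    also have "\<dots> = 1 / (6 * q)" using q1 by (simp add: m(3) power2_eq_square)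
    finally have "((1 - 1 / q) ^ m) ^ 3 \<le> (1 / (6 * q)) ^ 3" using 0 by (intro power_mono) auto
    then have "(1 - 1 / q) ^ k \<le> 1 / (216 * q ^ 3)" by (simp add: m(2) power_mult power_one_over power_mult_distrib)
    then have "(8 * real k + 2) * (1 - 1 / q) ^ k \<le> (180 * q\<^sup>2) * (1 / (216 * q ^ 3))"
      using kq l1 0 by (intro mult_mono) auto
    also have "\<dots> \<le> 1 / q" using q1 by (simp add: power2_eq_square power3_eq_cube field_simps)
    finally show ?thesis by (simp add: q_def)
  qed
  have "\<beta> = ((8 * real l + 1) * \<eta> + (4 * real k + 1) * (\<eta> + l * \<eta>)) + (4 * real k + 1) * (1 / l) + 1 / q + (8 * real k + 2) * (1 - 1 / Q) ^ k"
    by (simp add: \<beta>_def q_def algebra_simps)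
  then have "\<beta> \<le> 4 * (1 / q)" using b1 b2 b3 by linarith
  also have "\<dots> = (1 / (4 * t))\<^sup>2" by (simp add: q_def Q_def power_one_over power_mult_distrib)
  finally have "sqrt \<beta> \<le> 1 / (4 * t)" by (intro real_le_lsqrt) auto
  moreover have tk: "1 / t \<le> \<kappa> / 2"
  proof -
    have "1 / real t \<le> 1 / (2 * u)" using t u0 by (intro divide_left_mono) auto
    then show ?thesis by (simp add: u(2))
  qed
  ultimately have \<beta>: "2 * sqrt \<beta> \<le> \<kappa> / 4" by simp
  have "1 * \<delta>\<^sup>2 \<le> \<eta>" unfolding \<eta>_def using l1 by (intro mult_right_mono) auto
  moreover have "1 * \<eta> \<le> 19 * (real k * real l) * \<eta>"
  proof -
    have "1 * 1 \<le> real k * real l" using l1 by (intro mult_mono) auto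
    then show ?thesis using \<eta>0 by (intro mult_right_mono) auto
  qed
  ultimately have "\<delta>\<^sup>2 \<le> 1 / q" using main by linarith
  also have "1 / q = (1 / (8 * t))\<^sup>2" by (simp add: q_def Q_def power_one_over power_mult_distrib)
  finally have "\<delta> \<le> 1 / (8 * t)" by (rule power2_le_imp_le) simp
  then have \<delta>: "\<delta> \<le> \<kappa> / 16" using tk by simp
  have "1 * sqrt \<epsilon> \<le> \<delta>" unfolding \<delta>_def using \<epsilon>0 by (intro mult_right_mono) auto
  then have fin: "\<delta> \<le> \<kappa>" "2 * sqrt \<beta> + sqrt \<epsilon> \<le> \<kappa>" using \<delta> \<beta> \<kappa> by auto
  have "int (2 * l + 4 * k) \<le> 2 * M"
  proof -
    have "real (2 * l + 4 * k) \<le> 6 * real l" using l1 by simp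
    also have "\<dots> = 540 * q ^ 3" by (simp add: lq)
    also have "\<dots> \<le> 2 ^ 10 * (2 ^ 10 * u\<^sup>2) ^ 3" using q_u q1 by (intro mult_mono power_mono) auto
    also have "\<dots> = 2 ^ 40 * u ^ 6" by (simp add: power_mult_distrib flip: power_mult)
    also have "\<dots> \<le> 2 ^ 40 * (u ^ 6 * (2 * u) ^ 15)"
    proof -
      have "1 \<le> (2 * u) ^ 15" using u by (intro one_le_power) simp
      then have "u ^ 6 * 1 \<le> u ^ 6 * (2 * u) ^ 15" using u0 by (intro mult_left_mono) auto
      then show ?thesis by (intro mult_left_mono) auto
    qed
    also have "\<dots> = 2 ^ 55 * u ^ 21" by (simp add: power_mult_distrib flip: power_add)
    also have "\<dots> \<le> 2 ^ 220 * u ^ 21" using u0 by (intro mult_right_mono) auto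
    also have "\<dots> \<le> real_of_int M" by (rule M_ge)
    finally show ?thesis using M0 by linarith
  qed
  then show ?thesis using that[OF k1 kl Q1 \<epsilon>0 _ \<delta>_def \<eta>_def \<beta>_def fin] by blast
qed

lemma mat_square: "A \<in> carrier_mat d d \<Longrightarrow> A ^\<^sub>m 2 = A * A"
  by (simp add: numeral_2_eq_2)

lemma hs_norm_diff:
  assumes "A \<in> carrier_mat d d" "B \<in> carrier_mat d d"
  shows "hs_norm (A - B) = norm (fm d A - fm d B) / sqrt d"
  by (simp only: hs_norm_fm[OF minus_carrier_mat[OF assms(2)]] fm_diff[OF assms])

lemma hs_norm_unitary_one:
  assumes "A \<in> carrier (unitary_group d)" shows "hs_norm (A - 1\<^sub>m d) \<le> 2" and "d = 0 \<Longrightarrow> hs_norm (A - 1\<^sub>m d) = 0"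
proof -
  have A: "A \<in> carrier_mat d d" "fm d A \<in> uni d" using assms by (auto simp: unitary_group_carrier)
  have eq: "hs_norm (A - 1\<^sub>m d) = norm (fm d A - e d) / sqrt d"
    by (simp only: hs_norm_diff[OF A(1) one_carrier_mat] fm_one)
  have "norm (fm d A - e d) \<le> norm (fm d A) + norm (e d)" by (rule norm_triangle_ineq4)
  also have "\<dots> = 2 * sqrt d" by (simp add: norm_uni[OF A(2)] norm_e)
  finally show "hs_norm (A - 1\<^sub>m d) \<le> 2" unfolding eq by (cases "d = 0") (simp_all add: field_simps)
  show "d = 0 \<Longrightarrow> hs_norm (A - 1\<^sub>m d) = 0" unfolding eq by simp
qed

definition has_commuting_model :: "real \<Rightarrow> nat \<Rightarrow> complex mat \<Rightarrow> complex mat \<Rightarrow> bool" where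
  "has_commuting_model \<kappa> d A T \<longleftrightarrow>
    (\<exists>A' \<in> carrier (unitary_group d). \<exists>T' \<in> carrier (unitary_group d).
      A' ^\<^sub>m 2 = 1\<^sub>m d \<and>
      (\<forall>i :: int.
        (T' [^]\<^bsub>unitary_group d\<^esub> (- i) * A' * T' [^]\<^bsub>unitary_group d\<^esub> i) * A' =
        A' * (T' [^]\<^bsub>unitary_group d\<^esub> (- i) * A' * T' [^]\<^bsub>unitary_group d\<^esub> i)) \<and>
      hs_norm (A - A') \<le> \<kappa> \<and>
      hs_norm (T - T') \<le> \<kappa>)"

text \<open>Any two unitaries have distance at most 2, so the identity matrices serve as the model.\<close>

lemma trivial_model:
  assumes "A \<in> carrier (unitary_group d)" "T \<in> carrier (unitary_group d)" "0 < \<kappa>" "2 \<le> \<kappa> \<or> d = 0"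
  shows "has_commuting_model \<kappa> d A T"
proof -
  have 1: "1\<^sub>m d \<in> carrier (unitary_group d)" by (simp add: unitary_group_carrier fm_one e_uni)
  have "(cj (e d) ^^ n) (e d) = e d" for n by (induction n) (simp_all add: cj_e e_uni)
  then have c: "(cj (fm d (1\<^sub>m d)) ^^ n) (fm d (1\<^sub>m d)) * fm d (1\<^sub>m d) = fm d (1\<^sub>m d) * (cj (fm d (1\<^sub>m d)) ^^ n) (fm d (1\<^sub>m d))" for n
    by (simp add: fm_one)
  have "hs_norm (A - 1\<^sub>m d) \<le> \<kappa>" "hs_norm (T - 1\<^sub>m d) \<le> \<kappa>"
    using hs_norm_unitary_one[OF assms(1)] hs_norm_unitary_one[OF assms(2)] assms(3,4) by fastforce+
  moreover have "(1\<^sub>m d :: complex mat) ^\<^sub>m 2 = 1\<^sub>m d" by (simp add: mat_square[of _ d])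
  ultimately show ?thesis using conj_pow_commute[OF one_carrier_mat 1 c] 1
    unfolding has_commuting_model_def by (intro bexI[of _ "1\<^sub>m d"]) auto
qed

theorem commuting_model_exists:
  fixes \<kappa> \<epsilon> :: real and M :: int
  assumes \<kappa>: "0 < \<kappa>" and M: "M = \<lceil>2 ^ 220 * \<kappa> powi (- 21)\<rceil>" and \<epsilon>: "\<epsilon> = 1 * \<kappa> ^ 7 / (real_of_int M)\<^sup>2"
    and A: "A \<in> carrier (unitary_group d)" and T: "T \<in> carrier (unitary_group d)"
    and hyp1: "hs_norm (A ^\<^sub>m 2 - 1\<^sub>m d) \<le> \<epsilon>"
    and hyp2: "\<And>i. 0 \<le> i \<Longrightarrow> i \<le> 2 * M \<Longrightarrow>
      hs_norm (commutator A (T [^]\<^bsub>unitary_group d\<^esub> (- i) * A * T [^]\<^bsub>unitary_group d\<^esub> i)) \<le> \<epsilon>"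
  shows "has_commuting_model \<kappa> d A T"
proof (cases "2 \<le> \<kappa> \<or> d = 0")
  case True
  then show ?thesis by (rule trivial_model[OF A T \<kappa>])
next
  case False
  then have \<kappa>2: "\<kappa> < 2" and d: "0 < d" by auto
  then have sd: "0 < sqrt d" by simp
  obtain k l Q :: nat and \<delta> \<eta> \<beta> :: real where kl: "1 \<le> k" "k \<le> l" and Q: "1 \<le> Q" and \<epsilon>0: "0 < \<epsilon>"
    and window: "int (2 * l + 4 * k) \<le> 2 * M"
    and eqs: "\<delta> = 8 * (real (2 * l + 4 * k + 1) + 1) * sqrt \<epsilon>"
      "\<eta> = real (2 * l + 4 * k) * \<delta>\<^sup>2"
      "\<beta> = (8 * real l + 1) * \<eta> + (4 * real k + 1) * (\<eta> + 1 / l + l * \<eta>) + 1 / Q + (8 * real k + 2) * (1 - 1 / Q) ^ k"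
    and fin: "\<delta> \<le> \<kappa>" "2 * sqrt \<beta> + sqrt \<epsilon> \<le> \<kappa>"
    by (rule parameters[OF \<kappa> \<kappa>2 M \<epsilon>])
  have Ac: "A \<in> carrier_mat d d" "fm d A \<in> uni d" and Tc: "T \<in> carrier_mat d d" "fm d T \<in> uni d"
    using A T by (auto simp: unitary_group_carrier)
  have inv: "norm (fm d A * fm d A - e d) \<le> \<epsilon> * sqrt d"
  proof -
    have "hs_norm (A ^\<^sub>m 2 - 1\<^sub>m d) = norm (fm d A * fm d A - e d) / sqrt d"
      by (simp only: mat_square[OF Ac(1)] hs_norm_diff[OF mult_carrier_mat[OF Ac(1) Ac(1)] one_carrier_mat] fm_one fm_mult[OF Ac(1) Ac(1)])
    then show ?thesis using hyp1 sd by (simp add: pos_divide_le_eq)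
  qed
  have comm: "norm (fm d A * (cj (fm d T) ^^ i) (fm d A) - (cj (fm d T) ^^ i) (fm d A) * fm d A) \<le> \<epsilon> * sqrt d"
    if i: "i \<le> 2 * l + 4 * k" for i
  proof -
    define B where "B = T [^]\<^bsub>unitary_group d\<^esub> (- int i) * A * T [^]\<^bsub>unitary_group d\<^esub> (int i)"
    have B: "B \<in> carrier_mat d d" unfolding B_def
      by (intro mult_carrier_mat[of _ d d] pow_carrier[OF Ac(1) T] Ac(1))
    have fB: "fm d B = (cj (fm d T) ^^ i) (fm d A)" unfolding B_def by (rule fm_conj_pow[OF Ac(1) T])
    have "hs_norm (commutator A B) \<le> \<epsilon>" unfolding B_def using i window by (intro hyp2) auto
    moreover have "hs_norm (commutator A B) = norm (fm d A * fm d B - fm d B * fm d A) / sqrt d"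
      by (simp only: commutator_def hs_norm_diff[OF mult_carrier_mat[OF Ac(1) B] mult_carrier_mat[OF B Ac(1)]] fm_mult[OF Ac(1) B] fm_mult[OF B Ac(1)])
    ultimately show ?thesis using sd by (simp add: fB pos_divide_le_eq)
  qed
  obtain a b where a: "a \<in> uni d" and b: "b \<in> uni d" and aa: "a * a = e d"
    and ab: "\<forall>i. (cj b ^^ i) a * a = a * (cj b ^^ i) a"
    and close: "norm (fm d A - a) \<le> \<delta> * sqrt d" "norm (fm d T - b) \<le> (2 * sqrt \<beta> + sqrt \<epsilon>) * sqrt d"
    using fmat_stability[OF d Ac(2) Tc(2) kl Q \<epsilon>0 inv comm] unfolding eqs by blast
  have fa: "fm d (mf d a) = a" "fm d (mf d b) = b" using a b by (simp_all add: fm_mf uniD(1))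
  have near: "hs_norm (X - mf d x) \<le> \<kappa>"
    if X: "X \<in> carrier_mat d d" and x: "bnd d x" "norm (fm d X - x) \<le> r * sqrt d" "r \<le> \<kappa>" for X x r
  proof -
    have "hs_norm (X - mf d x) = norm (fm d X - x) / sqrt d"
      by (simp only: hs_norm_diff[OF X mf_carrier] fm_mf[OF x(1)])
    also have "\<dots> \<le> r" using x(2) sd by (simp add: pos_divide_le_eq)
    finally show ?thesis using x(3) by simp
  qed
  have "mf d a ^\<^sub>m 2 = 1\<^sub>m d"
    unfolding mat_square[OF mf_carrier] by (rule fm_inj[of _ d]) (simp_all add: fm_mult fa aa fm_one mult_carrier_mat[of _ d d])
  moreover have "(mf d b [^]\<^bsub>unitary_group d\<^esub> (- i) * mf d a * mf d b [^]\<^bsub>unitary_group d\<^esub> i) * mf d a =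
            mf d a * (mf d b [^]\<^bsub>unitary_group d\<^esub> (- i) * mf d a * mf d b [^]\<^bsub>unitary_group d\<^esub> i)" for i :: int
    by (rule conj_pow_commute[OF mf_carrier mf_unitary[OF b]]) (use ab in \<open>simp add: fa\<close>)
  moreover have "hs_norm (A - mf d a) \<le> \<kappa>" using near[OF Ac(1) uniD(1)[OF a] close(1) fin(1)] .
  moreover have "hs_norm (T - mf d b) \<le> \<kappa>" using near[OF Tc(1) uniD(1)[OF b] close(2) fin(2)] .
  ultimately show ?thesis using mf_unitary[OF a] mf_unitary[OF b] unfolding has_commuting_model_def by blast
qed

theorem theorem1p1:
  shows "\<exists>C c :: real. C > 0 \<and> c > 0 \<and>
    (\<forall>\<kappa> :: real. \<kappa> > 0 \<longrightarrow>
      (let M = \<lceil>C * \<kappa> powi (-21)\<rceil>;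
           \<epsilon> = c * \<kappa> ^ 7 / (real_of_int M) ^ 2
       in
        \<forall>d :: nat. \<forall>A \<in> carrier (unitary_group d). \<forall>T \<in> carrier (unitary_group d).
          hs_norm (A ^\<^sub>m 2 - 1\<^sub>m d) \<le> \<epsilon> \<and>
          (\<forall>i :: int. 0 \<le> i \<and> i \<le> 2 * M \<longrightarrow>
            hs_norm (commutator A
              (T [^]\<^bsub>unitary_group d\<^esub> (- i) * A * T [^]\<^bsub>unitary_group d\<^esub> i)) \<le> \<epsilon>)
          \<longrightarrow>
          (\<exists>A' \<in> carrier (unitary_group d). \<exists>T' \<in> carrier (unitary_group d).
            A' ^\<^sub>m 2 = 1\<^sub>m d \<and>
            (\<forall>i :: int.
              (T' [^]\<^bsub>unitary_group d\<^esub> (- i) * A' * T' [^]\<^bsub>unitary_group d\<^esub> i) * A' =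
              A' * (T' [^]\<^bsub>unitary_group d\<^esub> (- i) * A' * T' [^]\<^bsub>unitary_group d\<^esub> i)) \<and>
            hs_norm (A - A') \<le> \<kappa> \<and>
            hs_norm (T - T') \<le> \<kappa>)))"
proof (rule exI[of _ "2 ^ 220"], rule exI[of _ 1], unfold Let_def has_commuting_model_def[symmetric], intro conjI allI impI ballI)
  fix \<kappa> :: real and d A T
  assume "0 < \<kappa>" "A \<in> carrier (unitary_group d)" "T \<in> carrier (unitary_group d)"
    and "hs_norm (A ^\<^sub>m 2 - 1\<^sub>m d) \<le> 1 * \<kappa> ^ 7 / (real_of_int \<lceil>2 ^ 220 * \<kappa> powi (- 21)\<rceil>)\<^sup>2 \<and>
      (\<forall>i. 0 \<le> i \<and> i \<le> 2 * \<lceil>2 ^ 220 * \<kappa> powi (- 21)\<rceil> \<longrightarrow>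
        hs_norm (commutator A (T [^]\<^bsub>unitary_group d\<^esub> (- i) * A * T [^]\<^bsub>unitary_group d\<^esub> i))
        \<le> 1 * \<kappa> ^ 7 / (real_of_int \<lceil>2 ^ 220 * \<kappa> powi (- 21)\<rceil>)\<^sup>2)"
  then show "has_commuting_model \<kappa> d A T" by (intro commuting_model_exists[OF _ refl refl]) blast+
qed simp_all

end
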